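(* Assume the following. (1) For some $L>0$, $\|\nabla f_i(x)-\nabla f_i(y)\|\le L\|x-y\|$ for all $i\in[n]$, $x,y\in\mathbb{R}^d$, and there is $f_\star>-\infty$ with $f_i(x)\ge f_\star$ for all $i$, $x$. (2) There are $\rho_{\max}\ge\rho_{\min}>0$ and $\bar\rho_{\max}\ge\bar\rho_{\min}>0$ with $\rho_{\min}\mathbf{K}\preceq\mathbf{A}^\top\mathbf{R}\mathbf{A}\preceq\rho_{\max}\mathbf{K}$ and $\bar\rho_{\min}\mathbf{K}\preceq\mathbf{A}^\top\mathbf{A}\preceq\bar\rho_{\max}\mathbf{K}$. (3) For each $i$ there is $\sigma_i\ge0$ with $\mathbb{E}_{\xi_i\sim\mathbb{P}_i}\|\nabla f_i(x;\xi_i)-\nabla f_i(x)\|^2\le\sigma_i^2$ for all $x$; put $\bar\sigma^2=\frac1n\sum_{i}\sigma_i^2$. (4) There is $\sigma_A\ge0$ with $\mathbb{E}_{\xi_a\sim\mathbb{P}_a}\|\mathbf{A}(\xi_a)^\top\mathbf{A}\mathbf{x}-\mathbf{A}^\top\mathbf{R}\mathbf{A}\mathbf{x}\|^2\le\sigma_A^2\|\mathbf{x}\|_{\mathbf{K}}^2$ for all $\mathbf{x}\in\mathbb{R}^{nd}$. (5) For some $L_{\mathsf s}>0$, $\mathbb{E}_{\xi}\|\nabla f_i(x;\xi)-\nabla f_i(y;\xi)\|^2\le L_{\mathsf s}^2\|x-y\|^2$ for all $i$, $x,y\in\mathbb{R}^d$. Let $\mathsf a,\mathsf b,\mathsf c,\mathsf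 d,\mathsf e,\mathsf f,\mathsf g>0$ be constants, write $S=L_{\mathsf s}^2+L^2$, $P=\rho_{\max}^2+\bar\rho_{\max}^2$, $G=L_{\mathsf s}^2+L^2+\frac{\gamma^2}{\alpha^2}\bar\rho_{\max}^2+\frac{\gamma^2}{\alpha^2}\rho_{\max}^2$, and suppose the parameters of FSPDA-STORM and these constants satisfy all of the following: (i) $\alpha\le\min\{\frac1{2L},\sqrt{\frac{a_x}{64S}},\frac{\gamma\rho_{\min}\sqrt{1-\gamma\rho_{\min}}}{\sqrt{32}L},\frac1{\sqrt{12}},\eta\}$; $\gamma\le\min\{\sqrt{\frac{a_x}{64P}},\frac1{8\sqrt{a_x}\sigma_A^2}\}$; $\eta\beta\le\frac1{12}$; $\beta\le1$; $0<a_x\le1$; $a_\lambda\le\frac1{\sigma_A}$. (ii) $\alpha\le\min\{\frac{1}{512\,\mathsf e S},\frac1{512\,\mathsf g\,nP}\}$; $\ 64\,\mathsf f\alpha^2nG\le\frac\alpha{24}$. (iii) $\alpha\le\mathsf a\frac{\gamma\rho_{\min}n}{256L^2}$; $\ \alpha^2\le\frac{\mathsf a}{\mathsf d}\min\{\frac{\eta\gamma\rho_{\min}}{768L^2},\frac{\eta\gamma\rho_{\min}}{640}\}$; $\ \beta^2\le\min\{\frac{\mathsf a}{\mathsf b}\frac{\gamma\rho_{\min}^2}{1536\rho_{\max}^2},\frac{\mathsf a}{\mathsf c}\frac{\gamma\rho_{\min}}{1536\rho_{\max}^2}\}$; $\ \alpha^3\le\frac{\mathsf a}{\mathsf d}\frac{\eta\gamma\rho_{\min}}{768L^4}$;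 $\ \beta\le\frac{\mathsf a}{\mathsf d}\min\{\frac{\gamma\rho_{\min}}{512\rho_{\max}^2},\frac{\gamma\rho_{\min}}{640}\}$; $\ \alpha^2\le\min\{\frac{\mathsf a}{\mathsf e}\frac{\gamma\rho_{\min}n}{8192L^2S},\frac{\mathsf a}{\mathsf g}\frac{\gamma\rho_{\min}}{8192L^2P}\}$; $\ \gamma\le\min\{\frac{\mathsf a}{\mathsf e}\frac{\rho_{\min}n}{8192\rho_{\max}^2S},\frac{\mathsf a}{\mathsf g}\frac{\rho_{\min}}{8192\rho_{\max}^2P}\}$; $\ a_x^2\le\frac{\mathsf a}{\mathsf f}\frac{\alpha^2\rho_{\min}}{5120\gamma\sigma_A^2}$; $\ 64\,\mathsf f\alpha^2L^2G\le\mathsf a\frac{\gamma\rho_{\min}}{256}$; $\ 64\,\mathsf f\gamma^2\rho_{\max}^2G\le\mathsf a\frac{\gamma\rho_{\min}}{256}$; $\ a_\lambda^2\le\frac{\mathsf a}{\mathsf g}\frac{\gamma\rho_{\min}}{2560\sigma_A^2}$. (iv) $\eta\le\frac{\mathsf d}{\mathsf a}\big(28(1-\gamma\rho_{\min})(1-\gamma\rho_{\min}/2)\big)^{-1}$; $\ \beta+\frac\alpha\eta\le\min\{\frac{\mathsf d}{\mathsf b}\frac{\eta\rho_{\min}}{28},\frac{\mathsf d}{\mathsf c}\frac{\eta}{28}\}$; $\ \eta\le\min\{\frac{\mathsf d}{\mathsf e}\frac{n}{896S},\frac{\mathsf d}{\mathsf g}\frac1{448}\}$; $\ a_x^2\eta\gamma^2\le\frac{\mathsf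 d}{\mathsf f}\frac{\alpha^2}{448\sigma_A^2}$; $\ 64\,\mathsf f\eta^2G\le\mathsf d\frac\eta{28}$. (v) $\mathsf b=\frac{\eta(1-\gamma\rho_{\min}/4)}{\beta(1-\gamma\rho_{\min})}\mathsf a$; $\ \mathsf c=\frac{\mathsf d(\gamma+\eta\beta)-2\mathsf a\eta\gamma(1-\gamma\rho_{\min}/4)(1-\gamma\rho_{\min})^{-1}}{2\beta}$. (vi) $\alpha\le\mathsf e\frac{a_x}2$. (vii) $\alpha^2\le\min\{\frac{\mathsf f}{\mathsf a}\frac{a_x\gamma\rho_{\min}}{64},\frac{\mathsf f}{\mathsf d}\frac{a_x\eta}{384},\frac{\mathsf f}{\mathsf d}\frac{a_x}{64}\}$; $\ \alpha^2\beta\le\frac{\mathsf f}{\mathsf d}\frac{a_x}{256}$; $\ \alpha^4\le\frac{\mathsf f}{\mathsf d}\frac{a_x\eta}{256}$; $\ \alpha^2\le\min\{\frac{\mathsf f}{\mathsf e}\frac{a_xn}{256S},\frac{\mathsf f}{\mathsf g}\frac{a_x}{256(1+P)}\}$. (viii) $\beta\le\min\{\frac{\mathsf g}{\mathsf b}\frac{a_\lambda\rho_{\min}}{24},\frac{\mathsf g}{\mathsf c}\frac{a_\lambda}{24},\frac{\mathsf g}{\mathsf d}\frac{a_\lambda}3\}$. (ix) $\alpha^2\le\min\{\frac{\eta\rho_{\min}}{96\,\mathsf b\,nL^2},\frac{\eta}{96\,\mathsf c\,nL^2}\}$; $\ \alpha\le\frac{\eta}{12\,\mathsf d\,nL^2}$.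 Then for any integer $T\ge1$, with $\mathsf T$ uniformly distributed on $\{0,\dots,T-1\}$ (independent of the algorithm), the iterates generated by FSPDA-STORM satisfy $$\mathbb E\big[\|\nabla F(\bar{\mathbf x}^{\mathsf T})\|^2\big]\le\frac{F_0-f_\star}{T\alpha/4}+\frac{(\mathsf e\cdot2a_x^2+\mathsf f\cdot4a_x^2n)\bar\sigma^2}{\alpha/4},$$ $$\mathbb E\Big[\sum_{i=1}^n\|\mathbf x_i^{\mathsf T}-\bar{\mathbf x}^{\mathsf T}\|^2\Big]\le\frac{F_0-f_\star}{T\mathsf a\gamma\rho_{\min}/8}+\frac{(\mathsf e\cdot2a_x^2+\mathsf f\cdot4a_x^2n)\bar\sigma^2}{\mathsf a\gamma\rho_{\min}/8},$$ where $$F_0=\mathbb E\Big[F(\bar{\mathbf x}^0)+\mathsf a\|\mathbf x^0\|_{\mathbf K}^2+\|\mathbf v^0\|_{\mathsf b\mathbf Q+\mathsf c\mathbf K}^2+\mathsf d\langle\mathbf x^0,\mathbf v^0\rangle_{\mathbf K}+\mathsf e\big\|\bar{\mathbf m}_x^0-\tfrac1n\mathbf 1_\otimes^\top\nabla\mathbf f(\mathbf x^0)\big\|^2+\mathsf f\|\mathbf m_x^0-\nabla_{\mathbf x}\mathcal L(\mathbf x^0,\boldsymbol\lambda^0)\|^2+\mathsf g\|\mathbf A^\top\mathbf m_\lambda^0-\mathbf A^\top\mathbf R\mathbf A\mathbf x^0\|^2\Big].$$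
   Context: Problem. $\mathcal{G}=(\mathcal{V},\mathcal{E})$ is an undirected connected graph on $\mathcal V=[n]=\{1,\dots,n\}$. For each $i\in[n]$, $f_i:\mathbb{R}^d\to\mathbb{R}$ is continuously differentiable (possibly non-convex), $f_i(x)=\mathbb{E}_{\xi_i\sim\mathbb{P}_i}[f_i(x;\xi_i)]$ and $\nabla f_i(x)=\mathbb{E}_{\xi_i\sim\mathbb{P}_i}[\nabla f_i(x;\xi_i)]$. $F(x)=\frac1n\sum_{i=1}^nf_i(x)$. For $\mathbf{x}=[\mathbf{x}_1;\dots;\mathbf{x}_n]\in\mathbb{R}^{nd}$: $\nabla\mathbf{f}(\mathbf{x})=[\nabla f_1(\mathbf{x}_1);\dots;\nabla f_n(\mathbf{x}_n)]$, $\nabla\mathbf{f}(\mathbf{x};\xi)=[\nabla f_1(\mathbf{x}_1;\xi_1);\dots;\nabla f_n(\mathbf{x}_n;\xi_n)]$, $\bar{\mathbf{x}}=\frac1n\sum_i\mathbf{x}_i$, $\mathbf{1}_\otimes=\mathbf{1}\otimes\mathbf{I}_d\in\mathbb{R}^{nd\times d}$. Random graph. $\widetilde{\mathbf A}\in\{-1,0,1\}^{|\mathcal E|\times n}$ is an (oriented) incidence matrix of $\mathcal G$ and $\mathbf A=\widetilde{\mathbf A}\otimes\mathbf I_d$. For $\xi_a\sim\mathbb P_a$, $\mathbf I(\xi_a)\in\{0,1\}^{|\mathcal E|d\times|\mathcal E|d}$ is a binary diagonal matrix, $\mathbf A(\xi_a)=\mathbf I(\xi_a)\mathbf A$, and $\mathbf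 R=\mathbb E[\mathbf I(\xi_a)]$ is diagonal with positive diagonal entries. $\mathbf K=(\mathbf I_n-\mathbf 1\mathbf 1^\top/n)\otimes\mathbf I_d$, $\mathbf Q=(\mathbf A^\top\mathbf R\mathbf A)^\dagger$ (pseudo-inverse). For a symmetric matrix $\mathbf W$, $\langle\mathbf a,\mathbf b\rangle_{\mathbf W}=\mathbf a^\top\mathbf W\mathbf b$, $\|\mathbf a\|_{\mathbf W}^2=\langle\mathbf a,\mathbf a\rangle_{\mathbf W}$. Algorithm FSPDA-STORM. Parameters $\alpha,\eta,\gamma,\beta>0$, $a_x,a_\lambda\in[0,1]$. With $\xi=(\xi_1,\dots,\xi_n,\xi_a)$ define $$\nabla_{\mathbf x}\mathcal L(\mathbf x,\boldsymbol\lambda;\xi)=\nabla\mathbf f(\mathbf x;\xi)+\tfrac\eta\alpha\mathbf A^\top\boldsymbol\lambda+\tfrac\gamma\alpha\mathbf A^\top\mathbf A(\xi_a)\mathbf x,\quad\nabla_{\mathbf x}\mathcal L(\mathbf x,\boldsymbol\lambda)=\nabla\mathbf f(\mathbf x)+\tfrac\eta\alpha\mathbf A^\top\boldsymbol\lambda+\tfrac\gamma\alpha\mathbf A^\top\mathbf R\mathbf A\mathbf x.$$ From initial $\mathbf x^0,\mathbf m_x^0\in\mathbb R^{nd}$, $\boldsymbol\lambda^0,\mathbf m_\lambda^0\in\mathbb R^{|\mathcal E|d}$, for $t\ge0$: $\mathbf x^{t+1}=\mathbf x^t-\alpha\mathbf m_x^t$, $\boldsymbol\lambda^{t+1}=\boldsymbol\lambda^t+\beta\mathbf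 m_\lambda^t$, $$\mathbf m_x^{t+1}=\nabla_{\mathbf x}\mathcal L(\mathbf x^{t+1},\boldsymbol\lambda^{t+1};\xi^{t+1})+(1-a_x)\big(\mathbf m_x^t-\nabla_{\mathbf x}\mathcal L(\mathbf x^t,\boldsymbol\lambda^t;\xi^{t+1})\big),$$ $$\mathbf m_\lambda^{t+1}=\mathbf A(\xi_a^{t+1})\mathbf x^{t+1}+(1-a_\lambda)\big(\mathbf m_\lambda^t-\mathbf A(\xi_a^{t+1})\mathbf x^t\big),$$ where $\xi^{t}=(\xi_1^t,\dots,\xi_n^t,\xi_a^t)$, $t\ge1$, are i.i.d. over $t$ (independent of the initialization) with independent components $\xi_i^t\sim\mathbb P_i$, $\xi_a^t\sim\mathbb P_a$. Further, $\bar{\mathbf m}_x^t=\frac1n\mathbf 1_\otimes^\top\mathbf m_x^t$ and $\mathbf v^t=\mathbf A^\top\boldsymbol\lambda^t+\frac\alpha\eta\nabla\mathbf f(\mathbf 1_\otimes\bar{\mathbf x}^t)$. Upper bounds having $\sigma_A$ in the denominator are read as $+\infty$ if $\sigma_A=0$. *)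

theory Defs
  imports "HOL-Probability.Probability"
begin

definition gradient :: "('a::real_inner \<Rightarrow> real) \<Rightarrow> 'a \<Rightarrow> 'a" where
  "gradient f x = (THE D. GDERIV f x :> D)"

section \<open>Matrices\<close>

definition kron :: "real^'b::finite^'a::finite \<Rightarrow> real^'d::finite^'c::finite \<Rightarrow> real^('b \<times> 'd)^('a \<times> 'c)" where
  "kron M N = (\<chi> p q. M $ fst p $ fst q * N $ snd p $ snd q)"

definition loewner_le :: "real^'n^'n \<Rightarrow> real^'n^'n \<Rightarrow> bool" (infix "\<preceq>\<^sub>L" 50) where
  "M \<preceq>\<^sub>L N \<longleftrightarrow> transpose (N - M) = N - M \<and> (\<forall>x. 0 \<le> x \<bullet> ((N - M) *v x))"

text \<open>The Moore--Penrose pseudo-inverse; the four Penrose equations have exactly one solution.\<close>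

definition pinv :: "real^'n^'m \<Rightarrow> real^'m^'n" where
  "pinv M = (THE X. M ** X ** M = M \<and> X ** M ** X = X
      \<and> transpose (M ** X) = M ** X \<and> transpose (X ** M) = X ** M)"

definition weighted_inner :: "real^'n^'n \<Rightarrow> real^'n \<Rightarrow> real^'n \<Rightarrow> real" where
  "weighted_inner W a b = a \<bullet> (W *v b)"

definition weighted_norm_sq :: "real^'n^'n \<Rightarrow> real^'n \<Rightarrow> real" where
  "weighted_norm_sq W a = weighted_inner W a a"

definition binary_diagonal :: "real^'n^'n \<Rightarrow> bool" where
  "binary_diagonal M \<longleftrightarrow> (\<forall>p. M $ p $ p \<in> {0, 1}) \<and> (\<forall>p q. p \<noteq> q \<longrightarrow> M $ p $ q = 0)"

section \<open>Stacked vectors\<close>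

text \<open>The space of stacked vectors (one block in \<open>real^'d\<close> for each agent) is
  \<open>real^('n::finite \<times> 'd::finite)\<close>; the coordinate \<open>(i, k)\<close> is the \<open>k\<close>-th coordinate of block \<open>i\<close>.\<close>

definition block :: "real^('n::finite \<times> 'd::finite) \<Rightarrow> 'n \<Rightarrow> real^'d" where
  "block x i = (\<chi> k. x $ (i, k))"

definition stack :: "('n \<Rightarrow> real^'d) \<Rightarrow> real^('n::finite \<times> 'd::finite)" where
  "stack g = (\<chi> p. g (fst p) $ snd p)"

definition avg :: "real^('n::finite \<times> 'd::finite) \<Rightarrow> real^'d" where
  "avg x = (1 / real CARD('n)) *\<^sub>R (\<Sum>i\<in>UNIV. block x i)"

text \<open>The Kronecker product of the all-ones column vector with the identity.\<close>

definition ones_kron :: "real^'d^('n::finite \<times> 'd::finite)" where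
  "ones_kron = (\<chi> p k. if snd p = k then 1 else 0)"

definition consensus :: "real^('n::finite \<times> 'd::finite)^('n \<times> 'd)" where
  "consensus = kron (mat 1 - (1 / real CARD('n)) *\<^sub>R (\<chi> i j. 1)) (mat 1)"

definition stacked_gradient ::
    "('n \<Rightarrow> real^'d \<Rightarrow> real) \<Rightarrow> real^('n::finite \<times> 'd::finite) \<Rightarrow> real^('n \<times> 'd)" where
  "stacked_gradient f x = stack (\<lambda>i. gradient (f i) (block x i))"

section \<open>Graphs\<close>

text \<open>A graph on the vertex set \<open>UNIV :: 'n set\<close> is given by its set \<open>E\<close> of edges, which are
  two-element sets of vertices. Edge-indexed vectors and matrix rows are indexed by the type
  \<open>'n set\<close> of all potential edges, and the rows of an incidence matrix outside \<open>E\<close> are zero.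
  Hence the coordinates outside \<open>E\<close> of an edge-indexed vector have no influence on anything.
  An index type for the edges alone would exclude the one-vertex graph, as types are nonempty.\<close>

definition simple_graph :: "'n set set \<Rightarrow> bool" where
  "simple_graph E \<longleftrightarrow> (\<forall>e\<in>E. card e = 2)"

definition connected_graph :: "'n set set \<Rightarrow> bool" where
  "connected_graph E \<longleftrightarrow> (\<forall>i j. (i, j) \<in> {(u, v). {u, v} \<in> E}\<^sup>*)"

definition oriented_incidence :: "'n::finite set set \<Rightarrow> real^'n^('n set) \<Rightarrow> bool" where
  "oriented_incidence E A \<longleftrightarrow>
     (\<forall>e\<in>E. \<exists>i j. e = {i, j} \<and> i \<noteq> j \<and>
        (\<forall>k. A $ e $ k = (if k = i then 1 else if k = j then -1 else 0))) \<and>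
     (\<forall>e. e \<notin> E \<longrightarrow> A $ e = 0)"

section \<open>Gradients of the augmented Lagrangian\<close>

text \<open>The exact gradient is the case where \<open>f\<close> is the family of local objectives and
  \<open>B = R ** A\<close>; the stochastic gradient is the case where \<open>f\<close> is the family of sampled
  objectives and \<open>B\<close> is the sampled (masked) incidence matrix.\<close>

definition lagrangian_gradient ::
    "real \<Rightarrow> real \<Rightarrow> real \<Rightarrow> real^('n::finite \<times> 'd::finite)^('m::finite \<times> 'd) \<Rightarrow> ('n \<Rightarrow> real^'d \<Rightarrow> real)
      \<Rightarrow> real^('n \<times> 'd)^('m \<times> 'd) \<Rightarrow> real^('n \<times> 'd) \<Rightarrow> real^('m \<times> 'd) \<Rightarrow> real^('n \<times> 'd)" where
  "lagrangian_gradient \<alpha> \<eta> \<gamma> A f B x l =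
     stacked_gradient f x + (\<eta> / \<alpha>) *\<^sub>R (transpose A *v l)
       + (\<gamma> / \<alpha>) *\<^sub>R (transpose A *v (B *v x))"

section \<open>Independence\<close>

text \<open>Independence of two random variables whose values may have different types; the library's
  \<open>indep_var\<close> requires the same type for both.\<close>

definition indep_rv ::
    "'w measure \<Rightarrow> 'a measure \<Rightarrow> ('w \<Rightarrow> 'a) \<Rightarrow> 'b measure \<Rightarrow> ('w \<Rightarrow> 'b) \<Rightarrow> bool" where
  "indep_rv M MX X MY Y \<longleftrightarrow> X \<in> measurable M MX \<and> Y \<in> measurable M MY \<and>
     prob_space.indep_set M {X -` B \<inter> space M |B. B \<in> sets MX} {Y -` B \<inter> space M |B. B \<in> sets MY}"

end

theory Submission
  imports Defs
begin

text \<open>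
  The proof is a one-step Lyapunov estimate. Let \<open>C = A\<^sup>T R A\<close>, let \<open>u\<close> and \<open>v\<close> be the consensus
  parts of the iterate and of the dual residual, let \<open>w = A\<^sup>T m\<^sub>l - C x\<close> be the graph error and
  \<open>m\<^sub>x - \<nabla>\<L>\<close> the gradient error. A potential \<open>V \<ge> f\<^sub>\<star>\<close>, made of the averaged objective, a quadratic
  form in \<open>u\<close> and \<open>v\<close> and the squared errors, satisfies in conditional expectation

  \<open>E V(next) + \<alpha>/4 |\<nabla>F|\<^sup>2 + a \<gamma> \<rho>min/8 |u|\<^sup>2 \<le> V + noise\<close>    (\<open>one_step\<close>).

  Summing over the \<open>T\<close> steps (\<open>telescoped_drift\<close>) and dividing by \<open>T\<close>, which is what the uniformly
  drawn time does (\<open>nn_integral_uniform_time\<close>), gives both bounds.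

  Why the estimate holds. The next \<open>x\<close> and \<open>l\<close> do not depend on the next sample, so the objective
  and the quadratic form move deterministically. The weights \<open>b\<close> and \<open>c\<close> are those for which the
  cross terms \<open>\<langle>u, v\<rangle>\<close> and \<open>\<langle>C u, v\<rangle>\<close> produced by the different parts of the form cancel
  (\<open>b_beta\<close>, \<open>c_beta\<close>); negative multiples of \<open>|u|\<^sup>2\<close> and \<open>|v|\<^sup>2\<close> are left, and Young's inequality
  absorbs everything else (\<open>quadratic_descent\<close>). The errors contract by \<open>1 - a\<^sub>x\<close> and \<open>1 - a\<^sub>l\<close> and
  receive a centred noise (\<open>step_grad_error\<close>, \<open>step_graph_error\<close>). That noise is split into the noise
  at the current iterate, damped by \<open>a\<^sub>x\<close> or \<open>a\<^sub>l\<close>, and a part controlled by the distance moved in the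
  step; that distance is bounded by \<open>u\<close>, \<open>v\<close>, the errors and the averaged momentum, so it fits into
  the negative terms (\<open>drift_budget\<close>).

  One coupling is delicate. A motion \<open>\<eta> v\<close> of the iterate puts a noise of variance at most
  \<open>q \<eta>\<^sup>2 |v|\<^sup>2\<close>, \<open>q = min (\<sigma>\<^sub>A\<^sup>2) (\<rho>bmax\<^sup>2)\<close>, into the graph error, whose weight in the initial potential
  is \<open>g\<close>; the available descent is only of order \<open>d \<eta> |v|\<^sup>2\<close>, and \<open>g q \<eta>\<close> may be much larger than \<open>d\<close>.
  In that case \<open>V\<close> uses the smaller weight \<open>g' = d/(200 q \<eta>)\<close>. A smaller weight no longer dominates the
  coupling \<open>b \<beta> \<langle>v, Q w\<rangle>\<close> of \<open>v\<close> and \<open>w\<close>, so a multiple of \<open>\<langle>u, Q w\<rangle>\<close> is added to \<open>V\<close>: as \<open>u\<close> moves by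
  \<open>-\<eta> v\<close> while \<open>w\<close> keeps its conditional mean up to the factor \<open>1 - a\<^sub>l\<close>, this term changes by about
  \<open>-\<eta> \<langle>v, Q w\<rangle>\<close> and cancels the coupling up to a factor \<open>a\<^sub>l\<close>. In the case at hand the conditions on
  the parameters make \<open>g'\<close> large enough for what remains (\<open>shifted_weight_bounds\<close>). The quadratic form
  enters \<open>V\<close> with the factor one half, and the other half pays for the added term, so that \<open>V\<close> stays
  between \<open>f\<^sub>\<star>\<close> and the initial potential of the theorem (\<open>potential_bounds\<close>).
\<close>

declare transpose_matrix_vector [simp del]

section \<open>Young-type inequalities\<close>

text \<open>The form of Young's inequality in which every coupling is absorbed: a product with coefficient
  \<open>k\<close> fits into the squares with coefficients \<open>A\<close> and \<open>B\<close> as soon as the discriminant allows it.\<close>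

lemma weighted_young:
  fixes k p q A B :: real
  assumes "k\<^sup>2 \<le> 4 * A * B" "0 \<le> A" "0 \<le> B"
  shows "k * p * q \<le> A * p\<^sup>2 + B * q\<^sup>2"
proof -
  have "(k * p * q)\<^sup>2 = k\<^sup>2 * (p\<^sup>2 * q\<^sup>2)" by (simp add: power_mult_distrib)
  also have "\<dots> \<le> 4 * A * B * (p\<^sup>2 * q\<^sup>2)" using assms by (intro mult_right_mono) auto
  also have "\<dots> \<le> (A * p\<^sup>2 + B * q\<^sup>2)\<^sup>2"
  proof -
    have "4 * (x * y) \<le> (x + y)\<^sup>2" for x y :: real
      using zero_le_power2[of "x - y"] by (simp add: power2_eq_square algebra_simps)
    from this[of "A * p\<^sup>2" "B * q\<^sup>2"] show ?thesis by (simp add: ac_simps)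
  qed
  finally show ?thesis by (rule power2_le_imp_le) (use assms in auto)
qed

lemma norm_add_sq_young:
  fixes x y :: "'v::real_inner"
  assumes "1 < k"
  shows "(norm (x + y))\<^sup>2 \<le> k * (norm x)\<^sup>2 + k / (k - 1) * (norm y)\<^sup>2"
proof -
  have e: "(norm (x + y))\<^sup>2 = (norm x)\<^sup>2 + 2 * (x \<bullet> y) + (norm y)\<^sup>2"
    by (simp add: power2_norm_eq_inner inner_add_left inner_add_right inner_commute)
  have k: "(k - 1) * (1 / (k - 1)) = 1" using assms by simp
  have "2 * (x \<bullet> y) \<le> 2 * norm x * norm y" using norm_cauchy_schwarz[of x y] by simp
  also have "\<dots> \<le> (k - 1) * (norm x)\<^sup>2 + 1 / (k - 1) * (norm y)\<^sup>2"
    using assms by (intro weighted_young) (unfold mult.assoc k, auto)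
  finally have "(norm (x + y))\<^sup>2 \<le> k * (norm x)\<^sup>2 + (1 + 1 / (k - 1)) * (norm y)\<^sup>2"
    unfolding e by (simp add: algebra_simps)
  also have "1 + 1 / (k - 1) = k / (k - 1)" using assms by (simp add: field_simps)
  finally show ?thesis .
qed

lemma norm_add_sq_le2:
  fixes x y :: "'v::real_inner"
  shows "(norm (x + y))\<^sup>2 \<le> 2 * (norm x)\<^sup>2 + 2 * (norm y)\<^sup>2"
  using norm_add_sq_young[of 2 x y] by simp

lemma norm_add_sq_le3:
  fixes x y z :: "'v::real_inner"
  shows "(norm (x + y + z))\<^sup>2 \<le> 3 * (norm x)\<^sup>2 + 3 * (norm y)\<^sup>2 + 3 * (norm z)\<^sup>2"
proof -
  have "(norm (x + y + z))\<^sup>2 \<le> 3/2 * (norm (x + y))\<^sup>2 + 3 * (norm z)\<^sup>2"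
    using norm_add_sq_young[of "3/2" "x + y" z] by simp
  then show ?thesis using norm_add_sq_le2[of x y] by linarith
qed

section \<open>Blocks, averages and the consensus projection\<close>

lemma sum_pairs: "(\<Sum>p\<in>UNIV. f p) = (\<Sum>i\<in>UNIV. \<Sum>k\<in>UNIV. f (i, k))" for f :: "'a::finite \<times> 'b::finite \<Rightarrow> 'c::comm_monoid_add"
  unfolding UNIV_Times_UNIV[symmetric] by (subst sum.cartesian_product) simp

lemma inner_blocks: "x \<bullet> y = (\<Sum>i\<in>UNIV. block x i \<bullet> block y i)" for x y :: "real^('n::finite \<times> 'd::finite)"
  by (simp add: inner_vec_def block_def sum_pairs)

lemma norm_sq_blocks: "(norm x)\<^sup>2 = (\<Sum>i\<in>UNIV. (norm (block x i))\<^sup>2)" for x :: "real^('n::finite \<times> 'd::finite)"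
  by (simp add: power2_norm_eq_inner inner_blocks)

lemma block_add [simp]: "block (x + y) i = block x i + block y i"
  and block_diff [simp]: "block (x - y) i = block x i - block y i"
  and block_scaleR [simp]: "block (c *\<^sub>R x) i = c *\<^sub>R block x i"
  and block_stack [simp]: "block (stack h) i = h i"
  by (simp_all add: block_def stack_def vec_eq_iff)

lemma block_eqI: "(\<And>i. block x i = block y i) \<Longrightarrow> x = y"
  by (simp add: block_def vec_eq_iff)

lemma avg_add [simp]: "avg (x + y) = avg x + avg y"
  and avg_diff [simp]: "avg (x - y) = avg x - avg y"
  and avg_scaleR [simp]: "avg (c *\<^sub>R x) = c *\<^sub>R avg x"
  by (simp_all add: avg_def sum.distrib sum_subtractf scaleR_add_right scaleR_diff_right scaleR_sum_right mult.commute)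

lemma avg_stack_const [simp]: "avg (stack (\<lambda>_::'n. c) :: real^('n::finite \<times> 'd::finite)) = c"
  by (simp add: avg_def sum_constant_scaleR del: sum_constant)

lemma avg_zero [simp]: "avg 0 = 0" using avg_scaleR[of 0 0] by simp

lemma transpose_ones_kron: "transpose ones_kron *v x = (\<Sum>i\<in>UNIV. block x i)" for x :: "real^('n::finite \<times> 'd::finite)"
proof (rule vec_eq_iff[THEN iffD2, rule_format])
  fix k :: 'd
  have "(transpose (ones_kron :: real^'d^('n \<times> 'd)) *v x) $ k
      = (\<Sum>p\<in>UNIV. (if snd p = k then 1 else 0) * x $ p)"
    by (simp add: matrix_vector_mult_def transpose_def ones_kron_def)
  also have "\<dots> = (\<Sum>i\<in>UNIV. \<Sum>k'\<in>UNIV. if k' = k then x $ (i, k') else 0)"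
    unfolding sum_pairs by (intro sum.cong) auto
  finally show "(transpose (ones_kron :: real^'d^('n \<times> 'd)) *v x) $ k = (\<Sum>i\<in>UNIV. block x i) $ k"
    by (simp add: block_def)
qed

lemma avg_eq_ones_kron: "(1 / real CARD('n)) *\<^sub>R (transpose ones_kron *v x) = avg x" for x :: "real^('n::finite \<times> 'd::finite)"
  by (simp add: avg_def transpose_ones_kron)

lemma ones_kron_mult: "(ones_kron :: real^'d^('n::finite \<times> 'd::finite)) *v y = stack (\<lambda>_. y)"
  by (simp add: vec_eq_iff matrix_vector_mult_def ones_kron_def stack_def if_distrib[of "\<lambda>t. t * _"] cong: if_cong)

lemma consensus_mult: "consensus *v x = x - stack (\<lambda>_. avg x)" for x :: "real^('n::finite \<times> 'd::finite)"
proof (simp add: vec_eq_iff stack_def, intro allI)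
  fix i :: 'n and k :: 'd
  have "(consensus *v x) $ (i, k) = (\<Sum>j\<in>UNIV. \<Sum>k'\<in>UNIV.
      (if k = k' then ((if i = j then 1 else 0) - 1 / real CARD('n)) * x $ (j, k') else 0))"
    unfolding matrix_vector_mult_def consensus_def kron_def
    by (simp only: vec_lambda_beta, subst sum_pairs, intro sum.cong) (auto simp: mat_def)
  also have "\<dots> = (\<Sum>j\<in>UNIV. ((if i = j then 1 else 0) - 1 / real CARD('n)) * x $ (j, k))"
    by simp
  also have "\<dots> = (\<Sum>j\<in>UNIV. (if i = j then x $ (j, k) else 0) - x $ (j, k) / real CARD('n))"
    by (intro sum.cong) (auto simp: algebra_simps)
  also have "\<dots> = x $ (i, k) - avg x $ k"
    by (simp add: sum_subtractf avg_def block_def sum_divide_distrib)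
  finally show "(consensus *v x) $ (i, k) = x $ (i, k) - avg x $ k" .
qed

lemma block_consensus [simp]: "block (consensus *v x) i = block x i - avg x"
  by (simp add: consensus_mult)

lemma avg_consensus [simp]: "avg (consensus *v x) = 0"
  by (simp add: consensus_mult)

lemma consensus_idem [simp]: "consensus *v (consensus *v x) = consensus *v x"
  by (rule block_eqI) simp

lemma sum_block: "(\<Sum>i\<in>UNIV. block x i) = real CARD('n) *\<^sub>R avg x" for x :: "real^('n::finite \<times> 'd::finite)"
  by (simp add: avg_def)

lemma consensus_inner: "x \<bullet> (consensus *v y) = (consensus *v x) \<bullet> y"
  by (simp add: inner_blocks inner_diff_left inner_diff_right sum_subtractf
    flip: inner_sum_left inner_sum_right) (simp add: sum_block inner_commute)

text \<open>Pythagoras for the splitting of a stacked vector into disagreement and average.\<close>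

lemma norm_sq_consensus: "(norm x)\<^sup>2 = (norm (consensus *v x))\<^sup>2 + real CARD('n) * (norm (avg x))\<^sup>2"
  for x :: "real^('n::finite \<times> 'd::finite)"
proof -
  have "(norm (consensus *v x))\<^sup>2 = x \<bullet> (consensus *v x)"
    by (simp add: power2_norm_eq_inner consensus_inner[symmetric])
  also have "\<dots> = (norm x)\<^sup>2 - real CARD('n) * (norm (avg x))\<^sup>2"
    by (simp add: inner_blocks inner_diff_right sum_subtractf power2_norm_eq_inner flip: inner_sum_left)
      (simp add: sum_block)
  finally show ?thesis by simp
qed

lemma norm_consensus_le: "norm (consensus *v x) \<le> norm x"
  by (rule power2_le_imp_le) (use norm_sq_consensus[of x] in simp_all)

lemma norm_avg_sq_le: "real CARD('n) * (norm (avg x))\<^sup>2 \<le> (norm x)\<^sup>2" for x :: "real^('n::finite \<times> 'd::finite)"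
  using norm_sq_consensus[of x] by simp

lemma weighted_norm_sq_consensus: "weighted_norm_sq consensus x = (norm (consensus *v x))\<^sup>2"
  by (simp add: weighted_norm_sq_def weighted_inner_def power2_norm_eq_inner consensus_inner[symmetric])

lemma transpose_inner: "x \<bullet> (M *v y) = (transpose M *v x) \<bullet> y" for M :: "real^'n^'m"
  by (simp add: transpose_matrix_vector dot_lmul_matrix)

lemma transpose_eqI:
  fixes M :: "real^'n^'n"
  assumes "\<And>x y. x \<bullet> (M *v y) = (M *v x) \<bullet> y"
  shows "transpose M = M"
proof -
  have "transpose M *v x = M *v x" for x
    using assms[of x] unfolding transpose_inner[of x M] by (subst vector_eq_rdot[symmetric]) simp
  then show ?thesis by (simp add: matrix_eq)
qed

lemma inner_gram: "y \<bullet> ((transpose A ** A) *v y) = (norm (A *v y))\<^sup>2" for A :: "real^'n^'m"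
  by (simp add: transpose_inner power2_norm_eq_inner flip: matrix_vector_mul_assoc)

lemma inner_pinched: "y \<bullet> ((c *\<^sub>R consensus) *v y) = c * (norm (consensus *v y))\<^sup>2"
  using weighted_norm_sq_consensus[of y]
  by (simp add: scaleR_matrix_vector_assoc[symmetric] weighted_norm_sq_def weighted_inner_def)

lemma transpose_consensus: "transpose consensus = consensus"
  by (rule transpose_eqI) (rule consensus_inner)

section \<open>Positive semidefinite matrices pinched by the consensus projection\<close>

text \<open>The nonnegative quadratic \<open>t \<mapsto> \<langle>t y + x, M (t y + x)\<rangle>\<close> has a nonpositive discriminant.\<close>

lemma psd_cauchy_schwarz:
  fixes M :: "real^'n^'n"
  assumes sym: "transpose M = M" and psd: "\<And>x. 0 \<le> x \<bullet> (M *v x)"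
  shows "(y \<bullet> (M *v x))\<^sup>2 \<le> (y \<bullet> (M *v y)) * (x \<bullet> (M *v x))"
proof -
  let ?A = "y \<bullet> (M *v y)" and ?B = "y \<bullet> (M *v x)" and ?C = "x \<bullet> (M *v x)"
  have "0 \<le> ?A * t\<^sup>2 + 2 * ?B * t + ?C" for t
  proof -
    have "x \<bullet> (M *v y) = ?B" using transpose_inner[of x M y] sym by (simp add: inner_commute)
    then have "(t *\<^sub>R y + x) \<bullet> (M *v (t *\<^sub>R y + x)) = ?A * t\<^sup>2 + 2 * ?B * t + ?C"
      by (simp add: matrix_vector_right_distrib matrix_vector_mult_scaleR inner_add_left inner_add_right power2_eq_square algebra_simps)
    then show ?thesis using psd[of "t *\<^sub>R y + x"] by simp
  qed
  note q = this
  show ?thesis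
  proof (cases "?A = 0")
    case True
    have "?B = 0"
    proof (rule ccontr)
      assume "?B \<noteq> 0"
      then show False using q[of "- (?C + 1) / (2 * ?B)"] True by simp
    qed
    then show ?thesis using True by simp
  next
    case False
    then have A: "?A > 0" using psd[of y] by simp
    have "0 \<le> ?A * (?A * (- ?B / ?A)\<^sup>2 + 2 * ?B * (- ?B / ?A) + ?C)" using q[of "- ?B / ?A"] A by (intro mult_nonneg_nonneg) auto
    also have "\<dots> = ?A * ?C - ?B\<^sup>2" using A by (simp add: power2_eq_square field_simps)
    finally show ?thesis by simp
  qed
qed

text \<open>Matrices with the same kernel as the consensus projection and with spectrum between \<open>r\<close> and \<open>R\<close>
  on its range; \<open>A\<^sup>T R A\<close> is the instance of interest.\<close>

locale consensus_pinched =
  fixes C :: "real^('n::finite \<times> 'd::finite)^('n \<times> 'd)" and r R :: real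
  assumes lower: "r *\<^sub>R consensus \<preceq>\<^sub>L C" and upper: "C \<preceq>\<^sub>L R *\<^sub>R consensus"
    and r: "0 < r" "r \<le> R"
begin

abbreviation "K \<equiv> consensus :: real^('n \<times> 'd)^('n \<times> 'd)"

lemma sym: "transpose C = C"
proof -
  have "transpose (C - r *\<^sub>R K) = C - r *\<^sub>R K" using lower by (simp add: loewner_le_def)
  moreover have "transpose (C - r *\<^sub>R K) = transpose C - r *\<^sub>R K"
  proof -
    have tK: "transpose K = K" by (rule transpose_consensus)
    have "transpose (C - r *\<^sub>R K) = transpose C - r *\<^sub>R transpose K" by (simp add: transpose_def vec_eq_iff)
    then show ?thesis unfolding tK .
  qed
  ultimately show ?thesis by simp
qed

lemma inner_sym: "x \<bullet> (C *v y) = (C *v x) \<bullet> y"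
  using transpose_inner[of x C y] sym by simp

lemma quad_lower: "r * (norm (K *v x))\<^sup>2 \<le> x \<bullet> (C *v x)"
proof -
  have "0 \<le> x \<bullet> ((C - r *\<^sub>R K) *v x)" using lower by (simp add: loewner_le_def)
  also have "\<dots> = x \<bullet> (C *v x) - r * (norm (K *v x))\<^sup>2"
    using weighted_norm_sq_consensus[of x]
    by (simp add: matrix_vector_mult_diff_rdistrib inner_diff_right scaleR_matrix_vector_assoc[symmetric] weighted_norm_sq_def weighted_inner_def)
  finally show ?thesis by simp
qed

lemma quad_upper: "x \<bullet> (C *v x) \<le> R * (norm (K *v x))\<^sup>2"
proof -
  have "0 \<le> x \<bullet> ((R *\<^sub>R K - C) *v x)" using upper by (simp add: loewner_le_def)
  also have "\<dots> = R * (norm (K *v x))\<^sup>2 - x \<bullet> (C *v x)"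
    using weighted_norm_sq_consensus[of x]
    by (simp add: matrix_vector_mult_diff_rdistrib inner_diff_right scaleR_matrix_vector_assoc[symmetric] weighted_norm_sq_def weighted_inner_def)
  finally show ?thesis by simp
qed

lemma psd: "0 \<le> x \<bullet> (C *v x)"
proof -
  have "0 \<le> r * (norm (K *v x))\<^sup>2" using r by simp
  then show ?thesis using quad_lower[of x] by linarith
qed

lemma kernel: "C *v x = 0" if "K *v x = 0"
proof -
  have "x \<bullet> (C *v x) = 0" using quad_upper[of x] psd[of x] that by simp
  then have "((C *v x) \<bullet> (C *v x))\<^sup>2 \<le> 0" using psd_cauchy_schwarz[OF sym psd, of "C *v x" x] by simp
  then show ?thesis by simp
qed

lemma mult_consensus: "C *v (K *v x) = C *v x"
proof -
  have "K *v (x - K *v x) = 0" by (simp add: matrix_vector_mult_diff_distrib)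
  then have "C *v (x - K *v x) = 0" by (rule kernel)
  then show ?thesis by (simp add: matrix_vector_mult_diff_distrib)
qed

lemma consensus_mult_eq: "K *v (C *v x) = C *v x"
proof -
  have "(K *v (C *v x)) \<bullet> y = (C *v x) \<bullet> y" for y
    by (metis consensus_inner inner_sym mult_consensus)
  then show ?thesis by (subst vector_eq_rdot[symmetric]) simp
qed

text \<open>Cauchy--Schwarz in the form defined by the matrix, applied to \<open>C x\<close> and \<open>x\<close>; it replaces the
  inequality between a symmetric operator and its square that diagonalisation would give.\<close>

lemma norm_sq_le: "(norm (C *v x))\<^sup>2 \<le> R * (x \<bullet> (C *v x))"
proof (cases "C *v x = 0")
  case True then show ?thesis by simp
next
  case False
  let ?y = "C *v x"
  have "(?y \<bullet> ?y)\<^sup>2 \<le> (?y \<bullet> (C *v ?y)) * (x \<bullet> (C *v x))" by (rule psd_cauchy_schwarz[OF sym psd])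
  also have "\<dots> \<le> (R * (norm ?y)\<^sup>2) * (x \<bullet> (C *v x))"
    using quad_upper[of ?y] psd[of x] by (intro mult_right_mono) (simp_all add: consensus_mult_eq)
  finally have "(norm ?y)\<^sup>2 * (norm ?y)\<^sup>2 \<le> (norm ?y)\<^sup>2 * (R * (x \<bullet> (C *v x)))"
    unfolding power2_norm_eq_inner[symmetric] by (simp add: power2_eq_square ac_simps)
  then show ?thesis by (rule mult_left_le_imp_le) (use False in simp)
qed

text \<open>The matrix vanishes exactly on the consensus subspace, so adding the complementary projection makes
  it invertible; cutting that inverse back to the range of \<open>K\<close> gives a solution of the Penrose equations.\<close>

lemma pinv_props:
  shows pinv_mult: "pinv C *v (C *v x) = K *v x"
    and pinv_sym: "x \<bullet> (pinv C *v y) = (pinv C *v x) \<bullet> y"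
    and pinv_norm: "norm (pinv C *v x) \<le> norm x / r"
    and pinv_consensus: "pinv C *v (K *v x) = pinv C *v x"
    and consensus_pinv: "K *v (pinv C *v x) = pinv C *v x"
    and mult_pinv: "C *v (pinv C *v x) = K *v x"
proof -
  define D where "D = C + (mat 1 - K)"
  have Dx: "D *v x = C *v x + (x - K *v x)" for x
    by (simp add: D_def matrix_vector_mult_add_rdistrib matrix_vector_mult_diff_rdistrib)
  have KK: "K ** K = K" by (simp add: matrix_eq flip: matrix_vector_mul_assoc)
  have CK: "C ** K = C" by (simp add: matrix_eq mult_consensus flip: matrix_vector_mul_assoc)
  have KC: "K ** C = C" by (simp add: matrix_eq consensus_mult_eq flip: matrix_vector_mul_assoc)
  have "x = 0" if "D *v x = 0" for x
  proof -
    have "K *v (D *v x) = C *v x" unfolding Dx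
      by (simp add: matrix_vector_right_distrib matrix_vector_mult_diff_distrib consensus_mult_eq)
    then have Cx: "C *v x = 0" using that by simp
    then have "r * (norm (K *v x))\<^sup>2 \<le> 0" using quad_lower[of x] by simp
    then have "K *v x = 0" using r by (simp add: mult_le_0_iff)
    then show ?thesis using that Cx by (simp add: Dx)
  qed
  then obtain B where BD: "B ** D = mat 1"
    using matrix_left_invertible_ker[of D] by blast
  then have DB: "D ** B = mat 1" by (simp add: matrix_left_right_inverse)
  have DK: "D ** K = C" and KD: "K ** D = C"
    by (simp_all add: matrix_eq Dx matrix_vector_right_distrib matrix_vector_mult_diff_distrib mult_consensus consensus_mult_eq flip: matrix_vector_mul_assoc)
  define X where "X = B ** K"
  have "K ** B = (B ** D) ** (K ** B)" by (simp add: BD)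
  also have "\<dots> = B ** (D ** K) ** B" by (simp only: matrix_mul_assoc)
  also have "\<dots> = B ** (K ** D) ** B" by (simp only: DK KD)
  also have "\<dots> = B ** K ** (D ** B)" by (simp only: matrix_mul_assoc)
  finally have BK: "K ** B = B ** K" by (simp add: DB)
  have "C ** X = D ** (K ** B) ** K" unfolding X_def DK[symmetric] by (simp only: matrix_mul_assoc)
  also have "\<dots> = (D ** B) ** (K ** K)" unfolding BK by (simp only: matrix_mul_assoc)
  finally have CX: "C ** X = K" by (simp add: DB KK)
  have "X ** C = B ** C" by (simp add: X_def KC flip: matrix_mul_assoc)
  also have "\<dots> = (B ** D) ** K" by (simp add: DK flip: matrix_mul_assoc)
  finally have XC: "X ** C = K" by (simp add: BD)
  have "K ** X = (K ** B) ** K" unfolding X_def by (simp only: matrix_mul_assoc)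
  also have "\<dots> = B ** (K ** K)" unfolding BK by (simp only: matrix_mul_assoc)
  finally have KX: "K ** X = X" by (simp add: KK X_def)
  have tK: "transpose K = K" by (rule transpose_consensus)
  have penrose: "C ** X ** C = C \<and> X ** C ** X = X \<and> transpose (C ** X) = C ** X \<and> transpose (X ** C) = X ** C"
    by (simp add: CX XC KC KX tK)
  have unique: "Z = X" if Z: "C ** Z ** C = C \<and> Z ** C ** Z = Z \<and> transpose (C ** Z) = C ** Z \<and> transpose (Z ** C) = Z ** C" for Z
  proof -
    have "C ** Z = K"
    proof -
      have "C ** Z = K ** (C ** Z)" by (simp add: KC matrix_mul_assoc)
      have "K = (C ** Z ** C) ** X" using Z CX by simp
      also have "\<dots> = (C ** Z) ** (C ** X)" by (simp only: matrix_mul_assoc)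
      finally have "K = (C ** Z) ** K" by (simp add: CX)
      then have "transpose K = transpose K ** transpose (C ** Z)" by (metis matrix_transpose_mul)
      then show ?thesis using \<open>C ** Z = K ** (C ** Z)\<close> Z tK by simp
    qed
    moreover have "Z ** C = K"
    proof -
      have "Z ** C = (Z ** C) ** K" by (simp add: CK flip: matrix_mul_assoc)
      have "K = X ** (C ** Z ** C)" using Z XC by simp
      also have "\<dots> = (X ** C) ** (Z ** C)" by (simp only: matrix_mul_assoc)
      finally have "K = K ** (Z ** C)" by (simp add: XC)
      then have "transpose K = transpose (Z ** C) ** transpose K" by (metis matrix_transpose_mul)
      then show ?thesis using \<open>Z ** C = (Z ** C) ** K\<close> Z tK by simp
    qed
    ultimately have CZ: "C ** Z = C ** X" and ZC: "Z ** C = X ** C" by (simp_all only: CX XC)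
    have "Z = Z ** (C ** Z)" using Z by (simp only: matrix_mul_assoc)
    also have "\<dots> = (Z ** C) ** X" unfolding CZ by (simp only: matrix_mul_assoc)
    also have "\<dots> = X" unfolding ZC using penrose by (simp only:)
    finally show ?thesis .
  qed
  have pinv: "pinv C = X" unfolding pinv_def using penrose unique by (intro the_equality) blast+
  have tX: "transpose X = X"
  proof -
    have "transpose C ** transpose X = transpose (X ** C)" by (simp add: matrix_transpose_mul)
    then have 1: "C ** transpose X = K" by (simp add: sym XC tK)
    have "transpose X ** transpose C = transpose (C ** X)" by (simp add: matrix_transpose_mul)
    then have 2: "transpose X ** C = K" by (simp add: sym CX tK)
    have "transpose (X ** C ** X) = transpose X" using penrose by simp
    then have 3: "transpose X ** C ** transpose X = transpose X"
      by (simp add: matrix_transpose_mul sym matrix_mul_assoc)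
    then have 3: "K ** transpose X = transpose X" by (simp only: 2)
    show ?thesis by (rule unique) (simp add: 1 2 3 KC tK)
  qed
  have "X ** K = X" using KK by (simp add: X_def flip: matrix_mul_assoc)
  then show "pinv C *v (K *v x) = pinv C *v x" by (simp add: pinv matrix_vector_mul_assoc)
  show "K *v (pinv C *v x) = pinv C *v x" using KX by (simp add: pinv matrix_vector_mul_assoc)
  show "C *v (pinv C *v x) = K *v x" by (simp add: pinv matrix_vector_mul_assoc CX)
  show "pinv C *v (C *v x) = K *v x" by (simp add: pinv matrix_vector_mul_assoc XC)
  show "x \<bullet> (pinv C *v y) = (pinv C *v x) \<bullet> y" using transpose_inner[of x X y] tX by (simp add: pinv)
  show "norm (pinv C *v x) \<le> norm x / r"
  proof (cases "X *v x = 0")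
    case True then show ?thesis using r by (simp add: pinv)
  next
    case False
    let ?y = "X *v x"
    have Ky: "K *v ?y = ?y" by (simp add: matrix_vector_mul_assoc KX)
    have "r * (norm ?y)\<^sup>2 \<le> ?y \<bullet> (C *v ?y)" using quad_lower[of ?y] Ky by simp
    also have "C *v ?y = K *v x" by (simp add: matrix_vector_mul_assoc CX)
    also have "?y \<bullet> (K *v x) \<le> norm ?y * norm x" using norm_cauchy_schwarz[of ?y "K *v x"] norm_consensus_le[of x]
      by (meson mult_left_mono norm_ge_zero order_trans)
    finally have "norm ?y * (r * norm ?y) \<le> norm ?y * norm x" by (simp add: power2_eq_square ac_simps)
    then have "r * norm ?y \<le> norm x" using False by simp
    then show ?thesis using r by (simp add: pinv field_simps)
  qed
qed

end

text \<open>A mask has norm at most one, and both \<open>A\<close> and its transpose have norm at most \<open>sqrt R\<close>. The bound is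
  pointwise in the mask, so it also makes the sampled graph matrices integrable.\<close>

lemma norm_transpose_mask_le:
  fixes A :: "real^('n::finite \<times> 'd::finite)^'m::finite" and D :: "real^'m^'m"
  assumes upper: "transpose A ** A \<preceq>\<^sub>L R *\<^sub>R consensus" and D: "binary_diagonal D" and R: "0 \<le> R"
  shows "norm (transpose A *v (D *v (A *v y))) \<le> R * norm (consensus *v y)"
proof -
  have A: "(norm (A *v y))\<^sup>2 \<le> R * (norm (consensus *v y))\<^sup>2" for y :: "real^('n \<times> 'd)"
  proof -
    have "0 \<le> y \<bullet> ((R *\<^sub>R consensus - transpose A ** A) *v y)" using upper by (simp add: loewner_le_def)
    also have "\<dots> = R * (norm (consensus *v y))\<^sup>2 - (norm (A *v y))\<^sup>2"
      unfolding matrix_vector_mult_diff_rdistrib inner_diff_right inner_gram inner_pinched ..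
    finally show ?thesis by simp
  qed
  have Ay: "norm (A *v y) \<le> sqrt R * norm (consensus *v y)" for y :: "real^('n \<times> 'd)"
    using real_sqrt_le_mono[OF A[of y]] by (simp add: real_sqrt_mult)
  have At: "norm (transpose A *v w) \<le> sqrt R * norm w" for w
  proof (cases "transpose A *v w = 0")
    case True then show ?thesis using R by simp
  next
    case False
    let ?y = "transpose A *v w"
    have "norm ?y * norm ?y = w \<bullet> (A *v ?y)" by (simp add: transpose_inner power2_eq_square[symmetric] power2_norm_eq_inner)
    also have "\<dots> \<le> norm w * norm (A *v ?y)" by (rule norm_cauchy_schwarz)
    also have "\<dots> \<le> norm w * (sqrt R * norm ?y)"
      using R by (intro mult_left_mono order_trans[OF Ay[of ?y]] norm_consensus_le) auto
    finally have "norm ?y * norm ?y \<le> norm ?y * (sqrt R * norm w)" by (simp add: ac_simps)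
    then show ?thesis using False by simp
  qed
  have Dw: "norm (D *v w) \<le> norm w" for w
  proof -
    have e: "(D *v w) $ p = D $ p $ p * w $ p" for p
    proof -
      have "(D *v w) $ p = (\<Sum>q\<in>UNIV. D $ p $ q * w $ q)" by (simp add: matrix_vector_mult_def)
      also have "\<dots> = (\<Sum>q\<in>UNIV. if q = p then D $ p $ p * w $ p else 0)"
      proof (rule sum.cong)
        fix q
        show "D $ p $ q * w $ q = (if q = p then D $ p $ p * w $ p else 0)"
          using D by (cases "q = p") (auto simp: binary_diagonal_def)
      qed simp
      finally show ?thesis by simp
    qed
    have "\<bar>(D *v w) $ p\<bar> \<le> \<bar>w $ p\<bar>" for p
    proof -
      have "D $ p $ p = 0 \<or> D $ p $ p = 1" using D by (auto simp: binary_diagonal_def)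
      then show ?thesis unfolding e by auto
    qed
    then show ?thesis unfolding norm_vec_def by (intro L2_set_mono) auto
  qed
  have "norm (transpose A *v (D *v (A *v y))) \<le> sqrt R * norm (A *v y)"
    using At[of "D *v (A *v y)"] Dw[of "A *v y"] R by (meson mult_left_mono order_trans real_sqrt_ge_zero)
  also have "\<dots> \<le> sqrt R * (sqrt R * norm (consensus *v y))"
    using Ay[of y] R by (intro mult_left_mono) auto
  finally show ?thesis using R by (simp flip: mult.assoc)
qed

text \<open>\<open>A\<close> kills stacked vectors with equal blocks, as \<open>|A y|\<^sup>2\<close> is bounded by the disagreement of \<open>y\<close>;
  by duality the range of the transpose has average zero.\<close>

lemma consensus_transpose_mult:
  fixes A :: "real^('n::finite \<times> 'd::finite)^'m::finite"
  assumes upper: "transpose A ** A \<preceq>\<^sub>L R *\<^sub>R consensus"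
  shows "consensus *v (transpose A *v w) = transpose A *v w"
proof -
  have A0: "A *v (y - consensus *v y) = 0" for y :: "real^('n \<times> 'd)"
  proof -
    let ?y = "y - consensus *v y"
    have "consensus *v ?y = 0" by (simp add: matrix_vector_mult_diff_distrib)
    moreover have "0 \<le> ?y \<bullet> ((R *\<^sub>R consensus - transpose A ** A) *v ?y)" using upper by (simp add: loewner_le_def)
    ultimately have "(norm (A *v ?y))\<^sup>2 \<le> 0"
      unfolding matrix_vector_mult_diff_rdistrib inner_diff_right inner_gram inner_pinched by simp
    then show ?thesis by simp
  qed
  have "(consensus *v (transpose A *v w)) \<bullet> y = (transpose A *v w) \<bullet> y" for y
  proof -
    have "A *v y = A *v (consensus *v y)" using A0[of y] by (simp add: matrix_vector_mult_diff_distrib)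
    then show ?thesis by (metis consensus_inner transpose_inner)
  qed
  then show ?thesis by (subst vector_eq_rdot[symmetric]) simp
qed

section \<open>Gradients\<close>

text \<open>The Riesz vector of the derivative, built from an orthonormal basis.\<close>

lemma differentiable_gderiv:
  fixes f :: "'a::euclidean_space \<Rightarrow> real"
  assumes "f differentiable (at y)"
  shows "GDERIV f y :> gradient f y"
proof -
  obtain f' where f': "(f has_derivative f') (at y)" using assms by (auto simp: differentiable_def)
  interpret f': bounded_linear f' by (rule has_derivative_bounded_linear[OF f'])
  define D where "D = (\<Sum>b\<in>Basis. f' b *\<^sub>R b)"
  have "f' h = h \<bullet> D" for h
  proof -
    have "f' h = f' (\<Sum>b\<in>Basis. (h \<bullet> b) *\<^sub>R b)" by (simp add: euclidean_representation)
    also have "\<dots> = h \<bullet> D" by (simp add: f'.sum f'.scaleR D_def inner_sum_right mult.commute)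
    finally show ?thesis .
  qed
  then have "f' = (\<lambda>h. h \<bullet> D)" by (rule ext)
  then have D: "GDERIV f y :> D" unfolding gderiv_def using f' by simp
  have "D' = D" if "GDERIV f y :> D'" for D'
  proof -
    have "(\<lambda>h. h \<bullet> D') = (\<lambda>h. h \<bullet> D)"
      using that D unfolding gderiv_def by (rule has_derivative_unique)
    then have "h \<bullet> D' = h \<bullet> D" for h by metis
    then show ?thesis using vector_eq_ldot by blast
  qed
  with D have "gradient f y = D" unfolding gradient_def by (rule the_equality)
  then show ?thesis using D by simp
qed

lemma gradient_eqI:
  fixes f :: "'a::euclidean_space \<Rightarrow> real"
  assumes "GDERIV f y :> D"
  shows "gradient f y = D"
proof -
  have "GDERIV f y :> gradient f y"
    using assms by (intro differentiable_gderiv) (auto simp: gderiv_def differentiable_def)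
  then have "(\<lambda>h. h \<bullet> gradient f y) = (\<lambda>h. h \<bullet> D)"
    using assms unfolding gderiv_def by (rule has_derivative_unique)
  then have "h \<bullet> gradient f y = h \<bullet> D" for h by metis
  then show ?thesis using vector_eq_ldot by blast
qed

lemma gradient_directional_derivative:
  fixes f :: "'a::euclidean_space \<Rightarrow> real"
  assumes "f differentiable (at (y + t *\<^sub>R h))"
  shows "((\<lambda>t. f (y + t *\<^sub>R h)) has_real_derivative h \<bullet> gradient f (y + t *\<^sub>R h)) (at t)"
proof -
  have "((\<lambda>t. y + t *\<^sub>R h) has_derivative (\<lambda>t. t *\<^sub>R h)) (at t)"
    by (auto intro!: derivative_eq_intros)
  moreover have "(f has_derivative (\<lambda>k. k \<bullet> gradient f (y + t *\<^sub>R h))) (at (y + t *\<^sub>R h))"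
    using differentiable_gderiv[OF assms] by (simp add: gderiv_def)
  ultimately have "((\<lambda>t. f (y + t *\<^sub>R h)) has_derivative (\<lambda>t. (t *\<^sub>R h) \<bullet> gradient f (y + t' *\<^sub>R h))) (at t)" if "t' = t" for t'
    using that by (auto dest: has_derivative_compose)
  then show ?thesis by (simp add: has_field_derivative_def mult_commute_abs)
qed

text \<open>The descent lemma. Along the segment the difference of the two sides has a nonpositive derivative.\<close>

lemma smooth_upper_bound:
  fixes f :: "'a::euclidean_space \<Rightarrow> real"
  assumes diff: "\<And>y. f differentiable (at y)"
    and lip: "\<And>y z. norm (gradient f y - gradient f z) \<le> L * norm (y - z)"
  shows "f (y + h) \<le> f y + gradient f y \<bullet> h + L / 2 * (norm h)\<^sup>2"
proof -
  define \<psi> where "\<psi> t = f (y + t *\<^sub>R h) - t * (h \<bullet> gradient f y) - L / 2 * t\<^sup>2 * (norm h)\<^sup>2" for t :: real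
  have der: "(\<psi> has_real_derivative (h \<bullet> gradient f (y + t *\<^sub>R h) - h \<bullet> gradient f y - L * t * (norm h)\<^sup>2)) (at t)" for t
    unfolding \<psi>_def by (auto intro!: derivative_eq_intros gradient_directional_derivative diff)
  have "\<psi> 1 \<le> \<psi> 0"
  proof (rule DERIV_nonpos_imp_nonincreasing[of 0 1 \<psi>])
    fix t :: real assume t: "0 \<le> t" "t \<le> 1"
    have "h \<bullet> (gradient f (y + t *\<^sub>R h) - gradient f y) \<le> norm h * norm (gradient f (y + t *\<^sub>R h) - gradient f y)"
      by (rule norm_cauchy_schwarz)
    also have "\<dots> \<le> norm h * (L * norm (t *\<^sub>R h))"
      using lip[of "y + t *\<^sub>R h" y] by (intro mult_left_mono) auto
    also have "\<dots> = L * t * (norm h)\<^sup>2" using t by (simp add: power2_eq_square)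
    finally show "\<exists>d'. DERIV \<psi> t :> d' \<and> d' \<le> 0" using der[of t] by (auto simp: inner_diff_right intro!: exI)
  qed simp
  then show ?thesis by (simp add: \<psi>_def inner_commute)
qed

lemma gradient_average:
  fixes f :: "'n::finite \<Rightarrow> 'a::euclidean_space \<Rightarrow> real"
  assumes "\<And>i. f i differentiable (at y)"
  shows "gradient (\<lambda>y. k * (\<Sum>i\<in>UNIV. f i y)) y = k *\<^sub>R (\<Sum>i\<in>UNIV. gradient (f i) y)"
proof (rule gradient_eqI)
  have "(f i has_derivative (\<lambda>h. h \<bullet> gradient (f i) y)) (at y)" for i
    using differentiable_gderiv[OF assms] by (simp add: gderiv_def)
  then have "((\<lambda>y. k * (\<Sum>i\<in>UNIV. f i y)) has_derivative (\<lambda>h. k * (\<Sum>i\<in>UNIV. h \<bullet> gradient (f i) y))) (at y)"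
    by (intro has_derivative_mult_right has_derivative_sum)
  then show "GDERIV (\<lambda>y. k * (\<Sum>i\<in>UNIV. f i y)) y :> k *\<^sub>R (\<Sum>i\<in>UNIV. gradient (f i) y)"
    by (simp add: gderiv_def inner_sum_right)
qed

lemma stacked_gradient_lipschitz:
  fixes f :: "'n::finite \<Rightarrow> real^'d::finite \<Rightarrow> real"
  assumes "\<And>i y z. norm (gradient (f i) y - gradient (f i) z) \<le> L * norm (y - z)" "0 \<le> L"
  shows "norm (stacked_gradient f x - stacked_gradient f y) \<le> L * norm (x - y)"
proof (rule power2_le_imp_le)
  have "(norm (stacked_gradient f x - stacked_gradient f y))\<^sup>2
      = (\<Sum>i\<in>UNIV. (norm (gradient (f i) (block x i) - gradient (f i) (block y i)))\<^sup>2)"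
    by (simp add: norm_sq_blocks stacked_gradient_def)
  also have "\<dots> \<le> (\<Sum>i\<in>UNIV. (L * norm (block x i - block y i))\<^sup>2)"
    by (intro sum_mono power_mono assms) auto
  also have "\<dots> = (L * norm (x - y))\<^sup>2"
    by (simp add: norm_sq_blocks power_mult_distrib sum_distrib_left)
  finally show "(norm (stacked_gradient f x - stacked_gradient f y))\<^sup>2 \<le> (L * norm (x - y))\<^sup>2" .
qed (use assms in simp)

section \<open>Joint measurability of sampled gradients\<close>

text \<open>Approximating the first argument by measurable functions with finitely many values reduces the
  claim to measurability in the second argument.\<close>

lemma borel_measurable_caratheodory:
  fixes h :: "'a::euclidean_space \<Rightarrow> 's \<Rightarrow> 'b::{second_countable_topology,metric_space}"
  assumes meas: "\<And>y. h y \<in> borel_measurable M"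
    and cont: "\<And>s. s \<in> space M \<Longrightarrow> continuous_on UNIV (\<lambda>y. h y s)"
  shows "(\<lambda>(y, s). h y s) \<in> borel_measurable (borel \<Otimes>\<^sub>M M)"
proof -
  obtain q :: "nat \<Rightarrow> 'a \<Rightarrow> 'a" where q: "\<And>k. simple_function borel (q k)" "\<And>y. (\<lambda>k. q k y) \<longlonglongrightarrow> y"
    using borel_measurable_implies_sequence_metric[of "\<lambda>y. y" borel 0] by auto
  show ?thesis
  proof (rule borel_measurable_LIMSEQ_metric)
    fix k
    have [measurable]: "q k \<in> measurable borel (count_space (range (q k)))"
      using q(1)[of k] by (auto simp: simple_function_def intro!: measurable_count_space_eq2[THEN iffD2] simp: measurable_count_space_eq2)
    show "(\<lambda>p. h (q k (fst p)) (snd p)) \<in> borel_measurable (borel \<Otimes>\<^sub>M M)"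
    proof (rule measurable_compose_countable'[where I="range (q k)"])
      show "(\<lambda>p. h c (snd p)) \<in> borel_measurable (borel \<Otimes>\<^sub>M M)" for c using meas[of c] by measurable
      show "(\<lambda>p. q k (fst p)) \<in> measurable (borel \<Otimes>\<^sub>M M) (count_space (range (q k)))" by measurable
      show "countable (range (q k))" using q(1)[of k] by (auto simp: simple_function_def intro: countable_finite)
    qed
  next
    fix p :: "'a \<times> 's" assume "p \<in> space (borel \<Otimes>\<^sub>M M)"
    then have "continuous_on UNIV (\<lambda>y. h y (snd p))" by (intro cont) (auto simp: space_pair_measure)
    then have "(\<lambda>k. h (q k (fst p)) (snd p)) \<longlonglongrightarrow> h (fst p) (snd p)"
      using q(2)[of "fst p"] by (auto intro: continuous_on_tendsto_compose)
    then show "(\<lambda>k. h (q k (fst p)) (snd p)) \<longlonglongrightarrow> (case p of (y, s) \<Rightarrow> h y s)" by (simp add: split_beta)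
  qed
qed

text \<open>The iterates at which sampled gradients are evaluated are random, so measurability in the sample
  alone is not enough. A differentiable integrand is jointly measurable by continuity in the first
  argument, and its partial derivatives are limits of difference quotients.\<close>

lemma gradient_sample_measurable:
  fixes h :: "'a::euclidean_space \<Rightarrow> 's \<Rightarrow> real"
  assumes meas: "\<And>y. h y \<in> borel_measurable M"
    and diff: "\<And>s y. s \<in> space M \<Longrightarrow> (\<lambda>z. h z s) differentiable (at y)"
  shows "(\<lambda>(y, s). gradient (\<lambda>z. h z s) y) \<in> borel_measurable (borel \<Otimes>\<^sub>M M)"
proof -
  have h [measurable]: "(\<lambda>(y, s). h y s) \<in> borel_measurable (borel \<Otimes>\<^sub>M M)"
    using meas diff
    by (intro borel_measurable_caratheodory) (auto intro!: differentiable_imp_continuous_on simp: differentiable_on_def differentiable_at_withinI)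
  show ?thesis
  proof (subst borel_measurable_euclidean_space, rule ballI)
    fix b :: 'a assume "b \<in> Basis"
    show "(\<lambda>p. (case p of (y, s) \<Rightarrow> gradient (\<lambda>z. h z s) y) \<bullet> b) \<in> borel_measurable (borel \<Otimes>\<^sub>M M)"
    proof (rule borel_measurable_LIMSEQ_real)
      fix k :: nat
      have "(\<lambda>p. (h (fst p + (1 / real (Suc k)) *\<^sub>R b) (snd p))) \<in> borel_measurable (borel \<Otimes>\<^sub>M M)"
        using measurable_compose[OF _ h, of "\<lambda>p. (fst p + (1 / real (Suc k)) *\<^sub>R b, snd p)" "borel \<Otimes>\<^sub>M M"] by simp
      moreover have "(\<lambda>p. h (fst p) (snd p)) \<in> borel_measurable (borel \<Otimes>\<^sub>M M)"
        using h by (simp add: split_beta')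
      ultimately show "(\<lambda>p. (h (fst p + (1 / real (Suc k)) *\<^sub>R b) (snd p) - h (fst p) (snd p)) / (1 / real (Suc k)))
          \<in> borel_measurable (borel \<Otimes>\<^sub>M M)" by measurable
    next
      fix p :: "'a \<times> 's" assume p: "p \<in> space (borel \<Otimes>\<^sub>M M)"
      obtain y s where ys: "p = (y, s)" by (cases p)
      have s: "s \<in> space M" using p by (auto simp: ys space_pair_measure)
      have "((\<lambda>t. h (y + t *\<^sub>R b) s) has_real_derivative b \<bullet> gradient (\<lambda>z. h z s) (y + 0 *\<^sub>R b)) (at 0)"
        by (rule gradient_directional_derivative[OF diff[OF s]])
      then have "((\<lambda>t. (h (y + t *\<^sub>R b) s - h y s) / t) \<longlongrightarrow> b \<bullet> gradient (\<lambda>z. h z s) y) (at 0)"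
        by (simp add: DERIV_def)
      moreover have "filterlim (\<lambda>k. 1 / real (Suc k)) (at 0) sequentially"
        using LIMSEQ_inverse_real_of_nat by (auto simp: filterlim_at inverse_eq_divide)
      ultimately have "(\<lambda>k. (h (y + (1 / real (Suc k)) *\<^sub>R b) s - h y s) / (1 / real (Suc k))) \<longlonglongrightarrow> b \<bullet> gradient (\<lambda>z. h z s) y"
        by (rule filterlim_compose)
      then show "(\<lambda>k. (h (fst p + (1 / real (Suc k)) *\<^sub>R b) (snd p) - h (fst p) (snd p)) / (1 / real (Suc k)))
          \<longlonglongrightarrow> (case p of (y, s) \<Rightarrow> gradient (\<lambda>z. h z s) y) \<bullet> b"
        by (simp add: ys inner_commute)
    qed
  qed
qed

section \<open>Second moments\<close>

lemma (in prob_space) second_moment_shift: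
  fixes Z :: "'a \<Rightarrow> 'v::euclidean_space"
  assumes Z: "integrable M Z" "integrable M (\<lambda>x. (norm (Z x))\<^sup>2)" and mean: "expectation Z = 0"
  shows "integrable M (\<lambda>x. (norm (k + Z x))\<^sup>2)"
    and "expectation (\<lambda>x. (norm (k + Z x))\<^sup>2) = (norm k)\<^sup>2 + expectation (\<lambda>x. (norm (Z x))\<^sup>2)"
proof -
  have e: "(norm (k + Z x))\<^sup>2 = (norm k)\<^sup>2 + 2 * (k \<bullet> Z x) + (norm (Z x))\<^sup>2" for x
    by (simp add: power2_norm_eq_inner inner_add_left inner_add_right inner_commute)
  have i: "integrable M (\<lambda>x. k \<bullet> Z x)" using Z(1) by simp
  have "expectation (\<lambda>x. k \<bullet> Z x) = k \<bullet> expectation Z" using Z(1) by simp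
  then have "expectation (\<lambda>x. k \<bullet> Z x) = 0" using mean by simp
  then show "expectation (\<lambda>x. (norm (k + Z x))\<^sup>2) = (norm k)\<^sup>2 + expectation (\<lambda>x. (norm (Z x))\<^sup>2)"
    unfolding e using i Z(2) by (simp add: prob_space)
  show "integrable M (\<lambda>x. (norm (k + Z x))\<^sup>2)" unfolding e using i Z(2) by simp
qed

lemma (in prob_space) centered_second_moment_le:
  fixes Z :: "'a \<Rightarrow> 'v::euclidean_space"
  assumes Z: "integrable M Z" "integrable M (\<lambda>x. (norm (Z x))\<^sup>2)"
  shows "integrable M (\<lambda>x. (norm (Z x - expectation Z))\<^sup>2)"
    and "expectation (\<lambda>x. (norm (Z x - expectation Z))\<^sup>2) \<le> expectation (\<lambda>x. (norm (Z x))\<^sup>2)"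
proof -
  let ?m = "expectation Z"
  have e: "(norm (Z x - ?m))\<^sup>2 = (norm (Z x))\<^sup>2 - 2 * (?m \<bullet> Z x) + (norm ?m)\<^sup>2" for x
    by (simp add: power2_norm_eq_inner inner_diff_left inner_diff_right inner_commute)
  have i: "integrable M (\<lambda>x. ?m \<bullet> Z x)" using Z(1) by simp
  have "expectation (\<lambda>x. ?m \<bullet> Z x) = (norm ?m)\<^sup>2" using Z(1) by (simp add: power2_norm_eq_inner)
  then show "expectation (\<lambda>x. (norm (Z x - ?m))\<^sup>2) \<le> expectation (\<lambda>x. (norm (Z x))\<^sup>2)"
    unfolding e using i Z(2) by (simp add: prob_space)
  show "integrable M (\<lambda>x. (norm (Z x - ?m))\<^sup>2)" unfolding e using i Z(2) by simp
qed

section \<open>Chains driven by independent samples\<close>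

text \<open>Both measures agree on measurable rectangles.\<close>

lemma (in prob_space) indep_rv_distr_pair:
  assumes "indep_rv M MX X MY Y"
  shows "distr M (MX \<Otimes>\<^sub>M MY) (\<lambda>\<omega>. (X \<omega>, Y \<omega>)) = distr M MX X \<Otimes>\<^sub>M distr M MY Y"
proof -
  have X [measurable]: "X \<in> measurable M MX" and Y [measurable]: "Y \<in> measurable M MY"
    and ind: "indep_set {X -` B \<inter> space M |B. B \<in> sets MX} {Y -` B \<inter> space M |B. B \<in> sets MY}"
    using assms by (auto simp: indep_rv_def)
  interpret X: prob_space "distr M MX X" by (rule prob_space_distr) fact
  interpret Y: prob_space "distr M MY Y" by (rule prob_space_distr) fact
  show ?thesis
  proof (rule pair_measure_eqI[symmetric])
    show "sigma_finite_measure (distr M MX X)" "sigma_finite_measure (distr M MY Y)" by unfold_locales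
    show "sets (distr M MX X \<Otimes>\<^sub>M distr M MY Y) = sets (distr M (MX \<Otimes>\<^sub>M MY) (\<lambda>\<omega>. (X \<omega>, Y \<omega>)))"
      by (simp cong: sets_pair_measure_cong)
    fix A B assume AB: "A \<in> sets (distr M MX X)" "B \<in> sets (distr M MY Y)"
    then have [measurable]: "A \<in> sets MX" "B \<in> sets MY" by auto
    have "prob ((X -` A \<inter> space M) \<inter> (Y -` B \<inter> space M)) = prob (X -` A \<inter> space M) * prob (Y -` B \<inter> space M)"
      by (rule indep_setD[OF ind]) auto
    moreover have "(\<lambda>\<omega>. (X \<omega>, Y \<omega>)) -` (A \<times> B) \<inter> space M = (X -` A \<inter> space M) \<inter> (Y -` B \<inter> space M)" by auto
    ultimately show "emeasure (distr M MX X) A * emeasure (distr M MY Y) B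
        = emeasure (distr M (MX \<Otimes>\<^sub>M MY) (\<lambda>\<omega>. (X \<omega>, Y \<omega>))) (A \<times> B)"
      by (simp add: emeasure_distr emeasure_eq_measure ennreal_mult)
  qed
qed

text \<open>The state at time \<open>t\<close> as a function of the initial state and of the whole sample path; on this
  canonical space the dependence on single samples can be read off.\<close>

primrec iterate_chain :: "('b \<times> 's \<Rightarrow> 'b) \<Rightarrow> nat \<Rightarrow> 'b \<times> (nat \<Rightarrow> 's) \<Rightarrow> 'b" where
  "iterate_chain step 0 z = fst z"
| "iterate_chain step (Suc t) z = step (iterate_chain step t z, snd z (Suc t))"

lemma iterate_chain_upd: "t < k \<Longrightarrow> iterate_chain step t (i, y(k := w)) = iterate_chain step t (i, y)"
  by (induction t) auto

lemma measurable_iterate_chain [measurable]: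
  assumes [measurable]: "step \<in> measurable (B \<Otimes>\<^sub>M N) B"
  shows "iterate_chain step t \<in> measurable (B \<Otimes>\<^sub>M (\<Pi>\<^sub>M t\<in>{1::nat..}. N)) B"
proof (induction t)
  case (Suc t)
  note Suc[measurable]
  have [measurable]: "(\<lambda>y. y (Suc t)) \<in> measurable (\<Pi>\<^sub>M t\<in>{1::nat..}. N) N"
    by (rule measurable_component_singleton) auto
  show ?case unfolding iterate_chain.simps by measurable
qed (simp del: One_nat_def)

lemma measurable_iterate_chain' [measurable (raw)]:
  assumes "step \<in> measurable (B \<Otimes>\<^sub>M N) B" "k \<notin> {1..t}" "i \<in> space B"
  shows "(\<lambda>y. iterate_chain step t (i, y)) \<in> measurable (\<Pi>\<^sub>M t\<in>{1::nat..} - {k}. N) B"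
  using assms(2)
proof (induction t)
  case 0
  then show ?case using assms(3) by simp
next
  case (Suc t)
  then have [measurable]: "(\<lambda>y. iterate_chain step t (i, y)) \<in> measurable (\<Pi>\<^sub>M t\<in>{1::nat..} - {k}. N) B" by auto
  have [measurable]: "(\<lambda>y. y (Suc t)) \<in> measurable (\<Pi>\<^sub>M t\<in>{1::nat..} - {k}. N) N"
    by (rule measurable_component_singleton) (use Suc.prems in auto)
  show ?case unfolding iterate_chain.simps snd_conv by (rule measurable_compose[OF measurable_Pair assms(1)]) measurable
qed

text \<open>A Markov chain given by its update function, driven by i.i.d. samples that are independent of the
  initial state; the initial state has time \<open>0\<close> and the first sample has index \<open>1\<close>.\<close>

locale sampled_chain = prob_space M for M :: "'w measure" +
  fixes N :: "'s measure" and B :: "'b measure"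
    and \<xi> :: "nat \<Rightarrow> 'w \<Rightarrow> 's" and S :: "nat \<Rightarrow> 'w \<Rightarrow> 'b" and step :: "'b \<times> 's \<Rightarrow> 'b"
  assumes prob_N: "prob_space N"
    and xi_indep: "indep_vars (\<lambda>_. N) \<xi> {1..}"
    and xi_distr: "\<And>t. t \<ge> 1 \<Longrightarrow> distr M N (\<xi> t) = N"
    and init_indep: "indep_rv M B (S 0) (\<Pi>\<^sub>M t\<in>{1..}. N) (\<lambda>\<omega>. \<lambda>t\<in>{1..}. \<xi> t \<omega>)"
    and step: "step \<in> measurable (B \<Otimes>\<^sub>M N) B"
    and S_Suc: "\<And>t \<omega>. \<omega> \<in> space M \<Longrightarrow> S (Suc t) \<omega> = step (S t \<omega>, \<xi> (Suc t) \<omega>)"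
begin

sublocale N: prob_space N by (rule prob_N)

definition path :: "'w \<Rightarrow> 'b \<times> (nat \<Rightarrow> 's)" where
  "path \<omega> = (S 0 \<omega>, \<lambda>t\<in>{1..}. \<xi> t \<omega>)"

lemma S_eq: "\<omega> \<in> space M \<Longrightarrow> S t \<omega> = iterate_chain step t (path \<omega>)"
  by (induction t) (auto simp: path_def S_Suc)

lemma snd_path: "snd (path \<omega>) (Suc t) = \<xi> (Suc t) \<omega>" by (simp add: path_def)

lemma path_measurable [measurable]: "path \<in> measurable M (B \<Otimes>\<^sub>M (\<Pi>\<^sub>M t\<in>{1..}. N))"
  using init_indep unfolding indep_rv_def path_def by (intro measurable_Pair) auto

lemma S_measurable [measurable]: "S t \<in> measurable M B"
  using measurable_compose[OF path_measurable measurable_iterate_chain[OF step]]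
  by (subst measurable_cong[OF S_eq]) auto

lemma xi_measurable: "t \<ge> 1 \<Longrightarrow> \<xi> t \<in> measurable M N"
  using xi_indep by (auto simp: indep_vars_def)

lemma distr_path: "distr M (B \<Otimes>\<^sub>M (\<Pi>\<^sub>M t\<in>{1..}. N)) path = distr M B (S 0) \<Otimes>\<^sub>M (\<Pi>\<^sub>M t\<in>{1..}. N)"
proof -
  have "distr M (\<Pi>\<^sub>M t\<in>{1..}. N) (\<lambda>\<omega>. \<lambda>t\<in>{1..}. \<xi> t \<omega>) = (\<Pi>\<^sub>M t\<in>{1..}. distr M N (\<xi> t))"
    using xi_indep xi_measurable by (subst (asm) indep_vars_iff_distr_eq_PiM') auto
  also have "\<dots> = (\<Pi>\<^sub>M t\<in>{1..}. N)" using xi_distr by (intro PiM_cong) auto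
  finally show ?thesis
    using indep_rv_distr_pair[OF init_indep] unfolding path_def by simp
qed

text \<open>The state at time \<open>t\<close> is a function of the initial state and the first \<open>t\<close> samples, so
  the next sample may be integrated out first, with the state held fixed.\<close>

lemma nn_integral_next:
  assumes h: "h \<in> borel_measurable (B \<Otimes>\<^sub>M N)"
  shows "(\<integral>\<^sup>+\<omega>. h (S t \<omega>, \<xi> (Suc t) \<omega>) \<partial>M) = (\<integral>\<^sup>+\<omega>. (\<integral>\<^sup>+w. h (S t \<omega>, w) \<partial>N) \<partial>M)"
proof -
  note [measurable] = h step
  let ?P = "\<Pi>\<^sub>M t\<in>{1::nat..}. N" and ?I = "{1::nat..} - {Suc t}"
  let ?Q = "\<Pi>\<^sub>M t\<in>?I. N" and ?\<mu> = "distr M B (S 0)" and ?J = "iterate_chain step t"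
  interpret \<mu>: prob_space ?\<mu> by (rule prob_space_distr) simp
  interpret P: prob_space ?P by (rule prob_space_PiM) (rule prob_N)
  interpret Q: prob_space ?Q by (rule prob_space_PiM) (rule prob_N)
  interpret PQ: pair_sigma_finite N ?Q by unfold_locales
  have [measurable]: "(\<lambda>y. y (Suc t)) \<in> measurable ?P N"
    by (rule measurable_component_singleton) auto
  have "insert (Suc t) ?I = {1..}" by auto
  then have ins: "?P = distr (N \<Otimes>\<^sub>M ?Q) ?P (\<lambda>(w, y). y(Suc t := w))"
    using distr_pair_PiM_eq_PiM[of ?I "\<lambda>_. N" "Suc t"] prob_N by simp
  have upd [measurable]: "(\<lambda>(w, y). y(Suc t := w)) \<in> measurable (N \<Otimes>\<^sub>M ?Q) ?P"
  proof -
    have "(\<lambda>(w, y). y(Suc t := w)) \<in> measurable (N \<Otimes>\<^sub>M ?Q) (\<Pi>\<^sub>M t\<in>insert (Suc t) ?I. N)" by measurable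
    then show ?thesis using \<open>insert (Suc t) ?I = {1..}\<close> by simp
  qed
  have ins_int: "(\<integral>\<^sup>+y. k y \<partial>?P) = (\<integral>\<^sup>+p. k ((snd p)(Suc t := fst p)) \<partial>(N \<Otimes>\<^sub>M ?Q))"
    if [measurable]: "k \<in> borel_measurable ?P" for k
    by (subst ins, subst nn_integral_distr) (auto simp: split_beta simp del: One_nat_def)
  have key: "(\<integral>\<^sup>+y. h (?J (i, y), y (Suc t)) \<partial>?P) = (\<integral>\<^sup>+y. (\<integral>\<^sup>+w. h (?J (i, y), w) \<partial>N) \<partial>?P)" if i: "i \<in> space B" for i
  proof -
    have [measurable]: "(\<lambda>y. ?J (i, y)) \<in> measurable ?Q B"
      by (rule measurable_iterate_chain'[OF step]) (use i in auto)
    have [measurable]: "(\<lambda>y. ?J (i, y)) \<in> measurable ?P B" using i by measurable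
    have "(\<integral>\<^sup>+y. h (?J (i, y), y (Suc t)) \<partial>?P) = (\<integral>\<^sup>+p. h (?J (i, snd p), fst p) \<partial>(N \<Otimes>\<^sub>M ?Q))"
      by (subst ins_int) (auto simp: iterate_chain_upd simp del: One_nat_def)
    also have "\<dots> = (\<integral>\<^sup>+y. (\<integral>\<^sup>+w. h (?J (i, y), w) \<partial>N) \<partial>?Q)"
      by (subst PQ.nn_integral_snd[symmetric]) (auto simp del: One_nat_def)
    also have "\<dots> = (\<integral>\<^sup>+w'. (\<integral>\<^sup>+y. (\<integral>\<^sup>+w. h (?J (i, y), w) \<partial>N) \<partial>?Q) \<partial>N)"
      by (simp add: N.emeasure_space_1)
    also have "\<dots> = (\<integral>\<^sup>+p. (\<integral>\<^sup>+w. h (?J (i, snd p), w) \<partial>N) \<partial>(N \<Otimes>\<^sub>M ?Q))"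
      by (subst Q.nn_integral_fst[symmetric]) (auto simp del: One_nat_def)
    also have "\<dots> = (\<integral>\<^sup>+y. (\<integral>\<^sup>+w. h (?J (i, y), w) \<partial>N) \<partial>?P)"
      by (subst ins_int) (auto simp: iterate_chain_upd simp del: One_nat_def)
    finally show ?thesis .
  qed
  have "(\<integral>\<^sup>+\<omega>. h (S t \<omega>, \<xi> (Suc t) \<omega>) \<partial>M) = (\<integral>\<^sup>+\<omega>. h (?J (path \<omega>), snd (path \<omega>) (Suc t)) \<partial>M)"
    by (intro nn_integral_cong) (simp add: S_eq snd_path)
  also have "\<dots> = (\<integral>\<^sup>+z. h (?J z, snd z (Suc t)) \<partial>(?\<mu> \<Otimes>\<^sub>M ?P))"
    unfolding distr_path[symmetric] by (subst nn_integral_distr) (auto simp del: One_nat_def)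
  also have "\<dots> = (\<integral>\<^sup>+i. (\<integral>\<^sup>+y. h (?J (i, y), y (Suc t)) \<partial>?P) \<partial>?\<mu>)"
    by (subst P.nn_integral_fst[symmetric]) (auto simp del: One_nat_def)
  also have "\<dots> = (\<integral>\<^sup>+i. (\<integral>\<^sup>+y. (\<integral>\<^sup>+w. h (?J (i, y), w) \<partial>N) \<partial>?P) \<partial>?\<mu>)"
    by (intro nn_integral_cong key) simp
  also have "\<dots> = (\<integral>\<^sup>+z. (\<integral>\<^sup>+w. h (?J z, w) \<partial>N) \<partial>(?\<mu> \<Otimes>\<^sub>M ?P))"
    by (subst P.nn_integral_fst[symmetric]) (auto simp del: One_nat_def)
  also have "\<dots> = (\<integral>\<^sup>+\<omega>. (\<integral>\<^sup>+w. h (?J (path \<omega>), w) \<partial>N) \<partial>M)"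
    unfolding distr_path[symmetric] by (subst nn_integral_distr) (auto simp del: One_nat_def)
  also have "\<dots> = (\<integral>\<^sup>+\<omega>. (\<integral>\<^sup>+w. h (S t \<omega>, w) \<partial>N) \<partial>M)"
    by (intro nn_integral_cong) (auto simp: S_eq)
  finally show ?thesis .
qed

text \<open>The drift condition is integrated along the chain and summed. Everything is nonnegative and stays in
  the extended reals, so no integrability of the later states has to be known in advance.\<close>

lemma telescoped_drift:
  fixes V D :: "'b \<Rightarrow> ennreal"
  assumes [measurable]: "V \<in> borel_measurable B" "D \<in> borel_measurable B"
    and drift: "\<And>s. s \<in> space B \<Longrightarrow> (\<integral>\<^sup>+w. V (step (s, w)) \<partial>N) + D s \<le> V s + c"
  shows "(\<Sum>t<T. \<integral>\<^sup>+\<omega>. D (S t \<omega>) \<partial>M) \<le> (\<integral>\<^sup>+\<omega>. V (S 0 \<omega>) \<partial>M) + of_nat T * c"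
proof -
  note [measurable] = step
  have one: "(\<integral>\<^sup>+\<omega>. V (S (Suc t) \<omega>) \<partial>M) + (\<integral>\<^sup>+\<omega>. D (S t \<omega>) \<partial>M) \<le> (\<integral>\<^sup>+\<omega>. V (S t \<omega>) \<partial>M) + c" for t
  proof -
    have "(\<integral>\<^sup>+\<omega>. V (S (Suc t) \<omega>) \<partial>M) = (\<integral>\<^sup>+\<omega>. V (step (S t \<omega>, \<xi> (Suc t) \<omega>)) \<partial>M)"
      by (intro nn_integral_cong) (simp add: S_Suc)
    also have "\<dots> = (\<integral>\<^sup>+\<omega>. (\<integral>\<^sup>+w. V (step (S t \<omega>, w)) \<partial>N) \<partial>M)"
      by (rule nn_integral_next) measurable
    finally have "(\<integral>\<^sup>+\<omega>. V (S (Suc t) \<omega>) \<partial>M) + (\<integral>\<^sup>+\<omega>. D (S t \<omega>) \<partial>M)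
      = (\<integral>\<^sup>+\<omega>. (\<integral>\<^sup>+w. V (step (S t \<omega>, w)) \<partial>N) + D (S t \<omega>) \<partial>M)"
      by (subst nn_integral_add) auto
    also have "\<dots> \<le> (\<integral>\<^sup>+\<omega>. V (S t \<omega>) + c \<partial>M)"
      by (intro nn_integral_mono drift) (metis S_measurable measurable_space)
    also have "\<dots> = (\<integral>\<^sup>+\<omega>. V (S t \<omega>) \<partial>M) + c"
      by (subst nn_integral_add) (auto simp: emeasure_space_1)
    finally show ?thesis .
  qed
  have "(\<integral>\<^sup>+\<omega>. V (S T \<omega>) \<partial>M) + (\<Sum>t<T. \<integral>\<^sup>+\<omega>. D (S t \<omega>) \<partial>M) \<le> (\<integral>\<^sup>+\<omega>. V (S 0 \<omega>) \<partial>M) + of_nat T * c"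
  proof (induction T)
    case (Suc T)
    have "(\<integral>\<^sup>+\<omega>. V (S (Suc T) \<omega>) \<partial>M) + (\<Sum>t<Suc T. \<integral>\<^sup>+\<omega>. D (S t \<omega>) \<partial>M)
      = (\<Sum>t<T. \<integral>\<^sup>+\<omega>. D (S t \<omega>) \<partial>M) + ((\<integral>\<^sup>+\<omega>. V (S (Suc T) \<omega>) \<partial>M) + (\<integral>\<^sup>+\<omega>. D (S T \<omega>) \<partial>M))"
      by (simp add: ac_simps)
    also have "\<dots> \<le> (\<Sum>t<T. \<integral>\<^sup>+\<omega>. D (S t \<omega>) \<partial>M) + ((\<integral>\<^sup>+\<omega>. V (S T \<omega>) \<partial>M) + c)"
      by (intro add_left_mono one)
    also have "\<dots> = ((\<integral>\<^sup>+\<omega>. V (S T \<omega>) \<partial>M) + (\<Sum>t<T. \<integral>\<^sup>+\<omega>. D (S t \<omega>) \<partial>M)) + c" by (simp add: ac_simps)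
    also have "\<dots> \<le> ((\<integral>\<^sup>+\<omega>. V (S 0 \<omega>) \<partial>M) + of_nat T * c) + c"
      by (intro add_right_mono Suc.IH)
    finally show ?case by (simp add: distrib_left distrib_right ac_simps)
  qed simp
  then show ?thesis by (meson add_increasing order_refl order_trans zero_le)
qed

text \<open>The random time is independent of the whole path, so conditioning on it leaves the average over
  the time points.\<close>

lemma nn_integral_uniform_time:
  fixes D :: "'b \<Rightarrow> ennreal"
  assumes [measurable]: "D \<in> borel_measurable B"
    and tau: "distr M (count_space UNIV) \<tau> = measure_pmf (pmf_of_set {0..<T})" and T: "T \<ge> 1"
    and tau_indep: "indep_rv M (count_space UNIV) \<tau> (B \<Otimes>\<^sub>M (\<Pi>\<^sub>M t\<in>{1..}. N)) path"
  shows "of_nat T * (\<integral>\<^sup>+\<omega>. D (S (\<tau> \<omega>) \<omega>) \<partial>M) = (\<Sum>t<T. \<integral>\<^sup>+\<omega>. D (S t \<omega>) \<partial>M)"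
proof -
  note [measurable] = step
  let ?Z = "B \<Otimes>\<^sub>M (\<Pi>\<^sub>M t\<in>{1..}. N)"
  have [measurable]: "\<tau> \<in> measurable M (count_space UNIV)" using tau_indep by (simp add: indep_rv_def)
  interpret Z: prob_space "distr M ?Z path" by (rule prob_space_distr) (rule path_measurable)
  interpret T: prob_space "distr M (count_space UNIV) \<tau>" by (rule prob_space_distr) simp
  have m [measurable]: "(\<lambda>(t, z). D (iterate_chain step t z)) \<in> borel_measurable (count_space UNIV \<Otimes>\<^sub>M ?Z)"
    by (rule measurable_pair_measure_countable1) (auto simp del: One_nat_def)
  have m': "(\<lambda>(t, z). D (iterate_chain step t z)) \<in> borel_measurable (distr M (count_space UNIV) \<tau> \<Otimes>\<^sub>M distr M ?Z path)"
    by (subst measurable_cong_sets[OF sets_pair_measure_cong[OF sets_distr sets_distr] refl]) (rule m)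
  have "(\<integral>\<^sup>+\<omega>. D (S (\<tau> \<omega>) \<omega>) \<partial>M) = (\<integral>\<^sup>+\<omega>. (\<lambda>(t, z). D (iterate_chain step t z)) (\<tau> \<omega>, path \<omega>) \<partial>M)"
    by (intro nn_integral_cong) (simp add: S_eq)
  also have "\<dots> = (\<integral>\<^sup>+p. (\<lambda>(t, z). D (iterate_chain step t z)) p \<partial>distr M (count_space UNIV \<Otimes>\<^sub>M ?Z) (\<lambda>\<omega>. (\<tau> \<omega>, path \<omega>)))"
    by (subst nn_integral_distr) (auto simp del: One_nat_def)
  also have "\<dots> = (\<integral>\<^sup>+t. \<integral>\<^sup>+z. D (iterate_chain step t z) \<partial>distr M ?Z path \<partial>distr M (count_space UNIV) \<tau>)"
    unfolding indep_rv_distr_pair[OF tau_indep]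
    by (subst Z.nn_integral_fst[OF m', symmetric]) simp
  also have "\<dots> = (\<integral>\<^sup>+t. (\<integral>\<^sup>+\<omega>. D (S t \<omega>) \<partial>M) \<partial>measure_pmf (pmf_of_set {0..<T}))"
    unfolding tau by (intro nn_integral_cong, subst nn_integral_distr) (auto simp: S_eq intro!: nn_integral_cong simp del: One_nat_def)
  also have "\<dots> = (\<Sum>t<T. \<integral>\<^sup>+\<omega>. D (S t \<omega>) \<partial>M) / of_nat T"
    using T by (subst nn_integral_pmf_of_set) (auto simp: atLeast0LessThan lessThan_empty_iff)
  finally show ?thesis using T
    by (simp add: ennreal_times_divide mult.commute[of "of_nat T"] mult_divide_eq_ennreal)
qed

end

section \<open>Consequences of the parameter conditions\<close>

lemma le_div_mult_iff: "(0::real) < y \<Longrightarrow> x \<le> p / y * q \<longleftrightarrow> x * y \<le> p * q"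
  by (simp add: field_simps)

text \<open>The scalar part of the hypotheses of the main theorem, under the names used there.\<close>

locale storm_parameters =
  fixes \<alpha> \<eta> \<gamma> \<beta> a\<^sub>x a\<^sub>l L L\<^sub>s \<sigma>\<^sub>A \<rho>max \<rho>min \<rho>bmax :: real
    and a b c d e \<phi> g :: real
    and n S PP G :: real
  assumes n_ge: "n \<ge> 1"
    and params: "\<alpha> > 0" "\<eta> > 0" "\<gamma> > 0" "\<beta> > 0" "a\<^sub>x \<in> {0..1}" "a\<^sub>l \<in> {0..1}"
    and L_pos: "L > 0"
    and rho: "\<rho>max \<ge> \<rho>min" "\<rho>min > 0" "\<rho>bmax > 0"
    and sigmaA_nonneg: "\<sigma>\<^sub>A \<ge> 0"
    and Ls_pos: "L\<^sub>s > 0"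
    and consts_pos: "a > 0" "b > 0" "c > 0" "d > 0" "e > 0" "\<phi> > 0" "g > 0"
    and S_def: "S = L\<^sub>s\<^sup>2 + L\<^sup>2"
    and PP_def: "PP = \<rho>max\<^sup>2 + \<rho>bmax\<^sup>2"
    and G_def: "G = L\<^sub>s\<^sup>2 + L\<^sup>2 + \<gamma>\<^sup>2 / \<alpha>\<^sup>2 * \<rho>bmax\<^sup>2 + \<gamma>\<^sup>2 / \<alpha>\<^sup>2 * \<rho>max\<^sup>2"
    and i_alpha: "\<alpha> \<le> sqrt (a\<^sub>x / (64 * S))"
      "\<alpha> \<le> \<gamma> * \<rho>min * sqrt (1 - \<gamma> * \<rho>min) / (sqrt 32 * L)" "\<alpha> \<le> 1 / sqrt 12" "\<alpha> \<le> \<eta>"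
    and i_gamma: "\<gamma> \<le> sqrt (a\<^sub>x / (64 * PP))"
    and i_rest: "\<eta> * \<beta> \<le> 1 / 12" "\<beta> \<le> 1" "0 < a\<^sub>x" "a\<^sub>x \<le> 1"
    and ii: "\<alpha> \<le> 1 / (512 * e * S)"
      "64 * \<phi> * \<alpha>\<^sup>2 * n * G \<le> \<alpha> / 24"
    and iii: "\<alpha> \<le> a * (\<gamma> * \<rho>min * n / (256 * L\<^sup>2))"
      "\<alpha>\<^sup>2 \<le> a / d * min (\<eta> * \<gamma> * \<rho>min / (768 * L\<^sup>2)) (\<eta> * \<gamma> * \<rho>min / 640)"
      "\<beta>\<^sup>2 \<le> min (a / b * (\<gamma> * \<rho>min\<^sup>2 / (1536 * \<rho>max\<^sup>2))) (a / c * (\<gamma> * \<rho>min / (1536 * \<rho>max\<^sup>2)))"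
      "\<beta> \<le> a / d * min (\<gamma> * \<rho>min / (512 * \<rho>max\<^sup>2)) (\<gamma> * \<rho>min / 640)"
      "\<alpha>\<^sup>2 \<le> min (a / e * (\<gamma> * \<rho>min * n / (8192 * L\<^sup>2 * S))) (a / g * (\<gamma> * \<rho>min / (8192 * L\<^sup>2 * PP)))"
      "\<gamma> \<le> min (a / e * (\<rho>min * n / (8192 * \<rho>max\<^sup>2 * S))) (a / g * (\<rho>min / (8192 * \<rho>max\<^sup>2 * PP)))"
      "\<sigma>\<^sub>A \<noteq> 0 \<Longrightarrow> a\<^sub>x\<^sup>2 \<le> a / \<phi> * (\<alpha>\<^sup>2 * \<rho>min / (5120 * \<gamma> * \<sigma>\<^sub>A\<^sup>2))"
      "64 * \<phi> * \<alpha>\<^sup>2 * L\<^sup>2 * G \<le> a * (\<gamma> * \<rho>min / 256)"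
      "64 * \<phi> * \<gamma>\<^sup>2 * \<rho>max\<^sup>2 * G \<le> a * (\<gamma> * \<rho>min / 256)"
      "\<sigma>\<^sub>A \<noteq> 0 \<Longrightarrow> a\<^sub>l\<^sup>2 \<le> a / g * (\<gamma> * \<rho>min / (2560 * \<sigma>\<^sub>A\<^sup>2))"
    and iv: "\<eta> \<le> d / a * inverse (28 * (1 - \<gamma> * \<rho>min) * (1 - \<gamma> * \<rho>min / 2))"
      "\<beta> + \<alpha> / \<eta> \<le> min (d / b * (\<eta> * \<rho>min / 28)) (d / c * (\<eta> / 28))"
      "\<eta> \<le> min (d / e * (n / (896 * S))) (d / g * (1 / 448))"
      "64 * \<phi> * \<eta>\<^sup>2 * G \<le> d * (\<eta> / 28)"
    and v: "b = \<eta> * (1 - \<gamma> * \<rho>min / 4) / (\<beta> * (1 - \<gamma> * \<rho>min)) * a"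
      "c = (d * (\<gamma> + \<eta> * \<beta>) - 2 * a * \<eta> * \<gamma> * (1 - \<gamma> * \<rho>min / 4) * inverse (1 - \<gamma> * \<rho>min)) / (2 * \<beta>)"
    and vi: "\<alpha> \<le> e * (a\<^sub>x / 2)"
    and vii: "\<alpha>\<^sup>2 \<le> \<phi> / a * (a\<^sub>x * \<gamma> * \<rho>min / 64)" "\<alpha>\<^sup>2 \<le> \<phi> / d * (a\<^sub>x * \<eta> / 384)"
      "\<alpha>\<^sup>2 * \<beta> \<le> \<phi> / d * (a\<^sub>x / 256)"
      "\<alpha>^4 \<le> \<phi> / d * (a\<^sub>x * \<eta> / 256)"
      "\<alpha>\<^sup>2 \<le> min (\<phi> / e * (a\<^sub>x * n / (256 * S))) (\<phi> / g * (a\<^sub>x / (256 * (1 + PP))))"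
    and viii: "\<beta> \<le> g / b * (a\<^sub>l * \<rho>min / 24)" "\<beta> \<le> g / c * (a\<^sub>l / 24)" "\<beta> \<le> g / d * (a\<^sub>l / 3)"
    and ix: "\<alpha>\<^sup>2 \<le> min (\<eta> * \<rho>min / (96 * b * n * L\<^sup>2)) (\<eta> / (96 * c * n * L\<^sup>2))"
      "\<alpha> \<le> \<eta> / (12 * d * n * L\<^sup>2)"
begin

text \<open>The contraction rate of one consensus step.\<close>

definition z where "z = \<gamma> * \<rho>min"
text \<open>The Young factor with which \<open>|(u - \<gamma> C u - \<eta> v) + r|\<^sup>2\<close> is split: \<open>\<kappa>\<close> times the main part leaves
  a contraction of order \<open>z\<close>, and \<open>\<kappa>\<close> is the factor contained in \<open>b\<close> and \<open>c\<close>.\<close>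

definition \<kappa> where "\<kappa> = (1 - z / 4) / (1 - z)"
text \<open>The variance of the graph noise at a vector of unit disagreement is at most \<open>q\<close>.\<close>

definition q where "q = min (\<sigma>\<^sub>A\<^sup>2) (\<rho>bmax\<^sup>2)"
text \<open>\<open>shift\<close> switches the additional term \<open>\<langle>u, Q w\<rangle>\<close> of the potential on, and \<open>g'\<close> is the weight of the
  graph error in the potential; \<open>Y\<close> is the descent in \<open>|w|\<^sup>2\<close> that this weight provides.\<close>

definition shift :: real where "shift = (if g * q * \<eta> \<le> d / 100 then 0 else 1)"
definition g' where "g' = (if g * q * \<eta> \<le> d / 100 then g else d / (200 * q * \<eta>))"
definition Y where "Y = g' * a\<^sub>l"

lemmas pos = params(1-4) L_pos rho(2,3) Ls_pos consts_pos i_rest(3)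

lemma rmax_pos: "\<rho>max > 0" using rho by linarith
lemma n_pos: "n > 0" using n_ge by linarith
lemma S_pos: "S > 0" and S_ge: "L\<^sub>s\<^sup>2 \<le> S"
  using S_def L_pos Ls_pos by (auto simp: add_pos_pos)
lemma PP_pos: "PP > 0" and PP_ge: "\<rho>max\<^sup>2 \<le> PP" "\<rho>bmax\<^sup>2 \<le> PP"
  using PP_def rho rmax_pos by (auto simp: add_pos_pos)
lemma G_ge: "L\<^sub>s\<^sup>2 + \<gamma>\<^sup>2 / \<alpha>\<^sup>2 * \<rho>bmax\<^sup>2 \<le> G"
  by (simp add: G_def)

lemma gamma_PP: "\<gamma>\<^sup>2 * PP \<le> a\<^sub>x / 64"
proof -
  have "\<gamma>\<^sup>2 \<le> a\<^sub>x / (64 * PP)"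
    using i_gamma params PP_pos i_rest(3) by (metis less_imp_le power2_eq_square power_mono real_sqrt_pow2 zero_le_divide_iff mult_nonneg_nonneg zero_le_numeral)
  then show ?thesis using PP_pos by (simp add: field_simps)
qed
lemma gamma_rbmax: "\<gamma>\<^sup>2 * \<rho>bmax\<^sup>2 \<le> a\<^sub>x / 64"
  using gamma_PP PP_ge(2) by (meson mult_left_mono order_trans zero_le_power2)
lemma gamma_rmax: "\<gamma> * \<rho>max \<le> 1 / 8"
proof -
  have "(\<gamma> * \<rho>max)\<^sup>2 \<le> a\<^sub>x / 64" 
    using gamma_PP PP_ge(1) unfolding power_mult_distrib by (meson mult_left_mono order_trans zero_le_power2)
  also have "\<dots> \<le> (1/8)\<^sup>2" using i_rest(4) by (simp add: power2_eq_square)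
  finally show ?thesis by (rule power2_le_imp_le) simp
qed
lemma z_pos: "z > 0" unfolding z_def using params rho by simp
lemma z_le: "z \<le> 1 / 8"
proof -
  have "\<gamma> * \<rho>min \<le> \<gamma> * \<rho>max" using params rho by (simp add: mult_left_mono)
  then show ?thesis using gamma_rmax unfolding z_def by linarith
qed
lemma kappa_bounds: "1 \<le> \<kappa>" "1 < \<kappa>" "\<kappa> \<le> 111/100" "\<kappa> \<le> 1 + 6/7 * z"
    "\<kappa> / (\<kappa> - 1) \<le> 4 / (3 * z)"
proof -
  have z: "0 < z" "z \<le> 1/8" using z_pos z_le .
  show "1 < \<kappa>" "1 \<le> \<kappa>" using z by (auto simp: \<kappa>_def field_simps)
  show "\<kappa> \<le> 111/100" using z by (simp add: \<kappa>_def field_simps)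
  have "z * z \<le> 1/8 * z" using z by (intro mult_right_mono) auto
  then show "\<kappa> \<le> 1 + 6/7 * z" using z by (simp add: \<kappa>_def field_simps)
  have "\<kappa> / (\<kappa> - 1) = (1 - z/4) / (3/4 * z)" using z by (simp add: \<kappa>_def field_simps)
  also have "\<dots> \<le> 4 / (3 * z)" using z by (simp add: field_simps)
  finally show "\<kappa> / (\<kappa> - 1) \<le> 4 / (3 * z)" .
qed
text \<open>With the next equation, this is what makes the cross terms cancel: \<open>b\<close> balances \<open>\<langle>u, v\<rangle>\<close> and \<open>c\<close>
  balances \<open>\<langle>C u, v\<rangle>\<close>.\<close>

lemma b_beta: "b * \<beta> = \<kappa> * a * \<eta>"
proof -
  have "1 - z \<noteq> 0" using z_le by linarith
  then show ?thesis unfolding v(1) \<kappa>_def z_def[symmetric] using pos(4) by simp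
qed
lemma c_beta: "2 * (c * \<beta>) = d * (\<gamma> + \<eta> * \<beta>) - 2 * \<kappa> * a * \<eta> * \<gamma>"
proof -
  have "2 * (c * \<beta>) = d * (\<gamma> + \<eta> * \<beta>) - 2 * a * \<eta> * \<gamma> * (1 - z / 4) * inverse (1 - z)"
    unfolding v(2) z_def[symmetric] using pos(4) by simp
  then show ?thesis by (simp add: \<kappa>_def divide_inverse[of _ "1 - z"] ac_simps)
qed

lemma alphaL: "\<alpha> * L \<le> z / 5" "\<alpha> * L \<le> 1/40" "\<alpha>\<^sup>2 * L\<^sup>2 \<le> z\<^sup>2 / 32"
proof -
  have "sqrt (1 - z) \<le> 1" using z_pos by simp
  have "(5::real)\<^sup>2 \<le> 32" by simp
  then have "5 \<le> sqrt 32" by (rule real_le_rsqrt)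
  have "\<alpha> * (sqrt 32 * L) \<le> z * sqrt (1 - z)" using i_alpha(2) pos by (simp add: field_simps z_def)
  also have "\<dots> \<le> z * 1" using \<open>sqrt (1 - z) \<le> 1\<close> z_pos by (intro mult_left_mono) auto
  finally have *: "\<alpha> * L * sqrt 32 \<le> z" by (simp add: mult.commute mult.left_commute)
  have "\<alpha> * L * 5 \<le> \<alpha> * L * sqrt 32" using \<open>5 \<le> sqrt 32\<close> pos by (intro mult_left_mono) auto
  then show 1: "\<alpha> * L \<le> z / 5" using * by linarith
  show "\<alpha> * L \<le> 1/40" using 1 z_le by linarith
  have "(\<alpha> * L * sqrt 32)\<^sup>2 \<le> z\<^sup>2" using * pos by (intro power_mono) auto
  then show "\<alpha>\<^sup>2 * L\<^sup>2 \<le> z\<^sup>2 / 32" by (simp add: power_mult_distrib)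
qed
lemma alpha_le_half: "\<alpha> * L \<le> 1/2" using alphaL(2) by linarith
lemma alpha_sq: "\<alpha>\<^sup>2 \<le> 1/12"
proof -
  have "\<alpha>\<^sup>2 \<le> (1 / sqrt 12)\<^sup>2" using i_alpha(3) pos by (intro power_mono) auto
  then show ?thesis by (simp add: power_divide)
qed
lemma alpha_S: "\<alpha>\<^sup>2 * S \<le> a\<^sub>x / 64"
proof -
  have "\<alpha>\<^sup>2 \<le> a\<^sub>x / (64 * S)"
    using i_alpha(1) params S_pos i_rest(3) by (metis less_imp_le power2_eq_square power_mono real_sqrt_pow2 zero_le_divide_iff mult_nonneg_nonneg zero_le_numeral)
  then show ?thesis using S_pos by (simp add: field_simps)
qed
lemma alpha_Ls: "\<alpha>\<^sup>2 * L\<^sub>s\<^sup>2 \<le> a\<^sub>x / 64"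
  using alpha_S S_ge by (meson mult_left_mono order_trans zero_le_power2)

lemma alpha_L_n: "\<alpha> * L\<^sup>2 \<le> a * z * n / 256"
  using iii(1) pos n_pos by (simp add: field_simps z_def)
lemma d_alpha: "d * \<alpha>\<^sup>2 * L\<^sup>2 \<le> a * z * \<eta> / 768" "d * \<alpha>\<^sup>2 \<le> a * z * \<eta> / 640"
proof -
  have h: "\<alpha>\<^sup>2 * d \<le> a * min (\<eta> * z / (768 * L\<^sup>2)) (\<eta> * z / 640)"
    using iii(2) pos(12) unfolding z_def mult.assoc by (simp only: le_div_mult_iff)
  have "a * min (\<eta> * z / (768 * L\<^sup>2)) (\<eta> * z / 640) \<le> a * (\<eta> * z / (768 * L\<^sup>2))"
    "a * min (\<eta> * z / (768 * L\<^sup>2)) (\<eta> * z / 640) \<le> a * (\<eta> * z / 640)"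
    using pos(9) by (auto simp del: times_divide_eq_right intro!: mult_left_mono)
  then have "\<alpha>\<^sup>2 * d \<le> a * (\<eta> * z / (768 * L\<^sup>2))" "\<alpha>\<^sup>2 * d \<le> a * (\<eta> * z / 640)" using h by linarith+
  then show "d * \<alpha>\<^sup>2 * L\<^sup>2 \<le> a * z * \<eta> / 768" "d * \<alpha>\<^sup>2 \<le> a * z * \<eta> / 640" using pos by (simp_all add: field_simps)
qed
lemma beta_sq: "\<beta>\<^sup>2 * (b / \<rho>min) * \<rho>max\<^sup>2 \<le> a * z / 1536" "\<beta>\<^sup>2 * c * \<rho>max\<^sup>2 \<le> a * z / 1536"
proof -
  have h: "\<beta>\<^sup>2 \<le> a / b * (\<gamma> * \<rho>min\<^sup>2 / (1536 * \<rho>max\<^sup>2))" "\<beta>\<^sup>2 \<le> a / c * (\<gamma> * \<rho>min / (1536 * \<rho>max\<^sup>2))"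
    using iii(3) by simp_all
  show "\<beta>\<^sup>2 * (b / \<rho>min) * \<rho>max\<^sup>2 \<le> a * z / 1536" using h(1) pos rmax_pos by (simp add: field_simps z_def power2_eq_square)
  show "\<beta>\<^sup>2 * c * \<rho>max\<^sup>2 \<le> a * z / 1536" using h(2) pos rmax_pos by (simp add: field_simps z_def)
qed
text \<open>The third bound averages the other two, as \<open>2 \<rho>max \<le> \<rho>max\<^sup>2 + 1\<close>.\<close>

lemma d_beta: "d * \<beta> * \<rho>max\<^sup>2 \<le> a * z / 512" "d * \<beta> \<le> a * z / 640" "d * \<beta> * \<rho>max \<le> a * z / 512"
proof -
  have h: "\<beta> * d \<le> a * min (z / (512 * \<rho>max\<^sup>2)) (z / 640)"
    using iii(4) pos(12) unfolding z_def by (simp only: le_div_mult_iff)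
  have "a * min (z / (512 * \<rho>max\<^sup>2)) (z / 640) \<le> a * (z / (512 * \<rho>max\<^sup>2))"
    "a * min (z / (512 * \<rho>max\<^sup>2)) (z / 640) \<le> a * (z / 640)"
    using pos(9) by (auto simp del: times_divide_eq_right intro!: mult_left_mono)
  then have "\<beta> * d \<le> a * (z / (512 * \<rho>max\<^sup>2))" "\<beta> * d \<le> a * (z / 640)" using h by linarith+
  then show 1: "d * \<beta> * \<rho>max\<^sup>2 \<le> a * z / 512" "d * \<beta> \<le> a * z / 640" using rmax_pos by (simp_all add: field_simps)
  have "2 * \<rho>max \<le> \<rho>max\<^sup>2 + 1" using sum_squares_bound[of \<rho>max 1] by simp
  then have "d * \<beta> * (2 * \<rho>max) \<le> d * \<beta> * (\<rho>max\<^sup>2 + 1)" using pos by (intro mult_left_mono) auto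
  then have "2 * (d * \<beta> * \<rho>max) \<le> d * \<beta> * \<rho>max\<^sup>2 + d * \<beta>" by (simp add: algebra_simps)
  moreover have "a * z > 0" using pos z_pos by simp
  ultimately show "d * \<beta> * \<rho>max \<le> a * z / 512" using 1 by linarith
qed
lemma avg_error_motion: "e * L\<^sub>s\<^sup>2 * (\<alpha>\<^sup>2 * L\<^sup>2) \<le> a * z * n / 8192" "e * L\<^sub>s\<^sup>2 * (\<gamma>\<^sup>2 * \<rho>max\<^sup>2) \<le> a * z * n / 8192"
  "e * L\<^sub>s\<^sup>2 * \<eta> \<le> d * n / 896" "e * L\<^sub>s\<^sup>2 * \<alpha>\<^sup>2 \<le> \<phi> * a\<^sub>x * n / 256" "e * L\<^sub>s\<^sup>2 * \<alpha> \<le> 1 / 512"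
proof -
  have le: "e * L\<^sub>s\<^sup>2 * y \<le> e * S * y" if "y \<ge> 0" for y
    using S_ge pos that by (intro mult_right_mono mult_left_mono) auto
  have "e * S * (\<alpha>\<^sup>2 * L\<^sup>2) \<le> a * z * n / 8192" using iii(5) pos S_pos by (simp add: field_simps z_def)
  then show "e * L\<^sub>s\<^sup>2 * (\<alpha>\<^sup>2 * L\<^sup>2) \<le> a * z * n / 8192" using le[of "\<alpha>\<^sup>2 * L\<^sup>2"] by auto
  have "e * S * (\<gamma> * \<rho>max\<^sup>2) \<le> a * \<rho>min * n / 8192" using iii(6) pos S_pos rmax_pos by (simp add: field_simps)
  then have "\<gamma> * (e * S * (\<gamma> * \<rho>max\<^sup>2)) \<le> \<gamma> * (a * \<rho>min * n / 8192)" using pos by (intro mult_left_mono) auto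
  then have "e * S * (\<gamma>\<^sup>2 * \<rho>max\<^sup>2) \<le> a * z * n / 8192" by (simp add: z_def power2_eq_square ac_simps)
  then show "e * L\<^sub>s\<^sup>2 * (\<gamma>\<^sup>2 * \<rho>max\<^sup>2) \<le> a * z * n / 8192" using le[of "\<gamma>\<^sup>2 * \<rho>max\<^sup>2"] by simp
  have "e * S * \<eta> \<le> d * n / 896" using iv(3) pos S_pos by (simp add: field_simps)
  then show "e * L\<^sub>s\<^sup>2 * \<eta> \<le> d * n / 896" using le[of \<eta>] pos(2) by linarith
  have "e * S * \<alpha>\<^sup>2 \<le> \<phi> * a\<^sub>x * n / 256" using vii(5) pos S_pos by (simp add: field_simps)
  then show "e * L\<^sub>s\<^sup>2 * \<alpha>\<^sup>2 \<le> \<phi> * a\<^sub>x * n / 256" using le[of "\<alpha>\<^sup>2"] by auto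
  have "e * S * \<alpha> \<le> 1 / 512" using ii(1) pos S_pos by (simp add: field_simps)
  then show "e * L\<^sub>s\<^sup>2 * \<alpha> \<le> 1 / 512" using le[of \<alpha>] pos(1) by linarith
qed
lemma g_PP_gamma: "g * PP * \<gamma> \<le> a * \<rho>min / (8192 * \<rho>max\<^sup>2)"
  using iii(6) pos PP_pos rmax_pos by (simp add: field_simps)
lemma q_nonneg: "q \<ge> 0" and q_le: "q \<le> \<sigma>\<^sub>A\<^sup>2" "q \<le> PP"
  using PP_ge(2) by (auto simp: q_def)
lemma graph_error_motion: "g * q * (\<alpha>\<^sup>2 * L\<^sup>2) \<le> a * z / 8192" "g * q * (\<gamma>\<^sup>2 * \<rho>max\<^sup>2) \<le> a * z / 8192"
   "g * q * \<alpha>\<^sup>2 \<le> \<phi> * a\<^sub>x / 256"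
proof -
  have le: "g * q * y \<le> g * PP * y" if "y \<ge> 0" for y
    using q_le(2) pos that by (intro mult_right_mono mult_left_mono) auto
  have "g * PP * (\<alpha>\<^sup>2 * L\<^sup>2) \<le> a * z / 8192" using iii(5) pos PP_pos by (simp add: field_simps z_def)
  then show "g * q * (\<alpha>\<^sup>2 * L\<^sup>2) \<le> a * z / 8192" using le[of "\<alpha>\<^sup>2 * L\<^sup>2"] by auto
  have "g * PP * (\<gamma> * \<rho>max\<^sup>2) \<le> a * \<rho>min / 8192" using g_PP_gamma pos rmax_pos by (simp add: field_simps)
  then have "\<gamma> * (g * PP * (\<gamma> * \<rho>max\<^sup>2)) \<le> \<gamma> * (a * \<rho>min / 8192)" using pos by (intro mult_left_mono) auto
  then have "g * PP * (\<gamma>\<^sup>2 * \<rho>max\<^sup>2) \<le> a * z / 8192" by (simp add: z_def power2_eq_square ac_simps)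
  then show "g * q * (\<gamma>\<^sup>2 * \<rho>max\<^sup>2) \<le> a * z / 8192" using le[of "\<gamma>\<^sup>2 * \<rho>max\<^sup>2"] by simp
  have "g * (1 + PP) * \<alpha>\<^sup>2 \<le> \<phi> * a\<^sub>x / 256"
  proof -
    have "\<alpha>\<^sup>2 \<le> \<phi> / g * (a\<^sub>x / (256 * (1 + PP)))" using vii(5) by simp
    also have "\<dots> = \<phi> * a\<^sub>x / 256 / (g * (1 + PP))" by simp
    finally have "\<alpha>\<^sup>2 * (g * (1 + PP)) \<le> \<phi> * a\<^sub>x / 256" using pos(15) PP_pos by (subst (asm) pos_le_divide_eq) auto
    then show ?thesis by (simp add: ac_simps)
  qed
  moreover have "g * PP * \<alpha>\<^sup>2 \<le> g * (1 + PP) * \<alpha>\<^sup>2" using pos by (intro mult_right_mono mult_left_mono) auto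
  ultimately show "g * q * \<alpha>\<^sup>2 \<le> \<phi> * a\<^sub>x / 256" using le[of "\<alpha>\<^sup>2"] by auto
qed
lemma primal_noise_budget: "\<phi> * a\<^sub>x\<^sup>2 * (\<gamma>\<^sup>2 / \<alpha>\<^sup>2) * \<sigma>\<^sub>A\<^sup>2 \<le> a * z / 5120"
proof (cases "\<sigma>\<^sub>A = 0")
  case True then show ?thesis using pos z_pos by simp
next
  case False
  then have "\<sigma>\<^sub>A > 0" using sigmaA_nonneg by simp
  then have "\<phi> * a\<^sub>x\<^sup>2 * \<gamma> * \<sigma>\<^sub>A\<^sup>2 \<le> a * \<alpha>\<^sup>2 * \<rho>min / 5120" using iii(7)[OF False] pos by (simp add: field_simps)
  then have "\<gamma> / \<alpha>\<^sup>2 * (\<phi> * a\<^sub>x\<^sup>2 * \<gamma> * \<sigma>\<^sub>A\<^sup>2) \<le> \<gamma> / \<alpha>\<^sup>2 * (a * \<alpha>\<^sup>2 * \<rho>min / 5120)"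
    using pos by (intro mult_left_mono) auto
  then show ?thesis using pos by (simp add: z_def field_simps power2_eq_square)
qed
lemma dual_noise_budget: "g * a\<^sub>l\<^sup>2 * \<sigma>\<^sub>A\<^sup>2 \<le> a * z / 2560"
proof (cases "\<sigma>\<^sub>A = 0")
  case True then show ?thesis using pos z_pos by simp
next
  case False
  then have "\<sigma>\<^sub>A > 0" using sigmaA_nonneg by simp
  then show ?thesis using iii(10)[OF False] pos by (simp add: z_def field_simps)
qed
lemma grad_error_motion: "\<phi> * G * (\<alpha>\<^sup>2 * L\<^sup>2) \<le> a * z / 16384" "\<phi> * G * (\<gamma>\<^sup>2 * \<rho>max\<^sup>2) \<le> a * z / 16384"
  "\<phi> * G * \<eta>\<^sup>2 \<le> d * \<eta> / 1792" "\<phi> * G * n * \<alpha>\<^sup>2 \<le> \<alpha> / 1536"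
  using iii(8,9) iv(4) ii(2) by (auto simp: z_def algebra_simps)
lemma alpha_G: "\<alpha>\<^sup>2 * (L\<^sub>s\<^sup>2 + \<gamma>\<^sup>2 / \<alpha>\<^sup>2 * \<rho>bmax\<^sup>2) \<le> a\<^sub>x / 32"
proof -
  have "\<alpha>\<^sup>2 * (L\<^sub>s\<^sup>2 + \<gamma>\<^sup>2 / \<alpha>\<^sup>2 * \<rho>bmax\<^sup>2) = \<alpha>\<^sup>2 * L\<^sub>s\<^sup>2 + \<gamma>\<^sup>2 * \<rho>bmax\<^sup>2"
    using pos by (simp add: field_simps)
  then show ?thesis using alpha_Ls gamma_rbmax by linarith
qed
lemma a_eta: "a * \<eta> \<le> d / 22" "\<kappa> * a * \<eta> \<le> d / 19"
proof -
  have "28 * (1 - z) * (1 - z/2) \<ge> 22"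
  proof -
    have "7/8 * (15/16) \<le> (1 - z) * (1 - z/2)" using z_le by (intro mult_mono) auto
    then have "28 * (7/8 * (15/16)) \<le> 28 * ((1 - z) * (1 - z/2))" by (intro mult_left_mono) auto
    then show ?thesis unfolding mult.assoc by linarith
  qed
  then have "inverse (28 * (1 - z) * (1 - z/2)) \<le> inverse 22" by (intro le_imp_inverse_le) auto
  then have "d / a * inverse (28 * (1 - z) * (1 - z/2)) \<le> d / a * inverse 22"
    using pos by (intro mult_left_mono) auto
  then have "\<eta> \<le> d / a * inverse 22" using iv(1) unfolding z_def by linarith
  then show 1: "a * \<eta> \<le> d / 22" using pos by (simp add: field_simps)
  have "\<kappa> * (a * \<eta>) \<le> 111/100 * (d / 22)" using 1 kappa_bounds pos by (intro mult_mono) auto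
  then show "\<kappa> * a * \<eta> \<le> d / 19" using pos by (simp add: mult.assoc)
qed
lemma bc_beta: "(\<beta> + \<alpha> / \<eta>) * (b / \<rho>min) \<le> d * \<eta> / 28" "(\<beta> + \<alpha> / \<eta>) * c \<le> d * \<eta> / 28"
proof -
  have h: "\<beta> + \<alpha> / \<eta> \<le> d / b * (\<eta> * \<rho>min / 28)" "\<beta> + \<alpha> / \<eta> \<le> d / c * (\<eta> / 28)" using iv(2) by auto
  have "(\<beta> + \<alpha> / \<eta>) * b \<le> d * (\<eta> * \<rho>min / 28)" using h(1) pos by (simp only: le_div_mult_iff)
  then show "(\<beta> + \<alpha> / \<eta>) * (b / \<rho>min) \<le> d * \<eta> / 28" using pos(7,6) by (simp add: pos_divide_le_eq del: ring_distribs)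
  have "(\<beta> + \<alpha> / \<eta>) * c \<le> d * (\<eta> / 28)" using h(2) pos by (simp only: le_div_mult_iff)
  then show "(\<beta> + \<alpha> / \<eta>) * c \<le> d * \<eta> / 28" by simp
qed
lemma grad_error_budget: "a * \<alpha>\<^sup>2 \<le> \<phi> * a\<^sub>x * z / 64" "d * \<alpha>\<^sup>2 \<le> \<phi> * a\<^sub>x * \<eta> / 384"
   "d * \<beta> * \<alpha>\<^sup>2 \<le> \<phi> * a\<^sub>x / 256" "d * \<alpha>^4 \<le> \<phi> * a\<^sub>x * \<eta> / 256"
  using vii(1-4) pos by (simp_all add: le_div_mult_iff z_def field_simps)
lemma graph_error_budget: "b * \<beta> \<le> g * a\<^sub>l * \<rho>min / 24" "c * \<beta> \<le> g * a\<^sub>l / 24" "d * \<beta> \<le> g * a\<^sub>l / 3"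
  using viii pos by (simp_all add: le_div_mult_iff field_simps)
lemma dual_drift_budget: "\<alpha>\<^sup>2 * (b / \<rho>min) * (n * L\<^sup>2) \<le> \<eta> / 96" "\<alpha>\<^sup>2 * c * (n * L\<^sup>2) \<le> \<eta> / 96" "\<alpha> * d * (n * L\<^sup>2) \<le> \<eta> / 12"
  using ix pos n_pos by (simp_all add: field_simps)

text \<open>The last bound, \<open>a\<close> small against \<open>d \<rho>min\<close>, combines the lower bound \<open>b \<beta> \<ge> a \<eta>\<close> with the upper
  bound on \<open>b \<beta>\<close>. It compares the two scales of the quadratic form.\<close>

lemma dual_weight_budget: "b * \<beta> / \<rho>min \<le> d * \<eta> / 28" "c * \<beta> \<le> d * \<eta> / 28" "a \<le> d * \<rho>min / 28"
proof -
  have "0 \<le> \<alpha> / \<eta> * (b / \<rho>min)" "0 \<le> \<alpha> / \<eta> * c" using pos by simp_all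
  then have "\<beta> * (b / \<rho>min) \<le> d * \<eta> / 28" "\<beta> * c \<le> d * \<eta> / 28"
    using bc_beta unfolding distrib_right by linarith+
  then show 1: "b * \<beta> / \<rho>min \<le> d * \<eta> / 28" and "c * \<beta> \<le> d * \<eta> / 28"
    by (simp_all add: mult.commute)
  have "1 * (a * \<eta>) \<le> \<kappa> * (a * \<eta>)" using kappa_bounds(1) pos by (intro mult_right_mono) auto
  then have "a * \<eta> \<le> b * \<beta>" using b_beta by (simp add: mult.assoc)
  moreover have "b * \<beta> \<le> d * \<eta> / 28 * \<rho>min" using 1 pos(6) by (simp add: pos_divide_le_eq)
  ultimately have "\<eta> * a \<le> \<eta> * (d * \<rho>min / 28)" by (simp add: mult.commute mult.left_commute)
  then show "a \<le> d * \<rho>min / 28" using pos(2) by simp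
qed
lemma c_beta_bounds: "c * \<beta> \<ge> 44/100 * (d * \<gamma>)" "c * \<beta> \<le> d * (\<gamma> + \<eta> * \<beta>) / 2"
proof -
  have "\<kappa> * a * \<eta> * \<gamma> \<le> d / 19 * \<gamma>" using a_eta(2) pos by (intro mult_right_mono) auto
  moreover have "0 \<le> d * (\<eta> * \<beta>)" "0 \<le> \<kappa> * a * \<eta> * \<gamma>" "d * \<gamma> \<ge> 0" using pos kappa_bounds(1) by auto
  ultimately show "c * \<beta> \<ge> 44/100 * (d * \<gamma>)" "c * \<beta> \<le> d * (\<gamma> + \<eta> * \<beta>) / 2"
    using c_beta by (simp_all add: distrib_left)
qed
lemma d_beta_small: "d * \<beta> \<le> a * \<gamma> / (512 * \<rho>min)" "d * \<beta> \<le> a * \<gamma> / 512" "\<eta> * \<beta> \<le> \<gamma> / 11264"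
proof -
  have "\<rho>min\<^sup>2 \<le> \<rho>max\<^sup>2" using rho by (intro power_mono) auto
  then have "d * \<beta> * \<rho>min\<^sup>2 \<le> d * \<beta> * \<rho>max\<^sup>2" using pos by (intro mult_left_mono) auto
  then have "\<rho>min * (d * \<beta> * \<rho>min) \<le> \<rho>min * (a * \<gamma> / 512)" using d_beta(1) by (simp add: z_def power2_eq_square ac_simps)
  then show "d * \<beta> \<le> a * \<gamma> / (512 * \<rho>min)" using pos(6) by (simp add: field_simps)
  have "d * \<beta> * \<rho>min \<le> d * \<beta> * \<rho>max" using rho pos by (intro mult_left_mono) auto
  then have "\<rho>min * (d * \<beta>) \<le> \<rho>min * (a * \<gamma> / 512)" using d_beta(3) by (simp add: z_def ac_simps)
  then show 1: "d * \<beta> \<le> a * \<gamma> / 512" using pos(6) by simp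
  have "\<eta> * (d * \<beta>) \<le> \<eta> * (a * \<gamma> / 512)" using 1 pos by (intro mult_left_mono) auto
  also have "\<dots> = a * \<eta> * (\<gamma> / 512)" by simp
  also have "\<dots> \<le> d / 22 * (\<gamma> / 512)" using a_eta(1) pos by (intro mult_right_mono) auto
  finally have "d * (\<eta> * \<beta>) \<le> d * (\<gamma> / 11264)" by (simp add: mult.left_commute)
  then show "\<eta> * \<beta> \<le> \<gamma> / 11264" using pos(12) by simp
qed
text \<open>The quadratic form in \<open>u\<close> and \<open>v\<close> is positive definite, with half of \<open>a |u|\<^sup>2\<close> to spare.\<close>

lemma d_sq_le: "d\<^sup>2 \<le> 2 * a * c"
proof -
  have "a * z \<le> a * \<gamma> * \<rho>min" by (simp add: z_def)
  have 1: "512 * (d * \<beta>) \<le> a * \<gamma>" using d_beta_small(2) by simp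
  have "d * (512 * (d * \<beta>)) \<le> d * (a * \<gamma>)" using 1 pos by (intro mult_left_mono) auto
  moreover have "a * (44/100 * (d * \<gamma>)) \<le> a * (c * \<beta>)" using c_beta_bounds(1) pos by (intro mult_left_mono) auto
  moreover have "0 \<le> d * (d * \<beta>)" using pos by simp
  ultimately have "d * (d * \<beta>) \<le> 2 * (a * (c * \<beta>))" by (simp add: ac_simps)
  then have "\<beta> * d\<^sup>2 \<le> \<beta> * (2 * a * c)" by (simp add: power2_eq_square ac_simps)
  then show ?thesis using pos(4) by simp
qed

lemma shift_01: "shift = 0 \<or> shift = 1" by (simp add: shift_def)

text \<open>The smaller weight \<open>g'\<close> is still large where it is needed. Three facts drive this: \<open>a\<^sub>l\<close> is bounded
  below because \<open>g a\<^sub>l\<close> dominates \<open>b \<beta>/\<rho>min \<ge> a \<eta>/\<rho>min\<close>; the product \<open>g \<gamma> PP\<close> is small; and the graph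
  noise at the current iterate is within budget, \<open>g a\<^sub>l\<^sup>2 q \<le> a z/2560\<close>. Together they bound \<open>q \<gamma> \<eta>\<close>
  by \<open>a\<^sub>l\<close>, \<open>a\<^sub>l q \<eta>\<close> by \<open>z \<rho>min\<close> and \<open>q \<eta>\<close> by \<open>\<rho>min\<close>, and \<open>g'\<close> is inversely proportional to \<open>q \<eta>\<close>.\<close>

lemma shifted_weight_bounds:
  assumes "shift = 1"
  shows "900 * (d * \<gamma>) \<le> Y" "1000 * (a * a\<^sub>l\<^sup>2 / (\<gamma> * \<rho>min ^ 3)) \<le> Y"
    "2 * (a / \<rho>min\<^sup>2) \<le> g'" "2 * g' \<le> g" "g' * q * \<eta> \<le> d / 100" "a\<^sub>l > 0"
proof -
  have gap: "g * q * \<eta> > d / 100" using assms by (auto simp: shift_def split: if_splits)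
  have "q \<noteq> 0" using gap pos by (intro notI) simp
  then have q: "q > 0" using q_nonneg by simp
  have g': "g' = d / (200 * q * \<eta>)" using gap by (simp add: g'_def)
  have g'q: "g' * (200 * q * \<eta>) = d" using q pos(2) by (simp add: g')
  show "g' * q * \<eta> \<le> d / 100" using g'q pos(12) by (simp add: ac_simps)
  have "200 * q * \<eta> * (2 * g') \<le> 200 * q * \<eta> * g" using gap g'q by (simp add: ac_simps)
  then show "2 * g' \<le> g" using q pos(2) by simp
  have g'_pos: "g' > 0" using g' q pos by simp
  have "1 * (a * \<eta>) \<le> \<kappa> * (a * \<eta>)" using kappa_bounds(1) pos by (intro mult_right_mono) auto
  then have F2: "24 * (a * \<eta>) \<le> g * a\<^sub>l * \<rho>min" using graph_error_budget(1) b_beta by (simp add: mult.assoc)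
  then have "0 < g * a\<^sub>l * \<rho>min" using pos by (meson less_le_trans mult_pos_pos zero_less_numeral)
  then show al: "a\<^sub>l > 0" using pos(15,6) by (simp add: zero_less_mult_iff)
  have "\<rho>min\<^sup>2 \<le> \<rho>max\<^sup>2" using rho by (intro power_mono) auto
  then have "g * PP * \<gamma> * \<rho>min\<^sup>2 \<le> g * PP * \<gamma> * \<rho>max\<^sup>2" using pos PP_pos by (intro mult_left_mono) auto
  also have "\<dots> \<le> a * \<rho>min / 8192" using g_PP_gamma rmax_pos by (simp add: pos_le_divide_eq)
  finally have "\<rho>min * (g * PP * \<gamma> * \<rho>min) \<le> \<rho>min * (a / 8192)" by (simp add: power2_eq_square ac_simps)
  then have F4: "g * PP * \<gamma> * \<rho>min \<le> a / 8192" using pos(6) by simp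
  have "g * q * (\<gamma> * \<rho>min) \<le> g * PP * (\<gamma> * \<rho>min)" using q_le(2) pos by (intro mult_left_mono mult_right_mono) auto
  then have F4': "g * q * \<gamma> * \<rho>min \<le> a / 8192" using F4 by (simp add: mult.assoc)
  have "180000 * (g * q * \<gamma> * \<rho>min * \<eta>) \<le> 180000 * (a / 8192 * \<eta>)"
    using F4' pos by (intro mult_left_mono mult_right_mono) auto
  also have "\<dots> \<le> 24 * (a * \<eta>)" using pos by simp
  also note F2
  finally have "(g * \<rho>min) * (180000 * (q * \<gamma> * \<eta>)) \<le> (g * \<rho>min) * a\<^sub>l" by (simp add: ac_simps)
  then have alq: "180000 * (q * \<gamma> * \<eta>) \<le> a\<^sub>l" using pos by (simp add: mult_pos_pos)
  have "(200 * q * \<eta>) * (900 * (d * \<gamma>)) = d * (180000 * (q * \<gamma> * \<eta>))" by simp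
  also have "\<dots> \<le> d * a\<^sub>l" using alq pos by (intro mult_left_mono) auto
  also have "\<dots> = (200 * q * \<eta>) * Y" using g'q by (simp add: Y_def ac_simps)
  finally show "900 * (d * \<gamma>) \<le> Y" by (rule mult_left_le_imp_le) (use q pos(2) in simp)
  have F5: "g * a\<^sub>l\<^sup>2 * q \<le> a * z / 2560"
  proof -
    have "g * a\<^sub>l\<^sup>2 * q \<le> g * a\<^sub>l\<^sup>2 * \<sigma>\<^sub>A\<^sup>2" using q_le(1) pos by (intro mult_left_mono) auto
    then show ?thesis using dual_noise_budget by linarith
  qed
  have "24 * (a * \<eta>) * (a\<^sub>l * q) \<le> g * a\<^sub>l * \<rho>min * (a\<^sub>l * q)" using F2 al q by (intro mult_right_mono) auto
  also have "\<dots> = (g * a\<^sub>l\<^sup>2 * q) * \<rho>min" by (simp add: power2_eq_square)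
  also have "\<dots> \<le> (a * z / 2560) * \<rho>min" using F5 pos by (intro mult_right_mono) auto
  finally have "a * (24 * (a\<^sub>l * q * \<eta>)) \<le> a * (z * \<rho>min / 2560)" by (simp add: ac_simps)
  then have F6: "61440 * (a\<^sub>l * q * \<eta>) \<le> z * \<rho>min" using pos(9) by simp
  have F1: "28 * a \<le> d * \<rho>min" using dual_weight_budget(3) by simp
  have g'z: "1000 * (a * a\<^sub>l) \<le> g' * (\<gamma> * \<rho>min ^ 3)"
  proof -
    have "(200 * q * \<eta>) * (1000 * (a * a\<^sub>l)) = a * (200000 * (a\<^sub>l * q * \<eta>))" by simp
    also have "\<dots> \<le> a * (28 * (z * \<rho>min))"
    proof (rule mult_left_mono)
      have "z * \<rho>min > 0" using z_pos pos(6) by simp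
      then show "200000 * (a\<^sub>l * q * \<eta>) \<le> 28 * (z * \<rho>min)" using F6 by linarith
    qed (use pos in simp)
    also have "\<dots> = (28 * a) * (z * \<rho>min)" by simp
    also have "\<dots> \<le> (d * \<rho>min) * (z * \<rho>min)" using F1 z_pos pos by (intro mult_right_mono) auto
    also have "\<dots> = d * (\<gamma> * \<rho>min ^ 3)" by (simp add: z_def power3_eq_cube)
    also have "\<dots> = (200 * q * \<eta>) * (g' * (\<gamma> * \<rho>min ^ 3))" using g'q by (metis mult.assoc mult.commute)
    finally show ?thesis by (rule mult_left_le_imp_le) (use q pos(2) in simp)
  qed
  then have "1000 * (a * a\<^sub>l) * a\<^sub>l \<le> g' * (\<gamma> * \<rho>min ^ 3) * a\<^sub>l" using al by (intro mult_right_mono) auto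
  then have "1000 * (a * a\<^sub>l\<^sup>2) \<le> Y * (\<gamma> * \<rho>min ^ 3)" by (simp add: Y_def power2_eq_square ac_simps)
  moreover have "\<gamma> * \<rho>min ^ 3 > 0" using pos by simp
  ultimately show "1000 * (a * a\<^sub>l\<^sup>2 / (\<gamma> * \<rho>min ^ 3)) \<le> Y"
    by (metis pos_divide_le_eq times_divide_eq_right)
  have "(24 * (a * \<eta>))\<^sup>2 \<le> (g * a\<^sub>l * \<rho>min)\<^sup>2" using F2 pos by (intro power_mono) auto
  then have "(24 * (a * \<eta>))\<^sup>2 * (q * q) \<le> (g * a\<^sub>l * \<rho>min)\<^sup>2 * (q * q)" using q by (intro mult_right_mono) auto
  also have "\<dots> = (g * a\<^sub>l\<^sup>2 * q) * (g * q * \<rho>min\<^sup>2)" by (simp add: power2_eq_square)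
  also have "\<dots> \<le> (a * z / 2560) * (g * q * \<rho>min\<^sup>2)" using F5 q pos by (intro mult_right_mono) auto
  also have "\<dots> = (g * q * \<gamma> * \<rho>min) * (a * \<rho>min\<^sup>2 / 2560)" by (simp add: z_def power2_eq_square)
  also have "\<dots> \<le> (a / 8192) * (a * \<rho>min\<^sup>2 / 2560)" using F4' pos by (intro mult_right_mono) auto
  finally have "a\<^sup>2 * (576 * (q * \<eta>)\<^sup>2) \<le> a\<^sup>2 * (\<rho>min\<^sup>2 / 20971520)" by (simp add: power2_eq_square ac_simps)
  then have "(q * \<eta>)\<^sup>2 \<le> \<rho>min\<^sup>2 / 12079595520" using pos(9) by simp
  also have "\<dots> \<le> (\<rho>min * (7/100))\<^sup>2" by (simp add: power_mult_distrib power_divide)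
  finally have q\<eta>: "q * \<eta> \<le> \<rho>min * (7/100)" by (rule power2_le_imp_le) (use pos in simp)
  have "(200 * q * \<eta>) * (2 * a) \<le> 400 * (\<rho>min * (7/100)) * a" using q\<eta> pos by (simp add: ac_simps)
  also have "\<dots> = 28 * a * \<rho>min" by simp
  also have "\<dots> \<le> d * \<rho>min * \<rho>min" using F1 pos by (intro mult_right_mono) auto
  also have "\<dots> = (200 * q * \<eta>) * (g' * \<rho>min\<^sup>2)" using g'q by (simp add: power2_eq_square ac_simps)
  finally have "2 * a \<le> g' * \<rho>min\<^sup>2" by (rule mult_left_le_imp_le) (use q pos(2) in simp)
  then show "2 * (a / \<rho>min\<^sup>2) \<le> g'" using pos(6) by (simp add: pos_divide_le_eq)
qed

lemma g'_bounds: "0 < g'" "g' \<le> g" "g' * q * \<eta> \<le> d / 100"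
  "shift * (2 * (a / \<rho>min\<^sup>2)) \<le> g'" "shift * (2 * (a / \<rho>min\<^sup>2)) \<le> g - g'"
proof -
  have "0 < g' \<and> g' \<le> g \<and> g' * q * \<eta> \<le> d / 100 \<and> shift * (2 * (a / \<rho>min\<^sup>2)) \<le> g' \<and> shift * (2 * (a / \<rho>min\<^sup>2)) \<le> g - g'"
  proof (cases "shift = 0")
    case True
    then show ?thesis using pos by (auto simp: shift_def g'_def split: if_splits)
  next
    case False
    then have shift: "shift = 1" using shift_01 by blast
    have "0 < 2 * (a / \<rho>min\<^sup>2)" using pos by simp
    then show ?thesis using shifted_weight_bounds[OF shift] shift by simp
  qed
  then show "0 < g'" "g' \<le> g" "g' * q * \<eta> \<le> d / 100"
  "shift * (2 * (a / \<rho>min\<^sup>2)) \<le> g'" "shift * (2 * (a / \<rho>min\<^sup>2)) \<le> g - g'" by auto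
qed
lemma Y_nonneg: "Y \<ge> 0" using g'_bounds(1) params(6) by (simp add: Y_def)

text \<open>What the descent estimate requires of the weight of the graph error, in both cases. Without the
  shift, \<open>c \<beta>\<close> and \<open>b \<beta>/\<rho>min\<close> are bounded both by \<open>Y/24\<close> and by \<open>d \<eta>/28\<close>, and the product of the two
  bounds is used. With the shift, only the fraction \<open>a\<^sub>l\<close> of the coupling \<open>\<kappa> a \<eta> \<langle>v, Q w\<rangle>\<close> is left.\<close>

lemma graph_error_absorption: "(c * \<beta>)\<^sup>2 \<le> d * \<eta> * Y / 672"
  "((1 - shift * (1 - a\<^sub>l)) * \<kappa> * a * \<eta> / \<rho>min)\<^sup>2 \<le> d * \<eta> * Y / 672"
  "\<beta>\<^sup>2 * (b / \<rho>min + c) \<le> Y / 12" "d * \<beta> \<le> Y / 3"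
  "shift * (a * \<gamma> / \<rho>min) \<le> Y / 1000" "shift * (a * a\<^sub>l\<^sup>2 / (\<gamma> * \<rho>min ^ 3)) \<le> Y / 1000"
proof -
  let ?t = "1 - shift * (1 - a\<^sub>l)"
  have cb0: "0 \<le> c * \<beta>" "0 \<le> b * \<beta> / \<rho>min" using pos by auto
  have mult2: "x\<^sup>2 \<le> d * \<eta> * Y / 672" if "0 \<le> x" "x \<le> d * \<eta> / 28" "x \<le> Y / 24" for x :: real
  proof -
    have "x * x \<le> (d * \<eta> / 28) * (Y / 24)" using that by (intro mult_mono) auto
    then show ?thesis by (simp add: power2_eq_square)
  qed
  have b3: "\<beta>\<^sup>2 * (b / \<rho>min + c) = \<beta> * (b * \<beta> / \<rho>min + c * \<beta>)" by (simp add: power2_eq_square algebra_simps)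
  have b3': "\<beta>\<^sup>2 * (b / \<rho>min + c) \<le> b * \<beta> / \<rho>min + c * \<beta>"
    unfolding b3 using i_rest(2) pos cb0 by (intro mult_left_le_one_le) auto
  have "(c * \<beta>)\<^sup>2 \<le> d * \<eta> * Y / 672 \<and> (?t * \<kappa> * a * \<eta> / \<rho>min)\<^sup>2 \<le> d * \<eta> * Y / 672
    \<and> \<beta>\<^sup>2 * (b / \<rho>min + c) \<le> Y / 12 \<and> d * \<beta> \<le> Y / 3 \<and> shift * (a * \<gamma> / \<rho>min) \<le> Y / 1000
    \<and> shift * (a * a\<^sub>l\<^sup>2 / (\<gamma> * \<rho>min ^ 3)) \<le> Y / 1000"
  proof (cases "shift = 0")
    case True
    then have Y: "Y = g * a\<^sub>l" by (auto simp: Y_def shift_def g'_def split: if_splits)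
    have h: "b * \<beta> / \<rho>min \<le> Y / 24" "c * \<beta> \<le> Y / 24" "d * \<beta> \<le> Y / 3"
      using graph_error_budget pos(6) by (auto simp: Y pos_divide_le_eq)
    have k: "?t * \<kappa> * a * \<eta> / \<rho>min = b * \<beta> / \<rho>min" using b_beta True by simp
    have "\<beta>\<^sup>2 * (b / \<rho>min + c) \<le> Y / 12" using b3' h by linarith
    then show ?thesis unfolding k using mult2[OF cb0(1) dual_weight_budget(2) h(2)] mult2[OF cb0(2) dual_weight_budget(1) h(1)] h True Y_nonneg
      by simp
  next
    case False
    then have shift: "shift = 1" using shift_01 by blast
    note sc = shifted_weight_bounds[OF shift]
    have dg: "d * \<gamma> > 0" using pos by simp
    have "28 * (a * \<gamma>) \<le> \<gamma> * (d * \<rho>min)" using dual_weight_budget(3) pos(3) by simp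
    then have ag: "a * \<gamma> / \<rho>min \<le> d * \<gamma> / 28" using pos(6) by (simp add: pos_divide_le_eq ac_simps)
    have ag0: "a * \<gamma> / \<rho>min > 0" using pos by simp
    have "d * (\<eta> * \<beta>) \<le> d * (\<gamma> / 11264)" using d_beta_small(3) pos by (intro mult_left_mono) auto
    then have cb: "c * \<beta> \<le> 51/100 * (d * \<gamma>)" using c_beta_bounds(2) dg by (simp add: distrib_left)
    have h1: "c * \<beta> \<le> Y / 24" using cb sc(1) dg by linarith
    have "\<kappa> * (a * (\<eta> * \<beta>)) \<le> 111/100 * (a * (\<gamma> / 11264))"
      using kappa_bounds d_beta_small(3) pos by (intro mult_mono) auto
    then have "\<beta> * (b * \<beta>) \<le> a * \<gamma> * (111/100 / 11264)" using b_beta by (simp add: ac_simps)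
    then have "\<beta> * (b * \<beta>) / \<rho>min \<le> a * \<gamma> * (111/100 / 11264) / \<rho>min" using pos by (intro divide_right_mono) auto
    then have bb: "\<beta> * (b * \<beta> / \<rho>min) \<le> a * \<gamma> / \<rho>min * (111/100 / 11264)" by simp
    have "\<beta> * (c * \<beta>) \<le> c * \<beta>" using i_rest(2) pos by (intro mult_left_le_one_le) auto
    then have h3: "\<beta>\<^sup>2 * (b / \<rho>min + c) \<le> Y / 12"
    proof -
      have "a * \<gamma> / \<rho>min * (111/100 / 11264) \<le> Y / 24"
      proof -
        have "t * (111/100 / 11264) \<le> Y / 24" if "t \<le> d * \<gamma> / 28" "0 < t" for t
          using that sc(1) dg by linarith
        from this[OF ag ag0] show ?thesis .
      qed
      then have "\<beta> * (b * \<beta> / \<rho>min) \<le> Y / 24" using bb by (rule order_trans[rotated])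
      moreover have "\<beta> * (c * \<beta>) \<le> Y / 24" using \<open>\<beta> * (c * \<beta>) \<le> c * \<beta>\<close> h1 by (rule order_trans)
      ultimately have "\<beta> * (b * \<beta> / \<rho>min) + \<beta> * (c * \<beta>) \<le> Y / 24 + Y / 24" by (rule add_mono)
      then show ?thesis unfolding b3 distrib_left[of \<beta>] by simp
    qed
    have h4: "d * \<beta> \<le> Y / 3"
    proof -
      have "d * \<beta> \<le> Y / 3" if "d * \<beta> \<le> t / 512" "t \<le> d * \<gamma> / 28" "0 < t" for t
        using that sc(1) dg by linarith
      then show ?thesis using d_beta_small(1) ag ag0 by (metis divide_divide_eq_left mult.commute)
    qed
    have h5: "a * \<gamma> / \<rho>min \<le> Y / 1000" using ag sc(1) dg by linarith
    have "a\<^sub>l\<^sup>2 * a / \<rho>min\<^sup>2 \<le> Y * z / 1000"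
    proof -
      have "a * a\<^sub>l\<^sup>2 / (\<gamma> * \<rho>min ^ 3) * z \<le> Y / 1000 * z"
      proof (rule mult_right_mono)
        show "a * a\<^sub>l\<^sup>2 / (\<gamma> * \<rho>min ^ 3) \<le> Y / 1000" using sc(2) by linarith
      qed (use z_pos in simp)
      moreover have "a * a\<^sub>l\<^sup>2 / (\<gamma> * \<rho>min ^ 3) * z = a\<^sub>l\<^sup>2 * a / \<rho>min\<^sup>2" using pos(3,6) by (simp add: z_def field_simps power2_eq_square power3_eq_cube)
      ultimately show ?thesis by (simp only: mult.commute times_divide_eq_left)
    qed
    then have "a\<^sub>l\<^sup>2 * a / \<rho>min\<^sup>2 * (\<kappa> * \<eta>) \<le> Y * z / 1000 * (\<kappa> * \<eta>)"
      using kappa_bounds(1) pos by (intro mult_right_mono) auto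
    also have "\<dots> \<le> Y * z / 1000 * (111/100 * \<eta>)" using kappa_bounds z_pos Y_nonneg pos by (intro mult_left_mono mult_right_mono) auto
    also have "\<dots> \<le> Y * (1/8) / 1000 * (111/100 * \<eta>)" using z_le Y_nonneg pos by (intro mult_right_mono divide_right_mono mult_left_mono) auto
    finally have 1: "a\<^sub>l\<^sup>2 * a / \<rho>min\<^sup>2 * (\<kappa> * \<eta>) \<le> Y * \<eta> * (111 / 800000)" by simp
    have "(?t * \<kappa> * a * \<eta> / \<rho>min)\<^sup>2 = (a\<^sub>l\<^sup>2 * a / \<rho>min\<^sup>2 * (\<kappa> * \<eta>)) * (\<kappa> * a * \<eta>)"
      using shift by (simp add: power2_eq_square)
    also have "\<dots> \<le> (Y * \<eta> * (111 / 800000)) * (d / 19)"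
      using pos kappa_bounds(1) by (intro mult_mono'[OF 1 a_eta(2)]) (auto intro!: mult_nonneg_nonneg divide_nonneg_nonneg)
    also have "\<dots> \<le> d * \<eta> * Y / 672" using Y_nonneg pos by simp
    finally have h2: "(?t * \<kappa> * a * \<eta> / \<rho>min)\<^sup>2 \<le> d * \<eta> * Y / 672" .
    have h6: "a * a\<^sub>l\<^sup>2 / (\<gamma> * \<rho>min ^ 3) \<le> Y / 1000" using sc(2) by linarith
    show ?thesis using mult2[OF cb0(1) dual_weight_budget(2) h1] h2 h3 h4 h5 h6 shift by simp
  qed
  then show "(c * \<beta>)\<^sup>2 \<le> d * \<eta> * Y / 672"
  "((1 - shift * (1 - a\<^sub>l)) * \<kappa> * a * \<eta> / \<rho>min)\<^sup>2 \<le> d * \<eta> * Y / 672"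
  "\<beta>\<^sup>2 * (b / \<rho>min + c) \<le> Y / 12" "d * \<beta> \<le> Y / 3"
  "shift * (a * \<gamma> / \<rho>min) \<le> Y / 1000" "shift * (a * a\<^sub>l\<^sup>2 / (\<gamma> * \<rho>min ^ 3)) \<le> Y / 1000" by blast+
qed

end

section \<open>Descent of the quadratic form and the drift budget\<close>

context storm_parameters begin

text \<open>The form \<open>b Q + c I\<close> is at most \<open>X\<close> times the squared norm.\<close>

definition X where "X = b / \<rho>min + c"

lemma X_nonneg: "X \<ge> 0" using pos by (simp add: X_def)

lemma dual_form_bounds: "\<alpha> / \<eta> * X \<le> d * \<eta> / 14" "\<alpha>\<^sup>2 * X * (n * L\<^sup>2) \<le> \<eta> / 48"
  "\<beta>\<^sup>2 * X * \<rho>max\<^sup>2 \<le> a * z / 768" "\<beta>\<^sup>2 * X \<le> Y / 12"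
proof -
  have "0 \<le> \<beta> * X" using pos X_nonneg by simp
  moreover have "(\<beta> + \<alpha> / \<eta>) * X \<le> d * \<eta> / 14" using bc_beta unfolding X_def distrib_left[of _ "b / \<rho>min" c] by linarith
  moreover have "(\<beta> + \<alpha> / \<eta>) * X = \<beta> * X + \<alpha> / \<eta> * X" by (rule distrib_right)
  ultimately show "\<alpha> / \<eta> * X \<le> d * \<eta> / 14" by linarith
  show "\<alpha>\<^sup>2 * X * (n * L\<^sup>2) \<le> \<eta> / 48" using dual_drift_budget(1,2) unfolding X_def distrib_left distrib_right by linarith
  show "\<beta>\<^sup>2 * X * \<rho>max\<^sup>2 \<le> a * z / 768" using beta_sq unfolding X_def distrib_left distrib_right by linarith
  show "\<beta>\<^sup>2 * X \<le> Y / 12" using graph_error_absorption(3) by (simp add: X_def)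
qed

text \<open>\<open>U\<close>, \<open>V\<close>, \<open>W\<close>, \<open>E\<close>, \<open>D\<close> stand for the norms of the disagreement \<open>u\<close>, of the dual residual \<open>v\<close>, of the
  graph error, of the disagreement of the gradient error and of the change of the gradients between
  the old and the new average, and \<open>M\<close> for the squared norm of the averaged momentum. This lemma and
  the next two absorb the terms of the dual form, of the mixed term \<open>d \<langle>u, v\<rangle>\<close> and of the couplings with
  the graph error.\<close>

lemma dual_terms:
  fixes U V W E D M :: real
  assumes nn: "0 \<le> U" "0 \<le> V" "0 \<le> W" "0 \<le> E" "0 \<le> D" "0 \<le> M"
    and D: "D\<^sup>2 \<le> n * L\<^sup>2 * \<alpha>\<^sup>2 * M"
  shows "2 * (\<alpha> / \<eta>) * X * V * D + X * (3 * (\<beta> * \<rho>max * U)\<^sup>2 + 3 * (\<beta> * W)\<^sup>2 + 3 * (\<alpha> / \<eta> * D)\<^sup>2)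
    \<le> 1/14 * (d * \<eta> * V\<^sup>2) + 1/12 * (\<alpha> * M) + 1/256 * (a * z * U\<^sup>2) + 1/4 * (Y * W\<^sup>2)"
proof -
  have XD: "X * D\<^sup>2 \<le> \<eta> / 48 * M"
  proof -
    have "X * D\<^sup>2 \<le> X * (n * L\<^sup>2 * \<alpha>\<^sup>2 * M)" using D X_nonneg by (rule mult_left_mono)
    also have "\<dots> = \<alpha>\<^sup>2 * X * (n * L\<^sup>2) * M" by simp
    also have "\<dots> \<le> \<eta> / 48 * M" using dual_form_bounds(2) nn by (intro mult_right_mono) auto
    finally show ?thesis .
  qed
  have "2 * (\<alpha> / \<eta> * X) * V * D \<le> \<alpha> / \<eta> * X * V\<^sup>2 + \<alpha> / \<eta> * X * D\<^sup>2"
    using pos X_nonneg by (intro weighted_young) (auto simp: power2_eq_square)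
  moreover have "\<alpha> / \<eta> * X * V\<^sup>2 \<le> d * \<eta> / 14 * V\<^sup>2" using dual_form_bounds(1) by (intro mult_right_mono) auto
  moreover have "\<alpha> / \<eta> * (X * D\<^sup>2) \<le> \<alpha> / \<eta> * (\<eta> / 48 * M)" using XD pos by (intro mult_left_mono) auto
  moreover have "\<alpha> / \<eta> * (\<eta> / 48 * M) = \<alpha> * M / 48" using pos by simp
  ultimately have 1: "2 * (\<alpha> / \<eta>) * X * V * D \<le> 1/14 * (d * \<eta> * V\<^sup>2) + 1/48 * (\<alpha> * M)"
    by (simp add: mult.assoc)
  have "\<beta>\<^sup>2 * X * \<rho>max\<^sup>2 * U\<^sup>2 \<le> a * z / 768 * U\<^sup>2" using dual_form_bounds(3) by (intro mult_right_mono) auto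
  then have 2: "X * (3 * (\<beta> * \<rho>max * U)\<^sup>2) \<le> 1/256 * (a * z * U\<^sup>2)" by (simp add: power_mult_distrib ac_simps)
  have "\<beta>\<^sup>2 * X * W\<^sup>2 \<le> Y / 12 * W\<^sup>2" using dual_form_bounds(4) by (intro mult_right_mono) auto
  then have 3: "X * (3 * (\<beta> * W)\<^sup>2) \<le> 1/4 * (Y * W\<^sup>2)" by (simp add: power_mult_distrib ac_simps)
  have "(\<alpha> / \<eta>)\<^sup>2 * (X * D\<^sup>2) \<le> (\<alpha> / \<eta>)\<^sup>2 * (\<eta> / 48 * M)" using XD by (intro mult_left_mono) auto
  also have "\<dots> = \<alpha> / \<eta> * (\<alpha> * M / 48)" using pos by (simp add: power2_eq_square)
  also have "\<dots> \<le> 1 * (\<alpha> * M / 48)" using i_alpha(4) pos nn by (intro mult_right_mono) auto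
  finally have 4: "X * (3 * (\<alpha> / \<eta> * D)\<^sup>2) \<le> 1/16 * (\<alpha> * M)" by (simp add: power_mult_distrib ac_simps power_divide)
  show ?thesis using 1 2 3 4 by (simp add: distrib_left)
qed

lemma cross_terms:
  fixes U V W E D M :: real
  assumes nn: "0 \<le> U" "0 \<le> V" "0 \<le> W" "0 \<le> E" "0 \<le> D" "0 \<le> M"
    and D: "D\<^sup>2 \<le> n * L\<^sup>2 * \<alpha>\<^sup>2 * M"
  shows "d * (\<beta> * \<rho>max * U\<^sup>2 + \<alpha> * \<beta> * (L * U + E) * \<rho>max * U
      + \<beta> * (U + \<eta> * V + \<alpha> * (L * U + E)) * W
      + \<alpha> / \<eta> * (U + \<eta> * V + \<alpha> * (L * U + E)) * D
      + \<alpha> * (L * U + E) * V)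
    \<le> 2/100 * (a * z * U\<^sup>2) + 17/100 * (d * \<eta> * V\<^sup>2) + 36/100 * (Y * W\<^sup>2)
       + 4/100 * (\<phi> * a\<^sub>x * E\<^sup>2) + 13/100 * (\<alpha> * M)"
proof -
  have az: "a * z > 0" using pos z_pos by simp
  have dD: "d / \<eta> * D\<^sup>2 \<le> \<alpha> / 12 * M"
  proof -
    have "d / \<eta> * D\<^sup>2 \<le> d / \<eta> * (n * L\<^sup>2 * \<alpha>\<^sup>2 * M)" using D pos by (intro mult_left_mono) auto
    also have "\<dots> = (\<alpha> * d * (n * L\<^sup>2)) * (\<alpha> / \<eta> * M)" by (simp add: power2_eq_square)
    also have "\<dots> \<le> (\<eta> / 12) * (\<alpha> / \<eta> * M)" using dual_drift_budget(3) pos nn by (intro mult_right_mono) auto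
    also have "\<dots> = \<alpha> / 12 * M" using pos by simp
    finally show ?thesis .
  qed
  have U3: "d * \<beta> * \<rho>max * U\<^sup>2 \<le> 1/512 * (a * z * U\<^sup>2)"
    using mult_right_mono[OF d_beta(3), of "U\<^sup>2"] by simp
  have U4a: "d * (\<alpha> * \<beta> * (L * U) * \<rho>max * U) \<le> 1/20480 * (a * z * U\<^sup>2)"
  proof -
    have "(\<alpha> * L) * (d * \<beta> * \<rho>max * U\<^sup>2) \<le> 1/40 * (1/512 * (a * z * U\<^sup>2))"
      using pos nn rmax_pos
      by (intro mult_mono'[OF alphaL(2) U3]) (auto intro!: mult_nonneg_nonneg divide_nonneg_pos)
    then show ?thesis by (simp add: power2_eq_square ac_simps)
  qed
  have U4b: "d * (\<alpha> * \<beta> * E * \<rho>max * U) \<le> 1/1024 * (a * z * U\<^sup>2) + 1/512 * (\<phi> * a\<^sub>x * E\<^sup>2)"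
  proof -
    have "(d * \<beta>) * (\<rho>max * U) * (\<alpha> * E) \<le> d * \<beta> / 2 * (\<rho>max * U)\<^sup>2 + d * \<beta> / 2 * (\<alpha> * E)\<^sup>2"
      using pos by (intro weighted_young) (auto simp: power2_eq_square)
    moreover have "d * \<beta> * \<rho>max\<^sup>2 * U\<^sup>2 \<le> a * z / 512 * U\<^sup>2" using d_beta(1) by (intro mult_right_mono) auto
    moreover have "d * \<beta> * \<alpha>\<^sup>2 * E\<^sup>2 \<le> \<phi> * a\<^sub>x / 256 * E\<^sup>2" using grad_error_budget(3) by (intro mult_right_mono) auto
    ultimately show ?thesis by (simp add: power_mult_distrib ac_simps)
  qed
  have W5a: "d * (\<beta> * U * W) \<le> 1/1280 * (a * z * U\<^sup>2) + 1/6 * (Y * W\<^sup>2)"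
  proof -
    have "(d * \<beta>) * U * W \<le> d * \<beta> / 2 * U\<^sup>2 + d * \<beta> / 2 * W\<^sup>2"
      using pos by (intro weighted_young) (auto simp: power2_eq_square)
    moreover have "d * \<beta> * U\<^sup>2 \<le> a * z / 640 * U\<^sup>2" using d_beta(2) by (intro mult_right_mono) auto
    moreover have "d * \<beta> * W\<^sup>2 \<le> Y / 3 * W\<^sup>2" using graph_error_absorption(4) by (intro mult_right_mono) auto
    ultimately show ?thesis by (simp add: ac_simps)
  qed
  have W5b: "d * (\<beta> * (\<eta> * V) * W) \<le> 1/20 * (d * \<eta> * V\<^sup>2) + 5/36 * (Y * W\<^sup>2)"
  proof -
    have "(\<eta> * \<beta>) * (d * \<beta>) \<le> 1/12 * (Y / 3)" using i_rest(1) graph_error_absorption(4) pos by (intro mult_mono) auto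
    then have "(d * \<eta>) * ((\<eta> * \<beta>) * (d * \<beta>)) \<le> (d * \<eta>) * (1/12 * (Y / 3))" using pos by (intro mult_left_mono) auto
    then have "(d * \<beta> * \<eta>)\<^sup>2 \<le> 4 * (d * \<eta> / 20) * (5/36 * Y)" by (simp add: power2_eq_square ac_simps)
    then have "(d * \<beta> * \<eta>) * V * W \<le> d * \<eta> / 20 * V\<^sup>2 + 5/36 * Y * W\<^sup>2" using pos Y_nonneg by (intro weighted_young) auto
    then show ?thesis by (simp add: ac_simps)
  qed
  have W5c: "d * (\<beta> * (\<alpha> * (L * U)) * W) \<le> 1/40 * (1/1280 * (a * z * U\<^sup>2) + 1/6 * (Y * W\<^sup>2))"
  proof -
    have "(\<alpha> * L) * (d * (\<beta> * U * W)) \<le> 1/40 * (1/1280 * (a * z * U\<^sup>2) + 1/6 * (Y * W\<^sup>2))"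
      using pos nn rmax_pos
      by (intro mult_mono'[OF alphaL(2) W5a]) (auto intro!: mult_nonneg_nonneg divide_nonneg_pos)
    then show ?thesis by (simp add: ac_simps)
  qed
  have W5d: "d * (\<beta> * (\<alpha> * E) * W) \<le> 1/128 * (\<phi> * a\<^sub>x * E\<^sup>2) + 1/24 * (Y * W\<^sup>2)"
  proof -
    have "(d * \<beta>) * (\<alpha> * E) * W \<le> 2 * (d * \<beta>) * (\<alpha> * E)\<^sup>2 + d * \<beta> / 8 * W\<^sup>2"
      using pos by (intro weighted_young) (auto simp: power2_eq_square)
    moreover have "d * \<beta> * \<alpha>\<^sup>2 * E\<^sup>2 \<le> \<phi> * a\<^sub>x / 256 * E\<^sup>2" using grad_error_budget(3) by (intro mult_right_mono) auto
    moreover have "d * \<beta> * W\<^sup>2 \<le> Y / 3 * W\<^sup>2" using graph_error_absorption(4) by (intro mult_right_mono) auto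
    ultimately show ?thesis by (simp add: power_mult_distrib ac_simps)
  qed
  have D6a: "d * (\<alpha> / \<eta> * U * D) \<le> 1/1280 * (a * z * U\<^sup>2) + 1/24 * (\<alpha> * M)"
  proof -
    have "(d / \<eta>) * (\<alpha> * U) * D \<le> d / \<eta> / 2 * (\<alpha> * U)\<^sup>2 + d / \<eta> / 2 * D\<^sup>2"
      using pos by (intro weighted_young) (auto simp: power2_eq_square)
    moreover have "d / \<eta> * \<alpha>\<^sup>2 * U\<^sup>2 \<le> a * z / 640 * U\<^sup>2"
      using d_alpha(2) pos(2) by (intro mult_right_mono) (simp_all add: pos_divide_le_eq)
    ultimately have "(d / \<eta>) * (\<alpha> * U) * D \<le> 1/1280 * (a * z * U\<^sup>2) + 1/24 * (\<alpha> * M)"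
      using dD by (simp add: power_mult_distrib)
    then show ?thesis by (simp add: ac_simps)
  qed
  have D6b: "d * (\<alpha> / \<eta> * (\<eta> * V) * D) \<le> 1/20 * (d * \<eta> * V\<^sup>2) + 5/144 * (\<alpha> * M)"
  proof -
    have "(d * \<alpha>) * V * D \<le> d * \<eta> / 20 * V\<^sup>2 + 5 * d * \<alpha>\<^sup>2 / \<eta> * D\<^sup>2"
      using pos by (intro weighted_young) (auto simp: power2_eq_square)
    moreover have "5 * \<alpha>\<^sup>2 * (d / \<eta> * D\<^sup>2) \<le> 5 * (1/12) * (\<alpha> / 12 * M)"
      using alpha_sq pos by (intro mult_mono'[OF _ dD]) auto
    moreover have "5 * d * \<alpha>\<^sup>2 / \<eta> * D\<^sup>2 = 5 * \<alpha>\<^sup>2 * (d / \<eta> * D\<^sup>2)" by simp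
    ultimately have "(d * \<alpha>) * V * D \<le> d * \<eta> / 20 * V\<^sup>2 + 5 * (1/12) * (\<alpha> / 12 * M)" by (simp only:)
    then have "(d * \<alpha>) * V * D \<le> 1/20 * (d * \<eta> * V\<^sup>2) + 5/144 * (\<alpha> * M)" by simp
    moreover have "d * (\<alpha> / \<eta> * (\<eta> * V) * D) = (d * \<alpha>) * V * D" using pos(2) by simp
    ultimately show ?thesis by (simp only:)
  qed
  have D6c: "d * (\<alpha> / \<eta> * (\<alpha> * (L * U)) * D) \<le> 1/40 * (1/1280 * (a * z * U\<^sup>2) + 1/24 * (\<alpha> * M))"
  proof -
    have "(\<alpha> * L) * (d * (\<alpha> / \<eta> * U * D)) \<le> 1/40 * (1/1280 * (a * z * U\<^sup>2) + 1/24 * (\<alpha> * M))"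
      using pos nn rmax_pos
      by (intro mult_mono'[OF alphaL(2) D6a]) (auto intro!: mult_nonneg_nonneg divide_nonneg_pos)
    then show ?thesis by (simp add: ac_simps)
  qed
  have D6d: "d * (\<alpha> / \<eta> * (\<alpha> * E) * D) \<le> 1/512 * (\<phi> * a\<^sub>x * E\<^sup>2) + 1/24 * (\<alpha> * M)"
  proof -
    have "(d / \<eta>) * (\<alpha>\<^sup>2 * E) * D \<le> d / \<eta> / 2 * (\<alpha>\<^sup>2 * E)\<^sup>2 + d / \<eta> / 2 * D\<^sup>2"
      using pos by (intro weighted_young) (auto simp: power2_eq_square)
    moreover have "d / \<eta> * \<alpha>^4 * E\<^sup>2 \<le> \<phi> * a\<^sub>x / 256 * E\<^sup>2"
      using grad_error_budget(4) pos(2) by (intro mult_right_mono) (simp_all add: pos_divide_le_eq)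
    ultimately have "(d / \<eta>) * (\<alpha>\<^sup>2 * E) * D \<le> 1/512 * (\<phi> * a\<^sub>x * E\<^sup>2) + 1/24 * (\<alpha> * M)"
      using dD by (simp add: power_mult_distrib)
    then show ?thesis by (simp add: power2_eq_square ac_simps)
  qed
  have V7a: "d * (\<alpha> * (L * U) * V) \<le> 5/384 * (a * z * U\<^sup>2) + 1/40 * (d * \<eta> * V\<^sup>2)"
  proof -
    have "d * (d * \<alpha>\<^sup>2 * L\<^sup>2) \<le> d * (a * z * \<eta> / 768)" using d_alpha(1) pos by (intro mult_left_mono) auto
    then have "(d * \<alpha> * L)\<^sup>2 \<le> 4 * (5/384 * (a * z)) * (d * \<eta> / 40)" by (simp add: power2_eq_square ac_simps)
    then have "(d * \<alpha> * L) * U * V \<le> 5/384 * (a * z) * U\<^sup>2 + d * \<eta> / 40 * V\<^sup>2" using az pos by (intro weighted_young) auto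
    then show ?thesis by (simp add: ac_simps)
  qed
  have V7b: "d * (\<alpha> * E * V) \<le> 7/384 * (\<phi> * a\<^sub>x * E\<^sup>2) + 1/28 * (d * \<eta> * V\<^sup>2)"
  proof -
    have "d * (d * \<alpha>\<^sup>2) \<le> d * (\<phi> * a\<^sub>x * \<eta> / 384)" using grad_error_budget(2) pos by (intro mult_left_mono) auto
    then have "(d * \<alpha>)\<^sup>2 \<le> 4 * (7/384 * (\<phi> * a\<^sub>x)) * (d * \<eta> / 28)" by (simp add: power2_eq_square ac_simps)
    then have "(d * \<alpha>) * E * V \<le> 7/384 * (\<phi> * a\<^sub>x) * E\<^sup>2 + d * \<eta> / 28 * V\<^sup>2" using pos by (intro weighted_young) auto
    then show ?thesis by (simp add: ac_simps)
  qed
  have split: "d * (\<beta> * \<rho>max * U\<^sup>2 + \<alpha> * \<beta> * (L * U + E) * \<rho>max * U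
      + \<beta> * (U + \<eta> * V + \<alpha> * (L * U + E)) * W
      + \<alpha> / \<eta> * (U + \<eta> * V + \<alpha> * (L * U + E)) * D
      + \<alpha> * (L * U + E) * V)
    = d * \<beta> * \<rho>max * U\<^sup>2 + d * (\<alpha> * \<beta> * (L * U) * \<rho>max * U) + d * (\<alpha> * \<beta> * E * \<rho>max * U)
     + d * (\<beta> * U * W) + d * (\<beta> * (\<eta> * V) * W) + d * (\<beta> * (\<alpha> * (L * U)) * W) + d * (\<beta> * (\<alpha> * E) * W)
     + d * (\<alpha> / \<eta> * U * D) + d * (\<alpha> / \<eta> * (\<eta> * V) * D) + d * (\<alpha> / \<eta> * (\<alpha> * (L * U)) * D) + d * (\<alpha> / \<eta> * (\<alpha> * E) * D)
     + d * (\<alpha> * (L * U) * V) + d * (\<alpha> * E * V)"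
    by (simp only: distrib_left distrib_right mult.assoc add.assoc)
  have nonneg: "0 \<le> a * z * U\<^sup>2" "0 \<le> d * \<eta> * V\<^sup>2" "0 \<le> Y * W\<^sup>2" "0 \<le> \<phi> * a\<^sub>x * E\<^sup>2" "0 \<le> \<alpha> * M"
    using az pos nn Y_nonneg by simp_all
  have total: "1/512 * u + 1/20480 * u + (1/1024 * u + 1/512 * e') + (1/1280 * u + 1/6 * w)
      + (1/20 * v + 5/36 * w) + 1/40 * (1/1280 * u + 1/6 * w) + (1/128 * e' + 1/24 * w)
      + (1/1280 * u + 1/24 * m) + (1/20 * v + 5/144 * m) + 1/40 * (1/1280 * u + 1/24 * m)
      + (1/512 * e' + 1/24 * m) + (5/384 * u + 1/40 * v) + (7/384 * e' + 1/28 * v)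
    \<le> 2/100 * u + 17/100 * v + 36/100 * w + 4/100 * e' + 13/100 * m"
    if "0 \<le> u" "0 \<le> v" "0 \<le> w" "0 \<le> e'" "0 \<le> m" for u v w e' m :: real
    using that by (simp add: field_simps)
  show ?thesis unfolding split
    by (rule order_trans[OF _ total[OF nonneg]]) (intro add_mono U3 U4a U4b W5a W5b W5c W5d D6a D6b D6c D6d V7a V7b)
qed

lemma shift_terms:
  fixes U V W E :: real
  assumes nn: "0 \<le> U" "0 \<le> V" "0 \<le> W" "0 \<le> E"
  shows "(1 - shift * (1 - a\<^sub>l)) * \<kappa> * a * \<eta> / \<rho>min * V * W + c * \<beta> * V * W
     + shift * \<kappa> * a * (a\<^sub>l * U * W / \<rho>min + \<gamma> * U * W + \<alpha> * (L * U + E) * W / \<rho>min)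
    \<le> 3/100 * (a * z * U\<^sup>2) + 4/100 * (d * \<eta> * V\<^sup>2) + 15/100 * (Y * W\<^sup>2) + 1/1000 * (\<phi> * a\<^sub>x * E\<^sup>2)"
proof -
  have az: "a * z > 0" using pos z_pos by simp
  have shift: "0 \<le> shift" "shift * shift = shift" using shift_01 by auto
  have kk: "\<kappa> * \<kappa> \<le> 12321/10000" using mult_mono[OF kappa_bounds(3) kappa_bounds(3)] kappa_bounds(1) by simp
  have dY: "d * \<eta> * Y / 672 \<le> 4 * (d * \<eta> / 51) * (Y / 51)" using pos Y_nonneg by simp
  have V1: "(1 - shift * (1 - a\<^sub>l)) * \<kappa> * a * \<eta> / \<rho>min * V * W \<le> d * \<eta> / 51 * V\<^sup>2 + Y / 51 * W\<^sup>2"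
    using order_trans[OF graph_error_absorption(2) dY] pos Y_nonneg by (intro weighted_young) auto
  have V2: "c * \<beta> * V * W \<le> d * \<eta> / 51 * V\<^sup>2 + Y / 51 * W\<^sup>2"
    using order_trans[OF graph_error_absorption(1) dY] pos Y_nonneg by (intro weighted_young) auto
  have key: "(shift * \<kappa> * k) * U * W \<le> a * z / 100 * U\<^sup>2 + Y / 30 * W\<^sup>2"
    if k: "shift * k\<^sup>2 \<le> a * z * (Y / 1000)" for k
  proof (rule weighted_young)
    have "(shift * \<kappa> * k)\<^sup>2 = (\<kappa> * \<kappa>) * (shift * shift * k\<^sup>2)" by (simp add: power2_eq_square)
    also have "\<dots> \<le> 12321/10000 * (a * z * (Y / 1000))" unfolding shift(2) using shift(1) by (intro mult_mono[OF kk k]) auto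
    also have "\<dots> \<le> 4 * (a * z / 100) * (Y / 30)" using mult_nonneg_nonneg[OF less_imp_le[OF az] Y_nonneg] by simp
    finally show "(shift * \<kappa> * k)\<^sup>2 \<le> 4 * (a * z / 100) * (Y / 30)" .
  qed (use az Y_nonneg in auto)
  have k1: "shift * (a * a\<^sub>l / \<rho>min)\<^sup>2 \<le> a * z * (Y / 1000)"
  proof -
    have "a * z * (shift * (a * a\<^sub>l\<^sup>2 / (\<gamma> * \<rho>min ^ 3))) \<le> a * z * (Y / 1000)"
      using graph_error_absorption(6) az by (intro mult_left_mono) auto
    moreover have "a * z * (shift * (a * a\<^sub>l\<^sup>2 / (\<gamma> * \<rho>min ^ 3))) = shift * (a * a\<^sub>l / \<rho>min)\<^sup>2"
      using pos by (simp add: z_def power2_eq_square power3_eq_cube)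
    ultimately show ?thesis by metis
  qed
  have k2: "shift * (a * \<gamma>)\<^sup>2 \<le> a * z * (Y / 1000)"
  proof -
    have "a * z * (shift * (a * \<gamma> / \<rho>min)) \<le> a * z * (Y / 1000)"
      using graph_error_absorption(5) az by (intro mult_left_mono) auto
    moreover have "a * z * (shift * (a * \<gamma> / \<rho>min)) = shift * (a * \<gamma>)\<^sup>2"
      using pos by (simp add: z_def power2_eq_square)
    ultimately show ?thesis by metis
  qed
  have k3: "shift * (a * \<alpha> * L / \<rho>min)\<^sup>2 \<le> a * z * (Y / 1000)"
  proof -
    have "\<alpha> * L \<le> z" using alphaL(1) z_pos by linarith
    then have "a * (\<alpha> * L) / \<rho>min \<le> a * z / \<rho>min" using pos by (intro divide_right_mono mult_left_mono) auto
    then have "a * \<alpha> * L / \<rho>min \<le> a * \<gamma>" using pos by (simp add: z_def mult.assoc)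
    then have "shift * (a * \<alpha> * L / \<rho>min)\<^sup>2 \<le> shift * (a * \<gamma>)\<^sup>2" using pos shift by (intro mult_left_mono power_mono) auto
    then show ?thesis using k2 by linarith
  qed
  have W3: "(shift * \<kappa> * (a * \<alpha> / \<rho>min)) * E * W \<le> \<phi> * a\<^sub>x / 1000 * E\<^sup>2 + Y / 100 * W\<^sup>2"
  proof (rule weighted_young)
    have "shift * (a / \<rho>min\<^sup>2 * (a * \<alpha>\<^sup>2)) \<le> shift * (a / \<rho>min\<^sup>2 * (\<phi> * a\<^sub>x * z / 64))" using grad_error_budget(1) shift pos by (intro mult_left_mono) auto
    also have "\<dots> = shift * (a * \<gamma> / \<rho>min) * (\<phi> * a\<^sub>x / 64)" using pos by (simp add: z_def power2_eq_square)
    also have "\<dots> \<le> (Y / 1000) * (\<phi> * a\<^sub>x / 64)" using graph_error_absorption(5) pos by (intro mult_right_mono) auto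
    finally have h: "shift * (a * \<alpha> / \<rho>min)\<^sup>2 \<le> (Y / 1000) * (\<phi> * a\<^sub>x / 64)" by (simp add: power2_eq_square ac_simps)
    have "(shift * \<kappa> * (a * \<alpha> / \<rho>min))\<^sup>2 = (\<kappa> * \<kappa>) * (shift * shift * (a * \<alpha> / \<rho>min)\<^sup>2)" by (simp add: power2_eq_square)
    also have "\<dots> \<le> 12321/10000 * ((Y / 1000) * (\<phi> * a\<^sub>x / 64))" unfolding shift(2) using shift(1) by (intro mult_mono[OF kk h]) auto
    also have "\<dots> \<le> 4 * (\<phi> * a\<^sub>x / 1000) * (Y / 100)" using pos Y_nonneg by simp
    finally show "(shift * \<kappa> * (a * \<alpha> / \<rho>min))\<^sup>2 \<le> 4 * (\<phi> * a\<^sub>x / 1000) * (Y / 100)" .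
  qed (use pos Y_nonneg in auto)
  have split: "shift * \<kappa> * a * (a\<^sub>l * U * W / \<rho>min + \<gamma> * U * W + \<alpha> * (L * U + E) * W / \<rho>min)
    = (shift * \<kappa> * (a * a\<^sub>l / \<rho>min)) * U * W + (shift * \<kappa> * (a * \<gamma>)) * U * W
     + (shift * \<kappa> * (a * \<alpha> * L / \<rho>min)) * U * W + (shift * \<kappa> * (a * \<alpha> / \<rho>min)) * E * W"
    by (simp add: distrib_left distrib_right add_divide_distrib mult.assoc add.assoc)
  have nonneg: "0 \<le> d * \<eta> * V\<^sup>2" "0 \<le> Y * W\<^sup>2" using pos Y_nonneg by simp_all
  have total: "(1/51 * v + 1/51 * w) + (1/51 * v + 1/51 * w) + ((1/100 * u + 1/30 * w) + (1/100 * u + 1/30 * w)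
      + (1/100 * u + 1/30 * w) + (1/1000 * e' + 1/100 * w)) \<le> 3/100 * u + 4/100 * v + 15/100 * w + 1/1000 * e'"
    if "0 \<le> v" "0 \<le> w" for u v w e' :: real
    using that by simp
  show ?thesis unfolding split
    by (rule order_trans[OF _ total[OF nonneg]], intro add_mono)
      (use V1 V2 key[OF k1] key[OF k2] key[OF k3] W3 in simp_all)
qed

text \<open>\<open>u\<close> and \<open>v\<close> are updated by the linear primal-dual iteration, disturbed by \<open>p\<close> (gradients at the
  iterate instead of the average), \<open>y\<close> (gradient error), \<open>w\<close> and \<open>\<delta>\<close> (gradient change). On the left the
  graph error has been replaced by its conditional mean \<open>(1 - a\<^sub>l) w\<close>. The coefficients on the right are
  rounded sums of the Young constants; about half of the descent in \<open>|u|\<^sup>2\<close> and a third of that in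
  \<open>|v|\<^sup>2\<close> remain.\<close>

lemma quadratic_descent:
  fixes C Q :: "'v::real_inner \<Rightarrow> 'v" and u v w p y \<delta> u' v' :: 'v
  assumes lin: "linear Q"
    and sym: "\<And>x y. x \<bullet> Q y = Q x \<bullet> y"
    and C: "\<rho>min * (norm u)\<^sup>2 \<le> u \<bullet> C u" "(norm (C u))\<^sup>2 \<le> \<rho>max * (u \<bullet> C u)"
    and QC: "Q (C u) = u" and Q: "\<And>x. norm (Q x) \<le> norm x / \<rho>min"
    and p: "norm p \<le> L * norm u"
    and \<delta>: "(norm \<delta>)\<^sup>2 \<le> n * L\<^sup>2 * \<alpha>\<^sup>2 * M" and M: "M \<ge> 0"
    and u': "u' = u - \<gamma> *\<^sub>R C u - \<eta> *\<^sub>R v - \<alpha> *\<^sub>R p - \<alpha> *\<^sub>R y"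
    and v': "v' = v + \<beta> *\<^sub>R C u + \<beta> *\<^sub>R w + (\<alpha> / \<eta>) *\<^sub>R \<delta>"
  shows "(a * (norm u')\<^sup>2 + b * (v' \<bullet> Q v') + c * (norm v')\<^sup>2 + d * (u' \<bullet> v')) / 2
       + shift * \<kappa> * a * (1 - a\<^sub>l) * (u' \<bullet> Q w)
    \<le> (a * (norm u)\<^sup>2 + b * (v \<bullet> Q v) + c * (norm v)\<^sup>2 + d * (u \<bullet> v)) / 2 + shift * \<kappa> * a * (u \<bullet> Q w)
       - 4/10 * (a * z * (norm u)\<^sup>2) - 3/10 * (d * \<eta> * (norm v)\<^sup>2)
       + 46/100 * (Y * (norm w)\<^sup>2) + 5/100 * (\<phi> * a\<^sub>x * (norm y)\<^sup>2) + 11/100 * (\<alpha> * M)"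
proof -
  interpret Q: linear Q by (rule lin)
  define U V W E D where "U = norm u" and "V = norm v" and "W = norm w" and "E = norm y" and "D = norm \<delta>"
  note norms = U_def[symmetric] V_def[symmetric] W_def[symmetric] E_def[symmetric] D_def[symmetric]
  have nn: "0 \<le> U" "0 \<le> V" "0 \<le> W" "0 \<le> E" "0 \<le> D" by (simp_all add: U_def V_def W_def E_def D_def)
  have D: "D\<^sup>2 \<le> n * L\<^sup>2 * \<alpha>\<^sup>2 * M" using \<delta> by (simp add: D_def)
  \<comment> \<open>the consensus step without dual and disturbances\<close>
  define r where "r = u - \<gamma> *\<^sub>R C u"
  have az: "0 < a * z" using pos z_pos by simp
  have cs: "\<bar>x1 \<bullet> x2\<bar> \<le> k1 * k2" if "norm x1 \<le> k1" "norm x2 \<le> k2" for x1 x2 :: 'v and k1 k2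
    using Cauchy_Schwarz_ineq2[of x1 x2] mult_mono'[OF that] by simp
  have Cu: "norm (C u) \<le> \<rho>max * U"
  proof (cases "C u = 0")
    case True then show ?thesis using rmax_pos nn by simp
  next
    case False
    have "norm (C u) * norm (C u) \<le> \<rho>max * (norm u * norm (C u))"
      using C(2) rmax_pos norm_cauchy_schwarz[of u "C u"]
      by (smt (verit) mult_left_mono power2_eq_square)
    then show ?thesis using False by (simp add: U_def mult.assoc[symmetric])
  qed
  have r_sq: "(norm r)\<^sup>2 \<le> (1 - 15/8 * z) * U\<^sup>2"
  proof -
    have "(norm r)\<^sup>2 = U\<^sup>2 - 2 * \<gamma> * (u \<bullet> C u) + \<gamma>\<^sup>2 * (norm (C u))\<^sup>2"
      unfolding r_def U_def power2_norm_eq_inner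
      by (simp add: inner_diff_left inner_diff_right inner_commute power2_eq_square)
    also have "\<dots> \<le> U\<^sup>2 - 2 * \<gamma> * (u \<bullet> C u) + \<gamma>\<^sup>2 * (\<rho>max * (u \<bullet> C u))"
      using C(2) by (intro add_left_mono mult_left_mono) auto
    also have "\<dots> = U\<^sup>2 - \<gamma> * (u \<bullet> C u) * (2 - \<gamma> * \<rho>max)" by (simp add: power2_eq_square algebra_simps)
    also have "\<dots> \<le> U\<^sup>2 - \<gamma> * (\<rho>min * U\<^sup>2) * (15/8)"
    proof (rule diff_left_mono, rule mult_mono)
      show "\<gamma> * (\<rho>min * U\<^sup>2) \<le> \<gamma> * (u \<bullet> C u)" using C(1) pos by (intro mult_left_mono) (auto simp: U_def)
      show "0 \<le> \<gamma> * (u \<bullet> C u)" using C(1) pos by (smt (verit) mult_nonneg_nonneg zero_le_power2)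
    qed (use gamma_rmax in auto)
    finally show ?thesis by (simp add: z_def algebra_simps)
  qed
  have r: "norm r \<le> U"
  proof -
    have "(norm r)\<^sup>2 \<le> U\<^sup>2" using r_sq mult_right_mono[of "1 - 15/8 * z" 1 "U\<^sup>2"] z_pos by simp
    then show ?thesis using nn(1) by (rule power2_le_imp_le)
  qed
  have py: "norm (p + y) \<le> L * U + E" using norm_triangle_ineq[of p y] p by (simp add: U_def E_def)
  have u'_eq: "u' = (r - \<eta> *\<^sub>R v) + (- \<alpha>) *\<^sub>R (p + y)" unfolding u' r_def by (simp add: algebra_simps)
  have u'_norm: "norm u' \<le> U + \<eta> * V + \<alpha> * (L * U + E)"
  proof -
    have "norm u' \<le> norm r + norm (\<eta> *\<^sub>R v) + norm ((- \<alpha>) *\<^sub>R (p + y))"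
      unfolding u'_eq by (meson add_right_mono norm_triangle_ineq norm_triangle_ineq4 order_trans)
    also have "\<dots> \<le> U + \<eta> * V + \<alpha> * (L * U + E)"
      using r py pos by (intro add_mono) (auto simp: V_def)
    finally show ?thesis .
  qed

  define I1 I2 where "I1 = u \<bullet> v" and "I2 = C u \<bullet> v"
  have P1: "a * (norm u')\<^sup>2 \<le> a * U\<^sup>2 - 11/12 * (a * z * U\<^sup>2) - 2 * (\<kappa> * a * \<eta> * I1) + 2 * (\<kappa> * a * \<eta> * \<gamma> * I2)
      + 1/19 * (d * \<eta> * V\<^sup>2) + 1/24 * (\<phi> * a\<^sub>x * E\<^sup>2)"
  proof -
    have "(norm u')\<^sup>2 \<le> \<kappa> * (norm (r - \<eta> *\<^sub>R v))\<^sup>2 + \<kappa> / (\<kappa> - 1) * (norm ((- \<alpha>) *\<^sub>R (p + y)))\<^sup>2"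
      unfolding u'_eq by (rule norm_add_sq_young[OF kappa_bounds(2)])
    moreover have "\<kappa> / (\<kappa> - 1) * (norm ((- \<alpha>) *\<^sub>R (p + y)))\<^sup>2 \<le> 4 / (3 * z) * (\<alpha>\<^sup>2 * (2 * (L\<^sup>2 * U\<^sup>2) + 2 * E\<^sup>2))"
    proof (rule mult_mono[OF kappa_bounds(5)])
      have "(norm p)\<^sup>2 \<le> (L * U)\<^sup>2" using p by (intro power_mono) (auto simp: U_def)
      then have "(norm (p + y))\<^sup>2 \<le> 2 * (L\<^sup>2 * U\<^sup>2) + 2 * E\<^sup>2"
        using norm_add_sq_le2[of p y] by (simp add: E_def power_mult_distrib)
      then have "\<alpha>\<^sup>2 * (norm (p + y))\<^sup>2 \<le> \<alpha>\<^sup>2 * (2 * (L\<^sup>2 * U\<^sup>2) + 2 * E\<^sup>2)" by (rule mult_left_mono) auto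
      then show "(norm ((- \<alpha>) *\<^sub>R (p + y)))\<^sup>2 \<le> \<alpha>\<^sup>2 * (2 * (L\<^sup>2 * U\<^sup>2) + 2 * E\<^sup>2)" by (simp add: power_mult_distrib)
    qed (use z_pos in auto)
    ultimately have "a * (norm u')\<^sup>2 \<le> a * (\<kappa> * (norm (r - \<eta> *\<^sub>R v))\<^sup>2 + 4 / (3 * z) * (\<alpha>\<^sup>2 * (2 * (L\<^sup>2 * U\<^sup>2) + 2 * E\<^sup>2)))"
      using pos by (intro mult_left_mono) auto
    also have "\<dots> = a * \<kappa> * (norm (r - \<eta> *\<^sub>R v))\<^sup>2 + 8 * (a * \<alpha>\<^sup>2 * L\<^sup>2 / (3 * z)) * U\<^sup>2 + 8 * (a * \<alpha>\<^sup>2 / (3 * z)) * E\<^sup>2"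
      by (simp add: algebra_simps add_divide_distrib)
    also have "8 * (a * \<alpha>\<^sup>2 * L\<^sup>2 / (3 * z)) * U\<^sup>2 \<le> a * z / 12 * U\<^sup>2"
    proof (rule mult_right_mono)
      have "a * (\<alpha>\<^sup>2 * L\<^sup>2) \<le> a * (z\<^sup>2 / 32)" using alphaL(3) pos by (intro mult_left_mono) auto
      then show "8 * (a * \<alpha>\<^sup>2 * L\<^sup>2 / (3 * z)) \<le> a * z / 12" using z_pos by (simp add: field_simps power2_eq_square)
    qed simp
    also have "8 * (a * \<alpha>\<^sup>2 / (3 * z)) * E\<^sup>2 \<le> \<phi> * a\<^sub>x / 24 * E\<^sup>2"
      using grad_error_budget(1) z_pos by (intro mult_right_mono) (auto simp: field_simps)
    also have "a * \<kappa> * (norm (r - \<eta> *\<^sub>R v))\<^sup>2 \<le> a * (1 - z) * U\<^sup>2 - 2 * (\<kappa> * a * \<eta> * I1) + 2 * (\<kappa> * a * \<eta> * \<gamma> * I2) + 1/19 * (d * \<eta> * V\<^sup>2)"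
    proof -
      have e: "(norm (r - \<eta> *\<^sub>R v))\<^sup>2 = (norm r)\<^sup>2 - 2 * \<eta> * (I1 - \<gamma> * I2) + \<eta>\<^sup>2 * V\<^sup>2"
      proof -
        have rv: "r \<bullet> v = I1 - \<gamma> * I2" by (simp add: r_def I1_def I2_def inner_diff_left)
        have "(norm (r - \<eta> *\<^sub>R v))\<^sup>2 = (norm r)\<^sup>2 - 2 * \<eta> * (r \<bullet> v) + \<eta>\<^sup>2 * V\<^sup>2"
          unfolding V_def power2_norm_eq_inner
          by (simp add: inner_diff_left inner_diff_right inner_commute[of v r] power2_eq_square algebra_simps)
        then show ?thesis unfolding rv .
      qed
      have "\<kappa> * (norm r)\<^sup>2 \<le> (1 + 6/7 * z) * ((1 - 15/8 * z) * U\<^sup>2)"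
        using kappa_bounds z_pos by (intro mult_mono r_sq) auto
      also have "\<dots> = (1 + 6/7 * z) * (1 - 15/8 * z) * U\<^sup>2" by simp
      also have "\<dots> \<le> (1 - z) * U\<^sup>2"
      proof (rule mult_right_mono)
        have "z * z \<ge> 0" by simp
        then show "(1 + 6/7 * z) * (1 - 15/8 * z) \<le> 1 - z" using z_pos by (simp add: algebra_simps)
      qed simp
      finally have "a * (\<kappa> * (norm r)\<^sup>2) \<le> a * ((1 - z) * U\<^sup>2)" using pos by (intro mult_left_mono) auto
      moreover have "(\<kappa> * a * \<eta>) * (\<eta> * V\<^sup>2) \<le> d / 19 * (\<eta> * V\<^sup>2)"
        using a_eta(2) pos by (intro mult_right_mono) auto
      ultimately show ?thesis unfolding e by (simp add: power2_eq_square algebra_simps)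
    qed
    finally show ?thesis by (simp add: algebra_simps)
  qed

  define t where "t = \<beta> *\<^sub>R C u + \<beta> *\<^sub>R w + (\<alpha> / \<eta>) *\<^sub>R \<delta>"
  have v'_eq: "v' = v + t" unfolding v' t_def by (simp add: algebra_simps)
  have P2: "b * (v' \<bullet> Q v') + c * (norm v')\<^sup>2 \<le> b * (v \<bullet> Q v) + c * V\<^sup>2 + 2 * (\<kappa> * a * \<eta> * I1)
      + (d * (\<gamma> + \<eta> * \<beta>) * I2 - 2 * (\<kappa> * a * \<eta> * \<gamma> * I2)) + 2 * (\<kappa> * a * \<eta> * (v \<bullet> Q w)) + 2 * (c * \<beta> * (v \<bullet> w))
      + (2 * (\<alpha> / \<eta>) * X * V * D + X * (3 * (\<beta> * \<rho>max * U)\<^sup>2 + 3 * (\<beta> * W)\<^sup>2 + 3 * (\<alpha> / \<eta> * D)\<^sup>2))"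
  proof -
    have vQt: "v \<bullet> Q t = \<beta> * I1 + \<beta> * (v \<bullet> Q w) + \<alpha> / \<eta> * (v \<bullet> Q \<delta>)"
      by (simp add: t_def Q.add Q.scale QC inner_add_right I1_def inner_commute[of v u])
    have vt: "v \<bullet> t = \<beta> * I2 + \<beta> * (v \<bullet> w) + \<alpha> / \<eta> * (v \<bullet> \<delta>)"
      by (simp add: t_def inner_add_right I2_def inner_commute[of v "C u"])
    have e: "b * (v' \<bullet> Q v') + c * (norm v')\<^sup>2
       = b * (v \<bullet> Q v) + c * V\<^sup>2 + 2 * (b * (v \<bullet> Q t)) + 2 * (c * (v \<bullet> t)) + (b * (t \<bullet> Q t) + c * (norm t)\<^sup>2)"
      unfolding v'_eq V_def power2_norm_eq_inner
      by (simp add: Q.add inner_add_left inner_add_right sym[of t v] inner_commute[of "Q t" v] inner_commute[of t v] algebra_simps)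
    have "b * (t \<bullet> Q t) + c * (norm t)\<^sup>2 \<le> X * (norm t)\<^sup>2"
    proof -
      have "t \<bullet> Q t \<le> norm t * (norm t / \<rho>min)" using cs[of t "norm t" "Q t", OF order_refl Q[of t]] by simp
      then have "b * (t \<bullet> Q t) \<le> b * (norm t * (norm t / \<rho>min))" using pos by (intro mult_left_mono) auto
      then show ?thesis by (simp add: X_def distrib_right power2_eq_square)
    qed
    also have "\<dots> \<le> X * (3 * (\<beta> * \<rho>max * U)\<^sup>2 + 3 * (\<beta> * W)\<^sup>2 + 3 * (\<alpha> / \<eta> * D)\<^sup>2)"
    proof (rule mult_left_mono[OF _ X_nonneg])
      have "(norm t)\<^sup>2 \<le> 3 * (norm (\<beta> *\<^sub>R C u))\<^sup>2 + 3 * (norm (\<beta> *\<^sub>R w))\<^sup>2 + 3 * (norm ((\<alpha> / \<eta>) *\<^sub>R \<delta>))\<^sup>2"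
        unfolding t_def by (rule norm_add_sq_le3)
      moreover have "(norm (\<beta> *\<^sub>R C u))\<^sup>2 \<le> (\<beta> * \<rho>max * U)\<^sup>2"
        using Cu pos by (intro power_mono) (auto simp: mult.assoc)
      moreover have "norm (\<beta> *\<^sub>R w) = \<beta> * W" "norm ((\<alpha> / \<eta>) *\<^sub>R \<delta>) = \<alpha> / \<eta> * D"
        using pos by (auto simp: W_def D_def)
      ultimately show "(norm t)\<^sup>2 \<le> 3 * (\<beta> * \<rho>max * U)\<^sup>2 + 3 * (\<beta> * W)\<^sup>2 + 3 * (\<alpha> / \<eta> * D)\<^sup>2" by simp
    qed
    finally have T: "b * (t \<bullet> Q t) + c * (norm t)\<^sup>2 \<le> X * (3 * (\<beta> * \<rho>max * U)\<^sup>2 + 3 * (\<beta> * W)\<^sup>2 + 3 * (\<alpha> / \<eta> * D)\<^sup>2)" .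
    have d1: "b * (v \<bullet> Q \<delta>) + c * (v \<bullet> \<delta>) \<le> X * (V * D)"
    proof -
      have "v \<bullet> Q \<delta> \<le> V * (D / \<rho>min)" "v \<bullet> \<delta> \<le> V * D"
        using cs[of v V "Q \<delta>" "D / \<rho>min"] cs[of v V \<delta> D] Q[of \<delta>] by (auto simp: V_def D_def)
      then have "b * (v \<bullet> Q \<delta>) \<le> b * (V * (D / \<rho>min))" "c * (v \<bullet> \<delta>) \<le> c * (V * D)"
        using pos by (auto intro!: mult_left_mono simp del: times_divide_eq_right)
      then show ?thesis by (simp add: X_def distrib_right)
    qed
    have d2: "2 * (\<alpha> / \<eta>) * (b * (v \<bullet> Q \<delta>) + c * (v \<bullet> \<delta>)) \<le> 2 * (\<alpha> / \<eta>) * (X * (V * D))"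
      using d1 pos by (intro mult_left_mono) auto
    have "2 * (b * (v \<bullet> Q t)) + 2 * (c * (v \<bullet> t)) = 2 * ((b * \<beta>) * I1) + (2 * (c * \<beta>)) * I2 + 2 * ((b * \<beta>) * (v \<bullet> Q w)) + 2 * (c * \<beta> * (v \<bullet> w))
       + 2 * (\<alpha> / \<eta>) * (b * (v \<bullet> Q \<delta>) + c * (v \<bullet> \<delta>))" unfolding vQt vt by (simp add: algebra_simps)
    also have "\<dots> = 2 * (\<kappa> * a * \<eta> * I1) + (d * (\<gamma> + \<eta> * \<beta>) * I2 - 2 * (\<kappa> * a * \<eta> * \<gamma> * I2)) + 2 * (\<kappa> * a * \<eta> * (v \<bullet> Q w)) + 2 * (c * \<beta> * (v \<bullet> w))
       + 2 * (\<alpha> / \<eta>) * (b * (v \<bullet> Q \<delta>) + c * (v \<bullet> \<delta>))"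
      unfolding b_beta c_beta by (simp only: left_diff_distrib mult.assoc)
    finally show ?thesis unfolding e using T d2 by (simp add: mult.assoc)
  qed

  have P3: "d * (u' \<bullet> v') \<le> d * I1 - d * (\<gamma> + \<eta> * \<beta>) * I2 - d * \<eta> * V\<^sup>2
     + d * (\<beta> * \<rho>max * U\<^sup>2 + \<alpha> * \<beta> * (L * U + E) * \<rho>max * U
      + \<beta> * (U + \<eta> * V + \<alpha> * (L * U + E)) * W
      + \<alpha> / \<eta> * (U + \<eta> * V + \<alpha> * (L * U + E)) * D
      + \<alpha> * (L * U + E) * V)"
  proof -
    have u'v: "u' \<bullet> v = I1 - \<gamma> * I2 - \<eta> * V\<^sup>2 - \<alpha> * ((p + y) \<bullet> v)"
      unfolding u'_eq r_def I1_def I2_def V_def power2_norm_eq_inner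
      by (simp add: inner_add_left inner_diff_left algebra_simps)
    have u'Cu: "u' \<bullet> C u = r \<bullet> C u - \<eta> * I2 - \<alpha> * ((p + y) \<bullet> C u)"
      unfolding u'_eq I2_def by (simp add: inner_add_left inner_diff_left inner_commute[of v "C u"])
    have e: "u' \<bullet> v' = u' \<bullet> v + \<beta> * (u' \<bullet> C u) + \<beta> * (u' \<bullet> w) + \<alpha> / \<eta> * (u' \<bullet> \<delta>)"
      unfolding v' by (simp add: inner_add_right)
    have expand: "d * (I1 - k * I2 - \<eta> * V\<^sup>2 + \<alpha> * (H * V) + \<beta> * (U * (\<rho>max * U))
        + \<beta> * (\<alpha> * (H * (\<rho>max * U))) + \<beta> * (K * W) + h * (K * D))
      = d * I1 - d * k * I2 - d * \<eta> * V\<^sup>2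
        + d * (\<beta> * \<rho>max * U\<^sup>2 + \<alpha> * \<beta> * H * \<rho>max * U + \<beta> * K * W + h * K * D + \<alpha> * H * V)" for k H K h
      by (simp add: algebra_simps power2_eq_square)
    let ?K = "U + \<eta> * V + \<alpha> * (L * U + E)"
    have b1: "- ((p + y) \<bullet> v) \<le> (L * U + E) * V" using cs[OF py, of v V] by (simp add: V_def)
    have b2: "- ((p + y) \<bullet> C u) \<le> (L * U + E) * (\<rho>max * U)" using cs[OF py Cu] by simp
    have b3: "r \<bullet> C u \<le> U * (\<rho>max * U)" using cs[OF r Cu] by simp
    have b4: "u' \<bullet> w \<le> ?K * W" using cs[OF u'_norm, of w W] by (simp add: W_def)
    have b5: "u' \<bullet> \<delta> \<le> ?K * D" using cs[OF u'_norm, of \<delta> D] by (simp add: D_def)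
    have "u' \<bullet> v' = I1 - (\<gamma> + \<eta> * \<beta>) * I2 - \<eta> * V\<^sup>2 + \<alpha> * (- ((p + y) \<bullet> v)) + \<beta> * (r \<bullet> C u)
        + \<beta> * (\<alpha> * (- ((p + y) \<bullet> C u))) + \<beta> * (u' \<bullet> w) + \<alpha> / \<eta> * (u' \<bullet> \<delta>)"
      unfolding e u'v u'Cu by (simp add: algebra_simps)
    also have "\<dots> \<le> I1 - (\<gamma> + \<eta> * \<beta>) * I2 - \<eta> * V\<^sup>2 + \<alpha> * ((L * U + E) * V) + \<beta> * (U * (\<rho>max * U))
        + \<beta> * (\<alpha> * ((L * U + E) * (\<rho>max * U))) + \<beta> * (?K * W) + \<alpha> / \<eta> * (?K * D)"
      using pos by (intro add_mono mult_left_mono b1 b2 b3 b4 b5 order_refl) auto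
    finally have "d * (u' \<bullet> v') \<le> d * (I1 - (\<gamma> + \<eta> * \<beta>) * I2 - \<eta> * V\<^sup>2 + \<alpha> * ((L * U + E) * V) + \<beta> * (U * (\<rho>max * U))
        + \<beta> * (\<alpha> * ((L * U + E) * (\<rho>max * U))) + \<beta> * (?K * W) + \<alpha> / \<eta> * (?K * D))"
      using pos by (intro mult_left_mono) auto
    also have "\<dots> = d * I1 - d * (\<gamma> + \<eta> * \<beta>) * I2 - d * \<eta> * V\<^sup>2
     + d * (\<beta> * \<rho>max * U\<^sup>2 + \<alpha> * \<beta> * (L * U + E) * \<rho>max * U + \<beta> * ?K * W + \<alpha> / \<eta> * ?K * D + \<alpha> * (L * U + E) * V)"
      by (rule expand)
    finally show ?thesis .
  qed

  let ?c = "shift * \<kappa> * a"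
  have c0: "0 \<le> ?c" using shift_01 kappa_bounds(1) pos by auto
  have P4: "?c * (1 - a\<^sub>l) * (u' \<bullet> Q w) \<le> ?c * (u \<bullet> Q w) - ?c * (1 - a\<^sub>l) * \<eta> * (v \<bullet> Q w)
     + ?c * (a\<^sub>l * U * W / \<rho>min + \<gamma> * U * W + \<alpha> * (L * U + E) * W / \<rho>min)"
  proof -
    have expand: "k * (x1 - l' * \<eta> * x2 + a\<^sub>l * (U * (W / \<rho>min)) + 1 * (\<gamma> * (U * W) + \<alpha> * (H * (W / \<rho>min))))
      = k * x1 - k * l' * \<eta> * x2 + k * (a\<^sub>l * U * W / \<rho>min + \<gamma> * U * W + \<alpha> * H * W / \<rho>min)" for k l' x1 x2 H
      by (simp add: algebra_simps)
    have Qw: "norm (Q w) \<le> W / \<rho>min" using Q by (simp add: W_def)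
    have "C u \<bullet> Q w = u \<bullet> w" using sym[of "C u" w] QC by simp
    then have e: "u' \<bullet> Q w = u \<bullet> Q w - \<gamma> * (u \<bullet> w) - \<eta> * (v \<bullet> Q w) - \<alpha> * ((p + y) \<bullet> Q w)"
      unfolding u'_eq r_def by (simp add: inner_add_left inner_diff_left)
    have l: "0 \<le> 1 - a\<^sub>l" "1 - a\<^sub>l \<le> 1" "0 \<le> a\<^sub>l" using params(6) by auto
    have "(1 - a\<^sub>l) * (u' \<bullet> Q w) = u \<bullet> Q w - (1 - a\<^sub>l) * \<eta> * (v \<bullet> Q w)
      + a\<^sub>l * (- (u \<bullet> Q w)) + (1 - a\<^sub>l) * (\<gamma> * (- (u \<bullet> w)) + \<alpha> * (- ((p + y) \<bullet> Q w)))"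
      unfolding e by (simp add: algebra_simps)
    also have "\<dots> \<le> u \<bullet> Q w - (1 - a\<^sub>l) * \<eta> * (v \<bullet> Q w)
      + a\<^sub>l * (U * (W / \<rho>min)) + 1 * (\<gamma> * (U * W) + \<alpha> * ((L * U + E) * (W / \<rho>min)))"
    proof (intro add_mono order_refl)
      show "a\<^sub>l * (- (u \<bullet> Q w)) \<le> a\<^sub>l * (U * (W / \<rho>min))"
        using cs[of u U, OF _ Qw] l by (intro mult_left_mono) (auto simp: U_def)
      have "(1 - a\<^sub>l) * (\<gamma> * (- (u \<bullet> w)) + \<alpha> * (- ((p + y) \<bullet> Q w))) \<le> (1 - a\<^sub>l) * (\<gamma> * (U * W) + \<alpha> * ((L * U + E) * (W / \<rho>min)))"
      proof (intro mult_left_mono add_mono)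
        show "- (u \<bullet> w) \<le> U * W" using cs[of u U w W] by (simp add: U_def W_def)
        show "- ((p + y) \<bullet> Q w) \<le> (L * U + E) * (W / \<rho>min)" using cs[OF py Qw] by simp
      qed (use pos l in auto)
      also have "\<dots> \<le> 1 * (\<gamma> * (U * W) + \<alpha> * ((L * U + E) * (W / \<rho>min)))"
        using l pos nn by (intro mult_right_mono) (auto intro!: add_nonneg_nonneg mult_nonneg_nonneg divide_nonneg_pos)
      finally show "(1 - a\<^sub>l) * (\<gamma> * (- (u \<bullet> w)) + \<alpha> * (- ((p + y) \<bullet> Q w))) \<le> 1 * (\<gamma> * (U * W) + \<alpha> * ((L * U + E) * (W / \<rho>min)))" .
    qed
    finally have "?c * ((1 - a\<^sub>l) * (u' \<bullet> Q w)) \<le> ?c * (u \<bullet> Q w - (1 - a\<^sub>l) * \<eta> * (v \<bullet> Q w)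
      + a\<^sub>l * (U * (W / \<rho>min)) + 1 * (\<gamma> * (U * W) + \<alpha> * ((L * U + E) * (W / \<rho>min))))"
      using c0 by (rule mult_left_mono)
    also have "\<dots> = ?c * (u \<bullet> Q w) - ?c * (1 - a\<^sub>l) * \<eta> * (v \<bullet> Q w)
     + ?c * (a\<^sub>l * U * W / \<rho>min + \<gamma> * U * W + \<alpha> * (L * U + E) * W / \<rho>min)"
      by (rule expand)
    finally show ?thesis by (simp only: mult.assoc)
  qed

  have P5: "\<kappa> * a * \<eta> * (v \<bullet> Q w) - ?c * (1 - a\<^sub>l) * \<eta> * (v \<bullet> Q w) + c * \<beta> * (v \<bullet> w)
    \<le> (1 - shift * (1 - a\<^sub>l)) * \<kappa> * a * \<eta> / \<rho>min * V * W + c * \<beta> * V * W"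
  proof -
    have "\<bar>v \<bullet> Q w\<bar> \<le> V * (W / \<rho>min)" "\<bar>v \<bullet> w\<bar> \<le> V * W"
      using cs[of v V "Q w" "W / \<rho>min"] cs[of v V w W] Q[of w] by (auto simp: V_def W_def)
    moreover have k: "0 \<le> (1 - shift * (1 - a\<^sub>l)) * \<kappa> * a * \<eta>"
      using shift_01 params(6) kappa_bounds(1) pos by (intro mult_nonneg_nonneg) auto
    ultimately have "(1 - shift * (1 - a\<^sub>l)) * \<kappa> * a * \<eta> * (v \<bullet> Q w) \<le> (1 - shift * (1 - a\<^sub>l)) * \<kappa> * a * \<eta> * (V * (W / \<rho>min))"
      "c * \<beta> * (v \<bullet> w) \<le> c * \<beta> * (V * W)"
      using pos by (auto intro!: mult_left_mono simp del: times_divide_eq_right)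
    moreover have "\<kappa> * a * \<eta> * (v \<bullet> Q w) - ?c * (1 - a\<^sub>l) * \<eta> * (v \<bullet> Q w) = (1 - shift * (1 - a\<^sub>l)) * \<kappa> * a * \<eta> * (v \<bullet> Q w)"
      by (simp add: algebra_simps)
    ultimately show ?thesis by simp
  qed
  note S1 = dual_terms[OF nn M D]
  note S2 = cross_terms[OF nn M D]
  note S3 = shift_terms[OF nn(1-4)]
  have nonneg: "0 \<le> a * z * U\<^sup>2" "0 \<le> d * \<eta> * V\<^sup>2" "0 \<le> Y * W\<^sup>2" "0 \<le> \<phi> * a\<^sub>x * E\<^sup>2" "0 \<le> \<alpha> * M"
    using az pos nn M Y_nonneg by simp_all
  have P12: "a * (norm u')\<^sup>2 + (b * (v' \<bullet> Q v') + c * (norm v')\<^sup>2) + d * (u' \<bullet> v')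
    \<le> a * U\<^sup>2 + (b * (v \<bullet> Q v) + c * V\<^sup>2) + d * I1 + 2 * (\<kappa> * a * \<eta> * (v \<bullet> Q w)) + 2 * (c * \<beta> * (v \<bullet> w))
     + (-11/12 + 1/256 + 2/100) * (a * z * U\<^sup>2) + (1/19 + 1/14 - 1 + 17/100) * (d * \<eta> * V\<^sup>2)
     + (1/24 + 4/100) * (\<phi> * a\<^sub>x * E\<^sup>2) + (1/4 + 36/100) * (Y * W\<^sup>2) + (1/12 + 13/100) * (\<alpha> * M)"
    using P1 order_trans[OF P2 add_left_mono[OF S1]] order_trans[OF P3 add_left_mono[OF S2]] by argo
  have P56: "\<kappa> * a * \<eta> * (v \<bullet> Q w) - ?c * (1 - a\<^sub>l) * \<eta> * (v \<bullet> Q w) + c * \<beta> * (v \<bullet> w)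
     + ?c * (a\<^sub>l * U * W / \<rho>min + \<gamma> * U * W + \<alpha> * (L * U + E) * W / \<rho>min)
    \<le> 3/100 * (a * z * U\<^sup>2) + 4/100 * (d * \<eta> * V\<^sup>2) + 15/100 * (Y * W\<^sup>2) + 1/1000 * (\<phi> * a\<^sub>x * E\<^sup>2)"
    by (rule order_trans[OF add_right_mono[OF P5] S3])
  show ?thesis unfolding norms I1_def[symmetric] using P12 P4 P56 nonneg by argo
qed

text \<open>The final account. \<open>H\<close> is the squared distance by which the disagreement moves; \<open>q0\<close> and \<open>q1\<close> are the
  old and the new value of the quadratic part, \<open>\<epsilon>\<close> is the averaged gradient error, and \<open>\<epsilon>2\<close>, \<open>ex2\<close>, \<open>w2\<close>
  are the conditional second moments of the new errors. Every multiple of \<open>H\<close> is charged to the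
  descent in \<open>U\<close>, \<open>V\<close> and \<open>E\<close>.\<close>

lemma drift_budget:
  fixes U V W E Ex \<epsilon> M N2 H F0 F1 q0 q1 \<epsilon>2 ex2 w2 sb :: real
  assumes nn: "0 \<le> E" "E \<le> Ex" "0 \<le> M" "0 \<le> H" "0 \<le> N2"
    and H: "H \<le> 6 * (\<gamma>\<^sup>2 * \<rho>max\<^sup>2 * U\<^sup>2) + 6 * (\<eta>\<^sup>2 * V\<^sup>2) + 6 * (\<alpha>\<^sup>2 * L\<^sup>2 * U\<^sup>2) + 2 * (\<alpha>\<^sup>2 * E\<^sup>2)"
    and quad: "q1 \<le> q0 - 4/10 * (a * z * U\<^sup>2) - 3/10 * (d * \<eta> * V\<^sup>2)
       + 46/100 * (Y * W\<^sup>2) + 5/100 * (\<phi> * a\<^sub>x * E\<^sup>2) + 11/100 * (\<alpha> * M)"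
    and Fd: "F1 \<le> F0 - \<alpha> / 2 * N2 - \<alpha> / 4 * M + \<alpha> * \<epsilon>\<^sup>2 + \<alpha> * (L\<^sup>2 / n * U\<^sup>2)"
    and E1: "\<epsilon>2 \<le> (1 - a\<^sub>x)\<^sup>2 * \<epsilon>\<^sup>2 + 2 * a\<^sub>x\<^sup>2 * sb + 2 * (L\<^sub>s\<^sup>2 / n * (n * \<alpha>\<^sup>2 * M + H))"
    and E2: "ex2 \<le> (1 - a\<^sub>x)\<^sup>2 * Ex\<^sup>2 + 4 * a\<^sub>x\<^sup>2 * n * sb + 4 * (L\<^sub>s\<^sup>2 * (n * \<alpha>\<^sup>2 * M + H))
        + 4 * (\<gamma>\<^sup>2 / \<alpha>\<^sup>2 * (a\<^sub>x\<^sup>2 * \<sigma>\<^sub>A\<^sup>2 * U\<^sup>2 + \<rho>bmax\<^sup>2 * H))"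
    and E3: "w2 \<le> (1 - a\<^sub>l)\<^sup>2 * W\<^sup>2 + 2 * a\<^sub>l\<^sup>2 * \<sigma>\<^sub>A\<^sup>2 * U\<^sup>2 + 2 * (q * H)"
  shows "F1 + q1 + e * \<epsilon>2 + \<phi> * ex2 + g' * w2 + (\<alpha> / 4 * N2 + a * z / 8 * U\<^sup>2)
    \<le> F0 + q0 + e * \<epsilon>\<^sup>2 + \<phi> * Ex\<^sup>2 + g' * W\<^sup>2 + (e * (2 * a\<^sub>x\<^sup>2) + \<phi> * (4 * a\<^sub>x\<^sup>2 * n)) * sb"
proof -
  define AU DV PE AM where "AU = a * z * U\<^sup>2" and "DV = d * \<eta> * V\<^sup>2" and "PE = \<phi> * a\<^sub>x * E\<^sup>2" and "AM = \<alpha> * M"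
  have az: "0 < a * z" using pos z_pos by simp
  have nonneg: "0 \<le> AU" "0 \<le> DV" "0 \<le> PE" "0 \<le> AM" "0 \<le> Y * W\<^sup>2" "0 \<le> \<alpha> * N2" "0 \<le> e * a\<^sub>x * \<epsilon>\<^sup>2"
    using az pos nn Y_nonneg by (simp_all add: AU_def DV_def PE_def AM_def)
  have sq: "(1 - x)\<^sup>2 \<le> 1 - x" if "x \<in> {0..1}" for x :: real
  proof -
    have "(1 - x) * (1 - x) \<le> 1 * (1 - x)" using that by (intro mult_right_mono) auto
    then show ?thesis by (simp add: power2_eq_square)
  qed
  have Hk: "k * H \<le> k1 * AU + k2 * DV + k3 * PE"
    if k: "0 \<le> k" and "6 * (k * (\<gamma>\<^sup>2 * \<rho>max\<^sup>2) + k * (\<alpha>\<^sup>2 * L\<^sup>2)) \<le> k1 * (a * z)" and "6 * (k * \<eta>\<^sup>2) \<le> k2 * (d * \<eta>)"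
      and "2 * (k * \<alpha>\<^sup>2) \<le> k3 * (\<phi> * a\<^sub>x)" for k k1 k2 k3
  proof -
    have "k * H \<le> k * (6 * (\<gamma>\<^sup>2 * \<rho>max\<^sup>2 * U\<^sup>2) + 6 * (\<eta>\<^sup>2 * V\<^sup>2) + 6 * (\<alpha>\<^sup>2 * L\<^sup>2 * U\<^sup>2) + 2 * (\<alpha>\<^sup>2 * E\<^sup>2))"
      using H k by (rule mult_left_mono)
    also have "\<dots> = 6 * (k * (\<gamma>\<^sup>2 * \<rho>max\<^sup>2) + k * (\<alpha>\<^sup>2 * L\<^sup>2)) * U\<^sup>2 + 6 * (k * \<eta>\<^sup>2) * V\<^sup>2 + 2 * (k * \<alpha>\<^sup>2) * E\<^sup>2"
      by (simp add: algebra_simps)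
    also have "\<dots> \<le> k1 * (a * z) * U\<^sup>2 + k2 * (d * \<eta>) * V\<^sup>2 + k3 * (\<phi> * a\<^sub>x) * E\<^sup>2"
      using that by (intro add_mono mult_right_mono) auto
    finally show ?thesis by (simp add: AU_def DV_def PE_def mult.assoc)
  qed
  have scale: "x / n \<le> y" if "x \<le> y * n" for x y using that n_pos by (simp add: pos_divide_le_eq)
  have H1: "(e * L\<^sub>s\<^sup>2 / n) * H \<le> 12/8192 * AU + 6/896 * DV + 2/256 * PE"
  proof (rule Hk)
    have "e * L\<^sub>s\<^sup>2 * (\<gamma>\<^sup>2 * \<rho>max\<^sup>2) / n \<le> a * z / 8192" "e * L\<^sub>s\<^sup>2 * (\<alpha>\<^sup>2 * L\<^sup>2) / n \<le> a * z / 8192"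
      by (rule scale, use avg_error_motion(1,2) in simp)+
    then have "e * L\<^sub>s\<^sup>2 / n * (\<gamma>\<^sup>2 * \<rho>max\<^sup>2) \<le> a * z / 8192" "e * L\<^sub>s\<^sup>2 / n * (\<alpha>\<^sup>2 * L\<^sup>2) \<le> a * z / 8192"
      by (simp_all only: times_divide_eq_left)
    moreover have "6 * (x1 + x2) \<le> 12/8192 * t" if "x1 \<le> t / 8192" "x2 \<le> t / 8192" for x1 x2 t :: real
      using that by (simp add: field_simps)
    ultimately show "6 * (e * L\<^sub>s\<^sup>2 / n * (\<gamma>\<^sup>2 * \<rho>max\<^sup>2) + e * L\<^sub>s\<^sup>2 / n * (\<alpha>\<^sup>2 * L\<^sup>2)) \<le> 12/8192 * (a * z)" by blast
    have "e * L\<^sub>s\<^sup>2 / n * \<eta> \<le> d / 896" using scale[of "e * L\<^sub>s\<^sup>2 * \<eta>" "d / 896"] avg_error_motion(3) by simp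
    then have "e * L\<^sub>s\<^sup>2 / n * \<eta> * \<eta> \<le> d / 896 * \<eta>" using pos by (intro mult_right_mono) auto
    then show "6 * (e * L\<^sub>s\<^sup>2 / n * \<eta>\<^sup>2) \<le> 6/896 * (d * \<eta>)" by (simp add: power2_eq_square mult.assoc)
    have "e * L\<^sub>s\<^sup>2 * \<alpha>\<^sup>2 / n \<le> \<phi> * a\<^sub>x / 256" by (rule scale) (use avg_error_motion(4) in simp)
    then have "e * L\<^sub>s\<^sup>2 / n * \<alpha>\<^sup>2 \<le> \<phi> * a\<^sub>x / 256" by (simp only: times_divide_eq_left)
    then show "2 * (e * L\<^sub>s\<^sup>2 / n * \<alpha>\<^sup>2) \<le> 2/256 * (\<phi> * a\<^sub>x)" by linarith
  qed (use pos n_pos in simp)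
  let ?G = "L\<^sub>s\<^sup>2 + \<gamma>\<^sup>2 / \<alpha>\<^sup>2 * \<rho>bmax\<^sup>2"
  have G0: "0 \<le> ?G" by simp
  have H2: "(\<phi> * ?G) * H \<le> 12/16384 * AU + 6/1792 * DV + 1/16 * PE"
  proof (rule Hk)
    have le: "\<phi> * ?G * x \<le> \<phi> * G * x" if "0 \<le> x" for x
      using G_ge pos that by (intro mult_right_mono mult_left_mono) auto
    show "6 * (\<phi> * ?G * (\<gamma>\<^sup>2 * \<rho>max\<^sup>2) + \<phi> * ?G * (\<alpha>\<^sup>2 * L\<^sup>2)) \<le> 12/16384 * (a * z)"
      using le[of "\<gamma>\<^sup>2 * \<rho>max\<^sup>2"] le[of "\<alpha>\<^sup>2 * L\<^sup>2"] grad_error_motion(1,2) by simp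
    have six: "6 * x \<le> 6/1792 * t" if "x \<le> t / 1792" for x t :: real using that by simp
    show "6 * (\<phi> * ?G * \<eta>\<^sup>2) \<le> 6/1792 * (d * \<eta>)" by (rule six[OF order_trans[OF le grad_error_motion(3)]]) simp
    have "\<phi> * (\<alpha>\<^sup>2 * ?G) \<le> \<phi> * (a\<^sub>x / 32)" using alpha_G pos by (intro mult_left_mono) auto
    moreover have "2 * (\<phi> * x * \<alpha>\<^sup>2) \<le> 1/16 * (\<phi> * a\<^sub>x)" if "\<phi> * (\<alpha>\<^sup>2 * x) \<le> \<phi> * (a\<^sub>x / 32)" for x
      using that by (simp add: ac_simps)
    ultimately show "2 * (\<phi> * ?G * \<alpha>\<^sup>2) \<le> 1/16 * (\<phi> * a\<^sub>x)" by blast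
  qed (use pos G0 in simp)
  have H3: "(g' * q) * H \<le> 12/8192 * AU + 6/100 * DV + 2/256 * PE"
  proof (rule Hk)
    have le: "g' * q * x \<le> g * q * x" if "0 \<le> x" for x
      using g'_bounds(2) q_nonneg that by (intro mult_right_mono) auto
    show "6 * (g' * q * (\<gamma>\<^sup>2 * \<rho>max\<^sup>2) + g' * q * (\<alpha>\<^sup>2 * L\<^sup>2)) \<le> 12/8192 * (a * z)"
      using le[of "\<gamma>\<^sup>2 * \<rho>max\<^sup>2"] le[of "\<alpha>\<^sup>2 * L\<^sup>2"] graph_error_motion(1,2) by simp
    have "g' * q * \<eta> * \<eta> \<le> d / 100 * \<eta>" using g'_bounds(3) pos by (intro mult_right_mono) auto
    then show "6 * (g' * q * \<eta>\<^sup>2) \<le> 6/100 * (d * \<eta>)" by (simp add: power2_eq_square ac_simps)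
    show "2 * (g' * q * \<alpha>\<^sup>2) \<le> 2/256 * (\<phi> * a\<^sub>x)" using le[of "\<alpha>\<^sup>2"] graph_error_motion(3) by simp
  qed (use g'_bounds(1) q_nonneg in simp)
  have M1: "e * L\<^sub>s\<^sup>2 * \<alpha>\<^sup>2 * M \<le> 1/512 * AM"
  proof -
    have "(e * L\<^sub>s\<^sup>2 * \<alpha>) * (\<alpha> * M) \<le> 1/512 * (\<alpha> * M)" using avg_error_motion(5) pos nn by (intro mult_right_mono) auto
    then show ?thesis by (simp add: AM_def power2_eq_square ac_simps)
  qed
  have M2: "\<phi> * (L\<^sub>s\<^sup>2 * (n * \<alpha>\<^sup>2 * M)) \<le> 1/1536 * AM"
  proof -
    have "L\<^sub>s\<^sup>2 \<le> G" using G_ge by (smt (verit) divide_nonneg_nonneg mult_nonneg_nonneg zero_le_power2)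
    then have "\<phi> * (L\<^sub>s\<^sup>2 * (n * \<alpha>\<^sup>2 * M)) \<le> \<phi> * (G * (n * \<alpha>\<^sup>2 * M))"
      using pos n_pos nn by (intro mult_left_mono mult_right_mono) auto
    also have "\<dots> = \<phi> * G * n * \<alpha>\<^sup>2 * M" by simp
    also have "\<dots> \<le> \<alpha> / 1536 * M" using grad_error_motion(4) nn by (intro mult_right_mono) auto
    finally show ?thesis by (simp add: AM_def)
  qed
  have N1: "\<phi> * (\<gamma>\<^sup>2 / \<alpha>\<^sup>2 * (a\<^sub>x\<^sup>2 * \<sigma>\<^sub>A\<^sup>2 * U\<^sup>2)) \<le> 1/5120 * AU"
    using mult_right_mono[OF primal_noise_budget, of "U\<^sup>2"] by (simp add: AU_def ac_simps)
  have N2': "g' * (a\<^sub>l\<^sup>2 * \<sigma>\<^sub>A\<^sup>2 * U\<^sup>2) \<le> 1/2560 * AU"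
  proof -
    have "g' * (a\<^sub>l\<^sup>2 * \<sigma>\<^sub>A\<^sup>2 * U\<^sup>2) \<le> g * (a\<^sub>l\<^sup>2 * \<sigma>\<^sub>A\<^sup>2 * U\<^sup>2)" using g'_bounds(2) by (intro mult_right_mono) auto
    also have "\<dots> \<le> 1/2560 * AU" using mult_right_mono[OF dual_noise_budget, of "U\<^sup>2"] by (simp add: AU_def ac_simps)
    finally show ?thesis .
  qed
  have S1: "e * ((1 - a\<^sub>x)\<^sup>2 * \<epsilon>\<^sup>2) \<le> e * \<epsilon>\<^sup>2 - e * a\<^sub>x * \<epsilon>\<^sup>2"
  proof -
    have "e * ((1 - a\<^sub>x)\<^sup>2 * \<epsilon>\<^sup>2) \<le> e * ((1 - a\<^sub>x) * \<epsilon>\<^sup>2)" using sq[OF params(5)] pos by (intro mult_left_mono mult_right_mono) auto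
    then show ?thesis by (simp add: algebra_simps)
  qed
  have S2: "\<phi> * ((1 - a\<^sub>x)\<^sup>2 * Ex\<^sup>2) \<le> \<phi> * Ex\<^sup>2 - PE"
  proof -
    have "\<phi> * ((1 - a\<^sub>x)\<^sup>2 * Ex\<^sup>2) \<le> \<phi> * ((1 - a\<^sub>x) * Ex\<^sup>2)" using sq[OF params(5)] pos by (intro mult_left_mono mult_right_mono) auto
    moreover have "\<phi> * a\<^sub>x * E\<^sup>2 \<le> \<phi> * a\<^sub>x * Ex\<^sup>2" using nn pos by (intro mult_left_mono power_mono) auto
    ultimately show ?thesis by (simp add: PE_def algebra_simps)
  qed
  have S3: "g' * ((1 - a\<^sub>l)\<^sup>2 * W\<^sup>2) \<le> g' * W\<^sup>2 - Y * W\<^sup>2"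
  proof -
    have "g' * ((1 - a\<^sub>l)\<^sup>2 * W\<^sup>2) \<le> g' * ((1 - a\<^sub>l) * W\<^sup>2)" using sq[OF params(6)] g'_bounds(1) by (intro mult_left_mono mult_right_mono) auto
    then show ?thesis by (simp add: Y_def algebra_simps)
  qed
  have eE: "\<alpha> * \<epsilon>\<^sup>2 \<le> 1/2 * (e * a\<^sub>x * \<epsilon>\<^sup>2)" using mult_right_mono[OF vi, of "\<epsilon>\<^sup>2"] by simp
  have FU: "\<alpha> * (L\<^sup>2 / n * U\<^sup>2) \<le> 1/256 * AU"
  proof -
    have "\<alpha> * L\<^sup>2 / n \<le> a * z / 256" using alpha_L_n scale[of "\<alpha> * L\<^sup>2" "a * z / 256"] by simp
    from mult_right_mono[OF this, of "U\<^sup>2"] show ?thesis by (simp add: AU_def)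
  qed
  have T1: "e * \<epsilon>2 \<le> e * \<epsilon>\<^sup>2 - e * a\<^sub>x * \<epsilon>\<^sup>2 + e * (2 * a\<^sub>x\<^sup>2) * sb + 2 * (e * L\<^sub>s\<^sup>2 * \<alpha>\<^sup>2 * M) + 2 * (e * L\<^sub>s\<^sup>2 / n * H)"
  proof -
    have "e * \<epsilon>2 \<le> e * ((1 - a\<^sub>x)\<^sup>2 * \<epsilon>\<^sup>2 + 2 * a\<^sub>x\<^sup>2 * sb + 2 * (L\<^sub>s\<^sup>2 / n * (n * \<alpha>\<^sup>2 * M + H)))"
      using E1 pos by (intro mult_left_mono) auto
    also have "L\<^sub>s\<^sup>2 / n * (n * \<alpha>\<^sup>2 * M + H) = L\<^sub>s\<^sup>2 * \<alpha>\<^sup>2 * M + L\<^sub>s\<^sup>2 / n * H"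
      using n_pos by (simp add: distrib_left)
    also have "e * ((1 - a\<^sub>x)\<^sup>2 * \<epsilon>\<^sup>2 + 2 * a\<^sub>x\<^sup>2 * sb + 2 * (L\<^sub>s\<^sup>2 * \<alpha>\<^sup>2 * M + L\<^sub>s\<^sup>2 / n * H))
      = e * ((1 - a\<^sub>x)\<^sup>2 * \<epsilon>\<^sup>2) + e * (2 * a\<^sub>x\<^sup>2) * sb + 2 * (e * L\<^sub>s\<^sup>2 * \<alpha>\<^sup>2 * M) + 2 * (e * L\<^sub>s\<^sup>2 / n * H)"
      by (simp add: algebra_simps)
    finally show ?thesis using S1 by linarith
  qed
  have T2: "\<phi> * ex2 \<le> \<phi> * Ex\<^sup>2 - PE + \<phi> * (4 * a\<^sub>x\<^sup>2 * n) * sb + 4 * (\<phi> * (L\<^sub>s\<^sup>2 * (n * \<alpha>\<^sup>2 * M)))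
     + 4 * (\<phi> * (\<gamma>\<^sup>2 / \<alpha>\<^sup>2 * (a\<^sub>x\<^sup>2 * \<sigma>\<^sub>A\<^sup>2 * U\<^sup>2))) + 4 * (\<phi> * ?G * H)"
  proof -
    have "\<phi> * ex2 \<le> \<phi> * ((1 - a\<^sub>x)\<^sup>2 * Ex\<^sup>2 + 4 * a\<^sub>x\<^sup>2 * n * sb + 4 * (L\<^sub>s\<^sup>2 * (n * \<alpha>\<^sup>2 * M + H))
        + 4 * (\<gamma>\<^sup>2 / \<alpha>\<^sup>2 * (a\<^sub>x\<^sup>2 * \<sigma>\<^sub>A\<^sup>2 * U\<^sup>2 + \<rho>bmax\<^sup>2 * H)))"
      using E2 pos by (intro mult_left_mono) auto
    also have "\<dots> = \<phi> * ((1 - a\<^sub>x)\<^sup>2 * Ex\<^sup>2) + \<phi> * (4 * a\<^sub>x\<^sup>2 * n) * sb + 4 * (\<phi> * (L\<^sub>s\<^sup>2 * (n * \<alpha>\<^sup>2 * M)))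
     + 4 * (\<phi> * (\<gamma>\<^sup>2 / \<alpha>\<^sup>2 * (a\<^sub>x\<^sup>2 * \<sigma>\<^sub>A\<^sup>2 * U\<^sup>2))) + 4 * (\<phi> * ?G * H)"
      by (simp only: distrib_left distrib_right mult.assoc mult.left_commute[of _ 4] add.assoc)
    finally show ?thesis using S2 by linarith
  qed
  have T3: "g' * w2 \<le> g' * W\<^sup>2 - Y * W\<^sup>2 + 2 * (g' * (a\<^sub>l\<^sup>2 * \<sigma>\<^sub>A\<^sup>2 * U\<^sup>2)) + 2 * (g' * q * H)"
  proof -
    have "g' * w2 \<le> g' * ((1 - a\<^sub>l)\<^sup>2 * W\<^sup>2 + 2 * a\<^sub>l\<^sup>2 * \<sigma>\<^sub>A\<^sup>2 * U\<^sup>2 + 2 * (q * H))"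
      using E3 g'_bounds(1) by (intro mult_left_mono) auto
    also have "\<dots> = g' * ((1 - a\<^sub>l)\<^sup>2 * W\<^sup>2) + 2 * (g' * (a\<^sub>l\<^sup>2 * \<sigma>\<^sub>A\<^sup>2 * U\<^sup>2)) + 2 * (g' * q * H)"
      by (simp add: algebra_simps)
    finally show ?thesis using S3 by linarith
  qed
  have Fd': "F1 \<le> F0 - 1/2 * (\<alpha> * N2) - 1/4 * AM + \<alpha> * \<epsilon>\<^sup>2 + \<alpha> * (L\<^sup>2 / n * U\<^sup>2)"
    using Fd by (simp add: AM_def)
  have goal: "\<alpha> / 4 * N2 = 1/4 * (\<alpha> * N2)" "a * z / 8 * U\<^sup>2 = AU / 8" "(e * (2 * a\<^sub>x\<^sup>2) + \<phi> * (4 * a\<^sub>x\<^sup>2 * n)) * sb = e * (2 * a\<^sub>x\<^sup>2) * sb + \<phi> * (4 * a\<^sub>x\<^sup>2 * n) * sb"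
    by (simp_all add: AU_def distrib_right)
  show ?thesis unfolding goal
    using quad[folded AU_def DV_def PE_def AM_def] Fd' T1 T2 T3 H1 H2 H3 M1 M2 N1 N2' eE FU nonneg by argo
qed

end

section \<open>Measurability of stacked vectors\<close>

lemma measurable_stack [measurable (raw)]:
  fixes h :: "'n::finite \<Rightarrow> 'a \<Rightarrow> real^'d::finite"
  assumes [measurable]: "\<And>i. h i \<in> borel_measurable M"
  shows "(\<lambda>\<omega>. stack (\<lambda>i. h i \<omega>)) \<in> borel_measurable M"
proof -
  define emb :: "'n \<Rightarrow> real^'d \<Rightarrow> real^('n \<times> 'd)" where "emb i y = stack (\<lambda>j. if j = i then y else 0)" for i y
  have "linear (emb i)" for i
    by (rule linearI) (auto simp: emb_def stack_def vec_eq_iff)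
  then have [measurable]: "emb i \<in> borel_measurable borel" for i
    by (intro borel_measurable_continuous_onI linear_continuous_on) (simp add: linear_conv_bounded_linear)
  have "stack (\<lambda>i. h i \<omega>) = (\<Sum>i\<in>UNIV. emb i (h i \<omega>))" for \<omega>
    by (simp add: emb_def stack_def vec_eq_iff if_distrib[of "\<lambda>t. t $ _"] cong: if_cong)
  then show ?thesis by simp
qed

lemma integral_stack:
  fixes h :: "'n::finite \<Rightarrow> 'a \<Rightarrow> real^'d::finite"
  assumes "\<And>i. integrable M (h i)"
  shows "integrable M (\<lambda>\<omega>. stack (\<lambda>i. h i \<omega>))"
    and "(LINT \<omega>|M. stack (\<lambda>i. h i \<omega>)) = stack (\<lambda>i. LINT \<omega>|M. h i \<omega>)"
proof -
  define emb :: "'n \<Rightarrow> real^'d \<Rightarrow> real^('n \<times> 'd)" where "emb i y = stack (\<lambda>j. if j = i then y else 0)" for i y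
  have "linear (emb i)" for i
    by (rule linearI) (auto simp: emb_def stack_def vec_eq_iff)
  then have bl: "bounded_linear (emb i)" for i by (simp add: linear_conv_bounded_linear)
  have e: "stack k = (\<Sum>i\<in>UNIV. emb i (k i))" for k :: "'n \<Rightarrow> real^'d"
    by (simp add: emb_def stack_def vec_eq_iff if_distrib[of "\<lambda>t. t $ _"] cong: if_cong)
  have i: "integrable M (\<lambda>\<omega>. emb i (h i \<omega>))" for i
    by (rule integrable_bounded_linear[OF bl assms])
  show "integrable M (\<lambda>\<omega>. stack (\<lambda>i. h i \<omega>))" unfolding e using i by simp
  show "(LINT \<omega>|M. stack (\<lambda>i. h i \<omega>)) = stack (\<lambda>i. LINT \<omega>|M. h i \<omega>)"
    unfolding e using i integral_bounded_linear[OF bl assms] by simp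
qed

lemma bounded_linear_block: "bounded_linear (\<lambda>x. block x i)"
  by (simp add: linear_conv_bounded_linear[symmetric] linear_iff)

lemma bounded_linear_avg: "bounded_linear avg"
  by (simp add: linear_conv_bounded_linear[symmetric] linear_iff)

lemma measurable_block [measurable]: "(\<lambda>x. block x i) \<in> borel_measurable borel"
  by (intro borel_measurable_continuous_onI linear_continuous_on bounded_linear_block)

lemma measurable_avg [measurable]: "avg \<in> borel_measurable borel"
  by (intro borel_measurable_continuous_onI linear_continuous_on bounded_linear_avg)

lemma measurable_matrix_vector_mult [measurable (raw)]:
  fixes D :: "'a \<Rightarrow> real^'n^'m" and y :: "'a \<Rightarrow> real^'n"
  assumes [measurable]: "D \<in> borel_measurable M" "y \<in> borel_measurable M"
  shows "(\<lambda>\<omega>. D \<omega> *v y \<omega>) \<in> borel_measurable M"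
proof -
  have "continuous_on UNIV (\<lambda>p :: (real^'n^'m) \<times> (real^'n). fst p *v snd p)"
    unfolding matrix_vector_mult_def by (intro continuous_intros)
  then have [measurable]: "(\<lambda>p :: (real^'n^'m) \<times> (real^'n). fst p *v snd p) \<in> borel_measurable borel"
    by (rule borel_measurable_continuous_onI)
  have "(\<lambda>\<omega>. (\<lambda>p. fst p *v snd p) (D \<omega>, y \<omega>)) \<in> borel_measurable M" by measurable
  then show ?thesis by simp
qed

lemma bounded_linear_matrix_mult_vector: "bounded_linear (\<lambda>D :: real^'n^'m. D *v y)"
  by (simp add: linear_conv_bounded_linear[symmetric] linear_iff matrix_vector_mult_add_rdistrib scaleR_matrix_vector_assoc)

lemma lagrangian_gradient_eq:
  "lagrangian_gradient \<alpha> \<eta> \<gamma> A f (D ** A) x l = stacked_gradient f x + (\<eta> / \<alpha>) *\<^sub>R (transpose A *v l)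
     + (\<gamma> / \<alpha>) *\<^sub>R (transpose A *v (D *v (A *v x)))"
  by (simp add: lagrangian_gradient_def matrix_vector_mul_assoc)

lemma measurable_fst_borel [measurable]: "fst \<in> borel_measurable (borel :: ('a::second_countable_topology \<times> 'b::second_countable_topology) measure)"
  by (simp flip: borel_prod)

lemma measurable_snd_borel [measurable]: "snd \<in> borel_measurable (borel :: ('a::second_countable_topology \<times> 'b::second_countable_topology) measure)"
  by (simp flip: borel_prod)

text \<open>Passage from the extended-real estimate to integrability and a bound on the Bochner integral.\<close>

lemma integral_le_of_scaled_nn_integral:
  fixes h :: "'a \<Rightarrow> real"
  assumes [measurable]: "h \<in> borel_measurable M" and nn: "\<And>x. 0 \<le> h x" and k: "0 < k" "0 < t"
    and le: "ennreal t * (\<integral>\<^sup>+x. ennreal (k * h x) \<partial>M) \<le> ennreal B" and B: "0 \<le> B"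
  shows "integrable M h" "(LINT x|M. h x) \<le> B / (t * k)"
proof -
  have "ennreal t * (\<integral>\<^sup>+x. ennreal (k * h x) \<partial>M) = ennreal (t * k) * (\<integral>\<^sup>+x. ennreal (h x) \<partial>M)"
    using k nn by (simp add: ennreal_mult nn_integral_cmult mult.assoc)
  then have 1: "ennreal (t * k) * (\<integral>\<^sup>+x. ennreal (h x) \<partial>M) \<le> ennreal B" using le by simp
  have "(\<integral>\<^sup>+x. ennreal (h x) \<partial>M) < \<infinity>"
  proof (rule ccontr)
    assume "\<not> (\<integral>\<^sup>+x. ennreal (h x) \<partial>M) < \<infinity>"
    then have "(\<integral>\<^sup>+x. ennreal (h x) \<partial>M) = \<top>" by (simp add: not_less top_unique)
    then show False using 1 k by (simp add: ennreal_mult_top top_unique)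
  qed
  then show i: "integrable M h" using nn by (intro integrableI_nonneg) auto
  have "ennreal (t * k * (LINT x|M. h x)) \<le> ennreal B"
    using 1 k nn i by (simp add: nn_integral_eq_integral ennreal_mult)
  then have "t * k * (LINT x|M. h x) \<le> B" using B by (simp add: ennreal_le_iff)
  then show "(LINT x|M. h x) \<le> B / (t * k)" using k by (simp add: pos_le_divide_eq mult.commute)
qed

section \<open>Setting of the algorithm\<close>

type_synonym ('n, 'm, 'd) state =
  "(real^('n \<times> 'd)) \<times> (real^('m \<times> 'd)) \<times> (real^('n \<times> 'd)) \<times> (real^('m \<times> 'd))"

text \<open>The hypotheses on the objectives, the graph and the samples for which one step is analysed; the
  process itself enters later. The edge index type is arbitrary here.\<close>

locale fspda_storm = storm_parameters \<alpha> \<eta> \<gamma> \<beta> a\<^sub>x a\<^sub>l L L\<^sub>s \<sigma>\<^sub>A \<rho>max \<rho>min \<rho>bmax a b c d e \<phi> g "real CARD('n)" S PP G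
  for \<alpha> \<eta> \<gamma> \<beta> a\<^sub>x a\<^sub>l L L\<^sub>s \<sigma>\<^sub>A \<rho>max \<rho>min \<rho>bmax a b c d e \<phi> g S PP G :: real +
  fixes A :: "real^('n::finite \<times> 'd::finite)^('m::finite \<times> 'd)"
    and P :: "'n \<Rightarrow> 's measure" and Pa :: "'a measure"
    and Im :: "'a \<Rightarrow> real^('m \<times> 'd)^('m \<times> 'd)" and R :: "real^('m \<times> 'd)^('m \<times> 'd)"
    and f :: "'n \<Rightarrow> real^'d \<Rightarrow> real" and fs :: "'n \<Rightarrow> real^'d \<Rightarrow> 's \<Rightarrow> real"
    and \<sigma> :: "'n \<Rightarrow> real" and fstar :: real
  assumes P_prob: "\<And>i. prob_space (P i)" and Pa_prob: "prob_space Pa"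
    and f_diff: "\<And>i y. f i differentiable (at y)"
    and fs_diff: "\<And>i s y. s \<in> space (P i) \<Longrightarrow> (\<lambda>z. fs i z s) differentiable (at y)"
    and fs_int: "\<And>i y. integrable (P i) (fs i y)"
    and grad_mean: "\<And>i y. integrable (P i) (\<lambda>s. gradient (\<lambda>z. fs i z s) y)"
      "\<And>i y. gradient (f i) y = (LINT s|P i. gradient (\<lambda>z. fs i z s) y)"
    and Im_meas: "Im \<in> borel_measurable Pa"
    and Im_binary: "\<And>s. s \<in> space Pa \<Longrightarrow> binary_diagonal (Im s)"
    and R_def: "R = (LINT s|Pa. Im s)"
    and L_smooth: "\<And>i y z. norm (gradient (f i) y - gradient (f i) z) \<le> L * norm (y - z)"
    and f_lower: "\<And>i y. f i y \<ge> fstar"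
    and ARA_bounds: "\<rho>min *\<^sub>R consensus \<preceq>\<^sub>L transpose A ** R ** A" "transpose A ** R ** A \<preceq>\<^sub>L \<rho>max *\<^sub>R consensus"
    and AA_upper: "transpose A ** A \<preceq>\<^sub>L \<rho>bmax *\<^sub>R consensus"
    and variance:
      "\<And>i y. integrable (P i) (\<lambda>s. (norm (gradient (\<lambda>z. fs i z s) y - gradient (f i) y))\<^sup>2)"
      "\<And>i y. (LINT s|P i. (norm (gradient (\<lambda>z. fs i z s) y - gradient (f i) y))\<^sup>2) \<le> (\<sigma> i)\<^sup>2"
    and graph_variance: "\<And>y. (LINT s|Pa. (norm (transpose A *v (Im s *v (A *v y))
        - (transpose A ** R ** A) *v y))\<^sup>2) \<le> \<sigma>\<^sub>A\<^sup>2 * (norm (consensus *v y))\<^sup>2"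
    and mean_smooth:
      "\<And>i y z. integrable (P i) (\<lambda>s. (norm (gradient (\<lambda>w. fs i w s) y - gradient (\<lambda>w. fs i w s) z))\<^sup>2)"
      "\<And>i y z. (LINT s|P i. (norm (gradient (\<lambda>w. fs i w s) y - gradient (\<lambda>w. fs i w s) z))\<^sup>2)
         \<le> L\<^sub>s\<^sup>2 * (norm (y - z))\<^sup>2"
begin

abbreviation "K \<equiv> consensus :: real^('n \<times> 'd)^('n \<times> 'd)"
definition "C = transpose A ** R ** A"
definition "Q = pinv C"
definition F where "F y = (1 / real CARD('n)) * (\<Sum>i\<in>UNIV. f i y)"
definition "\<sigma>b2 = (1 / real CARD('n)) * (\<Sum>i\<in>UNIV. (\<sigma> i)\<^sup>2)"
definition N :: "(('n \<Rightarrow> 's) \<times> 'a) measure" where "N = (\<Pi>\<^sub>M i\<in>UNIV. P i) \<Otimes>\<^sub>M Pa"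

sublocale C: consensus_pinched C \<rho>min \<rho>max
  using ARA_bounds rho by unfold_locales (auto simp: C_def)

sublocale Pi: prob_space "P i" for i by (rule P_prob)
sublocale Pa: prob_space Pa by (rule Pa_prob)
sublocale PiM: prob_space "\<Pi>\<^sub>M i\<in>UNIV. P i" by (rule prob_space_PiM) (rule P_prob)
sublocale N: pair_prob_space "\<Pi>\<^sub>M i\<in>UNIV. P i" Pa ..

sublocale NN: prob_space N unfolding N_def by unfold_locales

abbreviation "grads \<equiv> stacked_gradient f"

lemma consensus_dual: "K *v (transpose A *v l) = transpose A *v l"
  by (rule consensus_transpose_mult[OF AA_upper])

lemma avg_dual [simp]: "avg (transpose A *v l) = 0"
  by (metis avg_consensus consensus_dual)

lemma C_mult: "C *v x = transpose A *v (R *v (A *v x))"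
  by (simp add: C_def flip: matrix_vector_mul_assoc)

lemma avg_C [simp]: "avg (C *v x) = 0" by (simp add: C_mult)

lemma gradient_F: "gradient F y = (1 / real CARD('n)) *\<^sub>R (\<Sum>i\<in>UNIV. gradient (f i) y)"
  unfolding F_def using gradient_average[of f y "1 / real CARD('n)"] f_diff by simp

lemma avg_stacked_gradient: "avg (grads x) = (1 / real CARD('n)) *\<^sub>R (\<Sum>i\<in>UNIV. gradient (f i) (block x i))"
  by (simp add: avg_def stacked_gradient_def)

lemma F_lower: "fstar \<le> F y"
proof -
  have "(\<Sum>i\<in>(UNIV :: 'n set). fstar) \<le> (\<Sum>i\<in>UNIV. f i y)" by (intro sum_mono f_lower)
  then show ?thesis by (simp add: F_def field_simps)
qed

section \<open>The noise of one step\<close>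

text \<open>Replacing the expected graph matrix by the sampled one gives \<open>graph_noise\<close>. The gradient noise of one
  step is grouped so that the noise at the old point \<open>x\<close> carries the factor \<open>a\<^sub>x\<close> and the rest is a centred
  gradient difference between \<open>x\<close> and the new point \<open>x'\<close>.\<close>

definition graph_noise :: "'a \<Rightarrow> real^('n \<times> 'd) \<Rightarrow> real^('n \<times> 'd)" where
  "graph_noise s y = transpose A *v (Im s *v (A *v y)) - C *v y"

definition sample_gradient :: "('n \<Rightarrow> 's) \<Rightarrow> real^('n \<times> 'd) \<Rightarrow> real^('n \<times> 'd)" where
  "sample_gradient p x = stack (\<lambda>i. gradient (\<lambda>z. fs i z (p i)) (block x i))"

definition gradient_noise :: "('n \<Rightarrow> 's) \<Rightarrow> real^('n \<times> 'd) \<Rightarrow> real^('n \<times> 'd) \<Rightarrow> real^('n \<times> 'd)" where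
  "gradient_noise p x x' = a\<^sub>x *\<^sub>R (sample_gradient p x - grads x)
     + ((sample_gradient p x' - sample_gradient p x) - (grads x' - grads x))"

lemma graph_noise_linear: "graph_noise s (k *\<^sub>R y + y') = k *\<^sub>R graph_noise s y + graph_noise s y'"
  by (simp add: graph_noise_def matrix_vector_right_distrib matrix_vector_mult_scaleR algebra_simps)

lemma avg_graph_noise [simp]: "avg (graph_noise s y) = 0" by (simp add: graph_noise_def)

lemma norm_masked_le: "s \<in> space Pa \<Longrightarrow> norm (transpose A *v (Im s *v (A *v y))) \<le> \<rho>bmax * norm (K *v y)"
  using norm_transpose_mask_le[OF AA_upper Im_binary] rho by simp

lemma masked_integrable: "integrable Pa (\<lambda>s. transpose A *v (Im s *v (A *v y)))"
proof (rule Pa.integrable_const_bound)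
  show "AE s in Pa. norm (transpose A *v (Im s *v (A *v y))) \<le> \<rho>bmax * norm (K *v y)"
    using norm_masked_le by (intro AE_I2)
qed (use Im_meas in measurable)

lemma mask_integrable: "integrable Pa Im"
proof (rule Pa.integrable_const_bound[where B="real CARD('m \<times> 'd)"])
  show "AE s in Pa. norm (Im s) \<le> real CARD('m \<times> 'd)"
  proof (intro AE_I2)
    fix s assume s: "s \<in> space Pa"
    have off: "Im s $ p $ q = 0" if "p \<noteq> q" for p q
      using Im_binary[OF s] that unfolding binary_diagonal_def by blast
    have diag: "Im s $ p $ p = 0 \<or> Im s $ p $ p = 1" for p
      using Im_binary[OF s] unfolding binary_diagonal_def by blast
    have "norm (Im s $ p) \<le> 1" for p
    proof -
      have "norm (Im s $ p) \<le> (\<Sum>q\<in>UNIV. \<bar>Im s $ p $ q\<bar>)" by (rule norm_le_l1_cart)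
      also have "\<dots> = (\<Sum>q\<in>UNIV. if q = p then \<bar>Im s $ p $ p\<bar> else 0)"
        by (rule sum.cong) (use off[of p] in force)+
      also have "\<dots> \<le> 1" using diag[of p] by auto
      finally show ?thesis .
    qed
    then have "(\<Sum>p\<in>UNIV. norm (Im s $ p)) \<le> (\<Sum>p\<in>(UNIV :: ('m \<times> 'd) set). 1)" by (intro sum_mono)
    moreover have "norm (Im s) \<le> (\<Sum>p\<in>UNIV. norm (Im s $ p))" unfolding norm_vec_def[of "Im s"] by (rule L2_set_le_sum) simp
    ultimately show "norm (Im s) \<le> real CARD('m \<times> 'd)" by simp
  qed
qed (rule Im_meas)

lemma masked_mean: "(LINT s|Pa. transpose A *v (Im s *v (A *v y))) = C *v y"
proof -
  have "bounded_linear (\<lambda>D. transpose A *v (D *v (A *v y)))"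
    by (rule bounded_linear_compose[OF matrix_vector_mul_bounded_linear bounded_linear_matrix_mult_vector])
  from integral_bounded_linear[OF this mask_integrable] show ?thesis unfolding C_mult R_def[symmetric] .
qed

lemma graph_noise_meas [measurable]: "(\<lambda>s. graph_noise s y) \<in> borel_measurable Pa"
  unfolding graph_noise_def using Im_meas by measurable

lemma graph_noise_mean: "integrable Pa (\<lambda>s. graph_noise s y)" "(LINT s|Pa. graph_noise s y) = 0"
  unfolding graph_noise_def using masked_integrable masked_mean by (simp_all add: Pa.prob_space)

text \<open>Centring does not increase the second moment, which gives the bound with \<open>\<rho>bmax\<close> beside the assumed one.\<close>

lemma graph_noise_sq:
  "integrable Pa (\<lambda>s. (norm (graph_noise s y))\<^sup>2)"
  "(LINT s|Pa. (norm (graph_noise s y))\<^sup>2) \<le> \<sigma>\<^sub>A\<^sup>2 * (norm (K *v y))\<^sup>2"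
  "(LINT s|Pa. (norm (graph_noise s y))\<^sup>2) \<le> \<rho>bmax\<^sup>2 * (norm (K *v y))\<^sup>2"
proof -
  let ?Z = "\<lambda>s. transpose A *v (Im s *v (A *v y))"
  have b: "(norm (?Z s))\<^sup>2 \<le> \<rho>bmax\<^sup>2 * (norm (K *v y))\<^sup>2" if "s \<in> space Pa" for s
    using power_mono[OF norm_masked_le[OF that, of y], of 2] by (simp add: power_mult_distrib)
  have i: "integrable Pa (\<lambda>s. (norm (?Z s))\<^sup>2)"
  proof (rule Pa.integrable_const_bound)
    show "AE s in Pa. norm ((norm (?Z s))\<^sup>2) \<le> \<rho>bmax\<^sup>2 * (norm (K *v y))\<^sup>2"
      using b by (intro AE_I2) simp
  qed (use Im_meas in measurable)
  note m = Pa.centered_second_moment_le[OF masked_integrable i, unfolded masked_mean, folded graph_noise_def]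
  show "integrable Pa (\<lambda>s. (norm (graph_noise s y))\<^sup>2)" by (rule m)
  show "(LINT s|Pa. (norm (graph_noise s y))\<^sup>2) \<le> \<sigma>\<^sub>A\<^sup>2 * (norm (K *v y))\<^sup>2"
    using graph_variance[of y] by (simp add: graph_noise_def C_def)
  have "(LINT s|Pa. (norm (?Z s))\<^sup>2) \<le> (LINT s|Pa. \<rho>bmax\<^sup>2 * (norm (K *v y))\<^sup>2)"
    using i b by (intro integral_mono) auto
  then show "(LINT s|Pa. (norm (graph_noise s y))\<^sup>2) \<le> \<rho>bmax\<^sup>2 * (norm (K *v y))\<^sup>2"
    using m(2) by (simp add: Pa.prob_space)
qed

lemma graph_noise_q: "(LINT s|Pa. (norm (graph_noise s y))\<^sup>2) \<le> q * (norm (K *v y))\<^sup>2"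
  using graph_noise_sq(2,3)[of y] by (auto simp: q_def min_def)

lemma graph_noise_combination:
  assumes "\<And>y. (LINT s|Pa. (norm (graph_noise s y))\<^sup>2) \<le> k' * (norm (K *v y))\<^sup>2"
  shows "(LINT s|Pa. (norm (graph_noise s (k *\<^sub>R y + y')))\<^sup>2)
      \<le> 2 * (k\<^sup>2 * \<sigma>\<^sub>A\<^sup>2 * (norm (K *v y))\<^sup>2) + 2 * (k' * (norm (K *v y'))\<^sup>2)"
proof -
  have i: "integrable Pa (\<lambda>s. (norm (graph_noise s (k *\<^sub>R y + y')))\<^sup>2)" by (rule graph_noise_sq)
  have "(LINT s|Pa. (norm (graph_noise s (k *\<^sub>R y + y')))\<^sup>2)
     \<le> (LINT s|Pa. 2 * (k\<^sup>2 * (norm (graph_noise s y))\<^sup>2) + 2 * (norm (graph_noise s y'))\<^sup>2)"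
  proof (rule integral_mono[OF i])
    fix s show "(norm (graph_noise s (k *\<^sub>R y + y')))\<^sup>2 \<le> 2 * (k\<^sup>2 * (norm (graph_noise s y))\<^sup>2) + 2 * (norm (graph_noise s y'))\<^sup>2"
      using norm_add_sq_le2[of "k *\<^sub>R graph_noise s y" "graph_noise s y'"]
      by (simp add: graph_noise_linear power_mult_distrib)
  qed (use graph_noise_sq(1) in simp)
  also have "\<dots> = 2 * (k\<^sup>2 * (LINT s|Pa. (norm (graph_noise s y))\<^sup>2)) + 2 * (LINT s|Pa. (norm (graph_noise s y'))\<^sup>2)"
    using graph_noise_sq(1) by simp
  also have "\<dots> \<le> 2 * (k\<^sup>2 * (\<sigma>\<^sub>A\<^sup>2 * (norm (K *v y))\<^sup>2)) + 2 * (k' * (norm (K *v y'))\<^sup>2)"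
    using graph_noise_sq(2)[of y] assms[of y'] by (intro add_mono mult_left_mono) auto
  finally show "(LINT s|Pa. (norm (graph_noise s (k *\<^sub>R y + y')))\<^sup>2)
      \<le> 2 * (k\<^sup>2 * \<sigma>\<^sub>A\<^sup>2 * (norm (K *v y))\<^sup>2) + 2 * (k' * (norm (K *v y'))\<^sup>2)" by (simp add: mult.assoc)
qed

definition block_noise :: "'n \<Rightarrow> real^'d \<Rightarrow> real^'d \<Rightarrow> 's \<Rightarrow> real^'d" where
  "block_noise i y y' s = a\<^sub>x *\<^sub>R (gradient (\<lambda>z. fs i z s) y - gradient (f i) y)
     + ((gradient (\<lambda>z. fs i z s) y' - gradient (\<lambda>z. fs i z s) y) - (gradient (f i) y' - gradient (f i) y))"

lemma gradient_noise_blocks: "gradient_noise p x x' = stack (\<lambda>i. block_noise i (block x i) (block x' i) (p i))"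
  by (rule block_eqI) (simp add: gradient_noise_def sample_gradient_def stacked_gradient_def block_noise_def)

lemma block_noise_mean: "integrable (P i) (block_noise i y y')" "(LINT s|P i. block_noise i y y' s) = 0"
  unfolding block_noise_def using grad_mean(1) by (simp_all add: grad_mean(2) Pi.prob_space)

text \<open>The gradient difference is centred by its mean, so its variance is at most its second moment, which
  mean-square smoothness bounds.\<close>

lemma block_noise_sq: "integrable (P i) (\<lambda>s. (norm (block_noise i y y' s))\<^sup>2)"
  "(LINT s|P i. (norm (block_noise i y y' s))\<^sup>2) \<le> 2 * a\<^sub>x\<^sup>2 * (\<sigma> i)\<^sup>2 + 2 * L\<^sub>s\<^sup>2 * (norm (y' - y))\<^sup>2"
proof -
  let ?D = "\<lambda>s. gradient (\<lambda>z. fs i z s) y' - gradient (\<lambda>z. fs i z s) y"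
  let ?V = "\<lambda>s. gradient (\<lambda>z. fs i z s) y - gradient (f i) y"
  have D: "integrable (P i) ?D" "(LINT s|P i. ?D s) = gradient (f i) y' - gradient (f i) y"
    using grad_mean by simp_all
  note m = Pi.centered_second_moment_le[OF D(1) mean_smooth(1), unfolded D(2)]
  let ?B = "\<lambda>s. 2 * (a\<^sub>x\<^sup>2 * (norm (?V s))\<^sup>2) + 2 * (norm (?D s - (gradient (f i) y' - gradient (f i) y)))\<^sup>2"
  have B: "integrable (P i) ?B" using m(1) variance(1)[of i y] by simp
  have le: "(norm (block_noise i y y' s))\<^sup>2 \<le> ?B s" for s
    using norm_add_sq_le2[of "a\<^sub>x *\<^sub>R ?V s" "?D s - (gradient (f i) y' - gradient (f i) y)"]
    by (simp add: block_noise_def power_mult_distrib)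
  have [measurable]: "block_noise i y y' \<in> borel_measurable (P i)" using block_noise_mean(1) by (rule borel_measurable_integrable)
  show i: "integrable (P i) (\<lambda>s. (norm (block_noise i y y' s))\<^sup>2)"
  proof (rule Bochner_Integration.integrable_bound[OF B])
    show "AE s in P i. norm ((norm (block_noise i y y' s))\<^sup>2) \<le> norm (?B s)"
      using le by (intro AE_I2) (auto intro: order_trans[OF _ abs_ge_self])
  qed measurable
  have "(LINT s|P i. (norm (block_noise i y y' s))\<^sup>2) \<le> (LINT s|P i. ?B s)"
    by (rule integral_mono[OF i B]) (rule le)
  also have "\<dots> = 2 * (a\<^sub>x\<^sup>2 * (LINT s|P i. (norm (?V s))\<^sup>2)) + 2 * (LINT s|P i. (norm (?D s - (gradient (f i) y' - gradient (f i) y)))\<^sup>2)"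
    using m(1) variance(1)[of i y] by simp
  also have "\<dots> \<le> 2 * (a\<^sub>x\<^sup>2 * (\<sigma> i)\<^sup>2) + 2 * (L\<^sub>s\<^sup>2 * (norm (y' - y))\<^sup>2)"
    using variance(2)[of i y] order_trans[OF m(2) mean_smooth(2)] by (intro add_mono mult_left_mono) auto
  finally show "(LINT s|P i. (norm (block_noise i y y' s))\<^sup>2) \<le> 2 * a\<^sub>x\<^sup>2 * (\<sigma> i)\<^sup>2 + 2 * L\<^sub>s\<^sup>2 * (norm (y' - y))\<^sup>2" by simp
qed

lemma distr_sample: "distr N (P i) (\<lambda>\<omega>. fst \<omega> i) = P i"
proof -
  have "distr N (P i) (\<lambda>\<omega>. fst \<omega> i) = distr (distr N (\<Pi>\<^sub>M i\<in>UNIV. P i) fst) (P i) (\<lambda>p. p i)"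
    unfolding N_def by (subst distr_distr) (auto simp: comp_def)
  also have "distr N (\<Pi>\<^sub>M i\<in>UNIV. P i) fst = (\<Pi>\<^sub>M i\<in>UNIV. P i)"
    unfolding N_def by (rule Pa.distr_pair_fst)
  finally show ?thesis using distr_PiM_component[of UNIV P i] P_prob by simp
qed

lemma distr_graph: "distr N Pa snd = Pa"
proof -
  have "distr N Pa snd = distr (distr (Pa \<Otimes>\<^sub>M (\<Pi>\<^sub>M i\<in>UNIV. P i)) N (\<lambda>(x, y). (y, x))) Pa snd"
    unfolding N_def by (subst N.distr_pair_swap) simp
  also have "\<dots> = distr (Pa \<Otimes>\<^sub>M (\<Pi>\<^sub>M i\<in>UNIV. P i)) Pa fst"
    unfolding N_def by (subst distr_distr) (auto simp: comp_def split_beta)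
  also have "\<dots> = Pa" by (rule PiM.distr_pair_fst)
  finally show ?thesis .
qed

lemma fst_sample_measurable [measurable]: "(\<lambda>\<omega>. fst \<omega> i) \<in> measurable N (P i)"
  unfolding N_def by measurable

lemma snd_sample_measurable [measurable]: "snd \<in> measurable N Pa"
  unfolding N_def by measurable

lemma marginal_gradient:
  fixes h :: "'s \<Rightarrow> 'v::{banach, second_countable_topology}"
  assumes "integrable (P i) h"
  shows "integrable N (\<lambda>\<omega>. h (fst \<omega> i))" "(LINT \<omega>|N. h (fst \<omega> i)) = (LINT s|P i. h s)"
proof -
  have h: "integrable (distr N (P i) (\<lambda>\<omega>. fst \<omega> i)) h" using assms by (simp add: distr_sample)
  show "integrable N (\<lambda>\<omega>. h (fst \<omega> i))" by (rule integrable_distr[OF fst_sample_measurable h])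
  have "(LINT s|distr N (P i) (\<lambda>\<omega>. fst \<omega> i). h s) = (LINT \<omega>|N. h (fst \<omega> i))"
    using assms by (intro integral_distr) auto
  then show "(LINT \<omega>|N. h (fst \<omega> i)) = (LINT s|P i. h s)" by (simp add: distr_sample)
qed

lemma marginal_graph:
  fixes h :: "'a \<Rightarrow> 'v::{banach, second_countable_topology}"
  assumes "integrable Pa h"
  shows "integrable N (\<lambda>\<omega>. h (snd \<omega>))" "(LINT \<omega>|N. h (snd \<omega>)) = (LINT s|Pa. h s)"
proof -
  have h: "integrable (distr N Pa snd) h" using assms by (simp add: distr_graph)
  show "integrable N (\<lambda>\<omega>. h (snd \<omega>))" by (rule integrable_distr[OF snd_sample_measurable h])
  have "(LINT s|distr N Pa snd. h s) = (LINT \<omega>|N. h (snd \<omega>))"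
    using assms by (intro integral_distr) auto
  then show "(LINT \<omega>|N. h (snd \<omega>)) = (LINT s|Pa. h s)" by (simp add: distr_graph)
qed

text \<open>Only the marginal law of each agent's sample enters, since the squared norm is a sum over blocks.\<close>

lemma gradient_noise_moments:
  shows "integrable N (\<lambda>\<omega>. gradient_noise (fst \<omega>) x x')"
    "(LINT \<omega>|N. gradient_noise (fst \<omega>) x x') = 0"
    "integrable N (\<lambda>\<omega>. (norm (gradient_noise (fst \<omega>) x x'))\<^sup>2)"
    "(LINT \<omega>|N. (norm (gradient_noise (fst \<omega>) x x'))\<^sup>2) \<le> 2 * a\<^sub>x\<^sup>2 * (real CARD('n) * \<sigma>b2) + 2 * L\<^sub>s\<^sup>2 * (norm (x' - x))\<^sup>2"
proof -
  let ?b = "\<lambda>i. block_noise i (block x i) (block x' i)"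
  have i1: "integrable N (\<lambda>\<omega>. ?b i (fst \<omega> i))" for i by (rule marginal_gradient[OF block_noise_mean(1)])
  show "integrable N (\<lambda>\<omega>. gradient_noise (fst \<omega>) x x')"
    unfolding gradient_noise_blocks by (rule integral_stack(1)[OF i1])
  show "(LINT \<omega>|N. gradient_noise (fst \<omega>) x x') = 0"
    unfolding gradient_noise_blocks integral_stack(2)[OF i1] marginal_gradient(2)[OF block_noise_mean(1)] block_noise_mean(2)
    by (simp add: stack_def vec_eq_iff)
  have e: "(norm (gradient_noise p x x'))\<^sup>2 = (\<Sum>i\<in>UNIV. (norm (?b i (p i)))\<^sup>2)" for p
    unfolding gradient_noise_blocks by (simp add: norm_sq_blocks)
  have i2: "integrable N (\<lambda>\<omega>. (norm (?b i (fst \<omega> i)))\<^sup>2)" for i by (rule marginal_gradient[OF block_noise_sq(1)])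
  show "integrable N (\<lambda>\<omega>. (norm (gradient_noise (fst \<omega>) x x'))\<^sup>2)" unfolding e using i2 by simp
  have "(LINT \<omega>|N. (norm (gradient_noise (fst \<omega>) x x'))\<^sup>2) = (\<Sum>i\<in>UNIV. LINT s|P i. (norm (?b i s))\<^sup>2)"
    unfolding e using i2 marginal_gradient(2)[OF block_noise_sq(1)] by simp
  also have "\<dots> \<le> (\<Sum>i\<in>UNIV. 2 * a\<^sub>x\<^sup>2 * (\<sigma> i)\<^sup>2 + 2 * L\<^sub>s\<^sup>2 * (norm (block x' i - block x i))\<^sup>2)"
    by (intro sum_mono block_noise_sq(2))
  also have "\<dots> = 2 * a\<^sub>x\<^sup>2 * (real CARD('n) * \<sigma>b2) + 2 * L\<^sub>s\<^sup>2 * (norm (x' - x))\<^sup>2"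
    by (simp add: sum.distrib sum_distrib_left[symmetric] \<sigma>b2_def norm_sq_blocks)
  finally show "(LINT \<omega>|N. (norm (gradient_noise (fst \<omega>) x x'))\<^sup>2) \<le> 2 * a\<^sub>x\<^sup>2 * (real CARD('n) * \<sigma>b2) + 2 * L\<^sub>s\<^sup>2 * (norm (x' - x))\<^sup>2" .
qed

section \<open>One step of the algorithm\<close>

definition sampled_lagrangian_gradient :: "('n \<Rightarrow> 's) \<times> 'a \<Rightarrow> real^('n \<times> 'd) \<Rightarrow> real^('m \<times> 'd) \<Rightarrow> real^('n \<times> 'd)" where
  "sampled_lagrangian_gradient \<omega> x l =
     lagrangian_gradient \<alpha> \<eta> \<gamma> A (\<lambda>i y. fs i y (fst \<omega> i)) (Im (snd \<omega>) ** A) x l"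

definition step :: "('n, 'm, 'd) state \<times> (('n \<Rightarrow> 's) \<times> 'a)
    \<Rightarrow> ('n, 'm, 'd) state" where
  "step = (\<lambda>((x, l, mx, ml), \<omega>).
     (x - \<alpha> *\<^sub>R mx, l + \<beta> *\<^sub>R ml,
      sampled_lagrangian_gradient \<omega> (x - \<alpha> *\<^sub>R mx) (l + \<beta> *\<^sub>R ml)
        + (1 - a\<^sub>x) *\<^sub>R (mx - sampled_lagrangian_gradient \<omega> x l),
      (Im (snd \<omega>) ** A) *v (x - \<alpha> *\<^sub>R mx) + (1 - a\<^sub>l) *\<^sub>R (ml - (Im (snd \<omega>) ** A) *v x)))"

text \<open>The dual residual: at a stationary point with consensus its consensus part vanishes.\<close>

definition dual where "dual x l = transpose A *v l + (\<alpha> / \<eta>) *\<^sub>R grads (ones_kron *v avg x)"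
definition grad_error where
  "grad_error x l mx = mx - lagrangian_gradient \<alpha> \<eta> \<gamma> A f (R ** A) x l"
definition graph_error where "graph_error x ml = transpose A *v ml - C *v x"
definition quad where
  "quad x v = a * (norm (K *v x))\<^sup>2 + b * ((K *v v) \<bullet> (Q *v (K *v v))) + c * (norm (K *v v))\<^sup>2 + d * ((K *v x) \<bullet> (K *v v))"

text \<open>The potential: half of the quadratic form, the switched term \<open>\<langle>u, Q w\<rangle>\<close>, and the weight \<open>g'\<close> in place of
  \<open>g\<close>. Averaging the gradient error gives the error of the averaged momentum, as the graph terms have
  average zero.\<close>

definition potential where
  "potential = (\<lambda>(x, l, mx, ml). F (avg x) + (quad x (dual x l) / 2
     + shift * \<kappa> * a * ((K *v x) \<bullet> (Q *v graph_error x ml)))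
     + e * (norm (avg (grad_error x l mx)))\<^sup>2 + \<phi> * (norm (grad_error x l mx))\<^sup>2 + g' * (norm (graph_error x ml))\<^sup>2)"

lemma lagrangian_gradient_exact:
  "lagrangian_gradient \<alpha> \<eta> \<gamma> A f (R ** A) x l = grads x + (\<eta> / \<alpha>) *\<^sub>R (transpose A *v l) + (\<gamma> / \<alpha>) *\<^sub>R (C *v x)"
  unfolding lagrangian_gradient_eq C_mult ..

lemma sampled_lagrangian_gradient_eq:
  "sampled_lagrangian_gradient (p, s) x l = lagrangian_gradient \<alpha> \<eta> \<gamma> A f (R ** A) x l
     + (sample_gradient p x - grads x) + (\<gamma> / \<alpha>) *\<^sub>R graph_noise s x"
  unfolding sampled_lagrangian_gradient_def lagrangian_gradient_exact fst_conv snd_conv unfolding lagrangian_gradient_eq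
  by (simp add: sample_gradient_def stacked_gradient_def graph_noise_def algebra_simps)

text \<open>\<open>Q\<close> and the consensus projection commute and \<open>Q\<close> lives on its range, so the weighted norms only see
  consensus parts.\<close>

lemma weighted_form_eq_quad: "a * weighted_norm_sq K x + weighted_norm_sq (b *\<^sub>R Q + c *\<^sub>R K) v + d * weighted_inner K x v = quad x v"
proof -
  have "v \<bullet> (Q *v v) = (K *v v) \<bullet> (Q *v (K *v v))"
    by (metis C.consensus_pinv C.pinv_consensus Q_def consensus_inner)
  moreover have "x \<bullet> (K *v v) = (K *v x) \<bullet> (K *v v)" by (metis consensus_idem consensus_inner)
  moreover have "v \<bullet> ((c *\<^sub>R K) *v v) = c * (norm (K *v v))\<^sup>2" by (rule inner_pinched)
  ultimately show ?thesis
    by (simp add: quad_def weighted_norm_sq_consensus weighted_norm_sq_def[of "b *\<^sub>R Q + c *\<^sub>R K"] weighted_inner_def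
      matrix_vector_mult_add_rdistrib inner_add_right scaleR_matrix_vector_assoc[symmetric, of b])
qed

lemma Q_psd: "0 \<le> v \<bullet> (Q *v v)"
proof -
  have "v \<bullet> (Q *v v) = (K *v v) \<bullet> (Q *v v)" by (metis C.consensus_pinv Q_def consensus_inner)
  also have "\<dots> = (Q *v v) \<bullet> (C *v (Q *v v))" using C.mult_pinv[of v] by (simp add: Q_def inner_commute)
  finally show ?thesis using C.psd by simp
qed

lemma quad_lower: "a / 2 * (norm (K *v x))\<^sup>2 \<le> quad x v"
proof -
  have "- d * norm (K *v x) * norm (K *v v) \<le> a / 2 * (norm (K *v x))\<^sup>2 + c * (norm (K *v v))\<^sup>2"
    using d_sq_le pos by (intro weighted_young) auto
  moreover have "\<bar>(K *v x) \<bullet> (K *v v)\<bar> \<le> norm (K *v x) * norm (K *v v)" by (rule Cauchy_Schwarz_ineq2)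
  then have "d * (- ((K *v x) \<bullet> (K *v v))) \<le> d * (norm (K *v x) * norm (K *v v))"
    using pos by (intro mult_left_mono) auto
  moreover have "0 \<le> a / 2 * (norm (K *v x))\<^sup>2" using pos by simp
  moreover have "- d * norm (K *v x) * norm (K *v v) = - (d * (norm (K *v x) * norm (K *v v)))" by simp
  moreover have "d * norm (K *v x) * norm (K *v v) \<le> a / 2 * (norm (K *v x))\<^sup>2 + c * (norm (K *v v))\<^sup>2"
    using d_sq_le pos by (intro weighted_young) auto
  moreover have "0 \<le> b * ((K *v v) \<bullet> (Q *v (K *v v)))" using Q_psd pos by simp
  ultimately show ?thesis unfolding quad_def by (simp add: mult.assoc)
qed

lemma shift_term_le:
  "\<bar>shift * \<kappa> * a * ((K *v x) \<bullet> (Q *v w))\<bar> \<le> a / 4 * (norm (K *v x))\<^sup>2 + shift * (2 * (a / \<rho>min\<^sup>2)) * (norm w)\<^sup>2"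
proof -
  have s: "0 \<le> shift" "shift * shift = shift" using shift_01 by auto
  have k0: "0 \<le> shift * \<kappa> * a" using s kappa_bounds(1) pos by simp
  have "\<bar>(K *v x) \<bullet> (Q *v w)\<bar> \<le> norm (K *v x) * (norm w / \<rho>min)"
    using Cauchy_Schwarz_ineq2[of "K *v x" "Q *v w"] C.pinv_norm[of w] unfolding Q_def
    by (meson mult_left_mono norm_ge_zero order_trans)
  then have "shift * \<kappa> * a * \<bar>(K *v x) \<bullet> (Q *v w)\<bar> \<le> shift * \<kappa> * a * (norm (K *v x) * (norm w / \<rho>min))"
    using k0 by (rule mult_left_mono)
  also have "\<dots> = (shift * \<kappa> * a / \<rho>min) * norm (K *v x) * norm w" by simp
  also have "\<dots> \<le> a / 4 * (norm (K *v x))\<^sup>2 + shift * (2 * (a / \<rho>min\<^sup>2)) * (norm w)\<^sup>2"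
  proof (rule weighted_young)
    have "\<kappa> * \<kappa> \<le> 2" using mult_mono[OF kappa_bounds(3) kappa_bounds(3)] kappa_bounds(1) by simp
    have "(shift * \<kappa> * a / \<rho>min)\<^sup>2 = (\<kappa> * \<kappa>) * ((shift * shift) * (a / \<rho>min)\<^sup>2)" by (simp add: power2_eq_square)
    also have "\<dots> \<le> 2 * (shift * (a / \<rho>min)\<^sup>2)" unfolding s(2) using \<open>\<kappa> * \<kappa> \<le> 2\<close> s(1) by (intro mult_right_mono) auto
    also have "\<dots> = 4 * (a / 4) * (shift * (2 * (a / \<rho>min\<^sup>2)))" by (simp add: power2_eq_square)
    finally show "(shift * \<kappa> * a / \<rho>min)\<^sup>2 \<le> 4 * (a / 4) * (shift * (2 * (a / \<rho>min\<^sup>2)))" .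
  qed (use s pos in auto)
  finally show ?thesis unfolding abs_mult[of "shift * \<kappa> * a"] abs_of_nonneg[OF k0] .
qed

text \<open>Half of the quadratic form is at least \<open>a/4 |u|\<^sup>2\<close>, which together with the weights \<open>g'\<close> and \<open>g - g'\<close> of
  the graph error dominates the term \<open>\<langle>u, Q w\<rangle>\<close> from either side.\<close>

lemma potential_bounds:
  shows "fstar \<le> potential (x, l, mx, ml)"
    and "potential (x, l, mx, ml) \<le> F (avg x) + quad x (dual x l)
       + e * (norm (avg (grad_error x l mx)))\<^sup>2 + \<phi> * (norm (grad_error x l mx))\<^sup>2 + g * (norm (graph_error x ml))\<^sup>2"
proof -
  let ?w = "graph_error x ml"
  have q: "a / 2 * (norm (K *v x))\<^sup>2 \<le> quad x (dual x l)" by (rule quad_lower)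
  have s: "\<bar>shift * \<kappa> * a * ((K *v x) \<bullet> (Q *v ?w))\<bar> \<le> a / 4 * (norm (K *v x))\<^sup>2 + shift * (2 * (a / \<rho>min\<^sup>2)) * (norm ?w)\<^sup>2"
    by (rule shift_term_le)
  have g1: "shift * (2 * (a / \<rho>min\<^sup>2)) * (norm ?w)\<^sup>2 \<le> g' * (norm ?w)\<^sup>2"
    and g2: "shift * (2 * (a / \<rho>min\<^sup>2)) * (norm ?w)\<^sup>2 \<le> (g - g') * (norm ?w)\<^sup>2"
    using g'_bounds(4,5) by (intro mult_right_mono; simp)+
  have nn: "0 \<le> e * (norm (avg (grad_error x l mx)))\<^sup>2" "0 \<le> \<phi> * (norm (grad_error x l mx))\<^sup>2" using pos by simp_all
  show "fstar \<le> potential (x, l, mx, ml)"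
    unfolding potential_def split_conv using q s g1 nn F_lower[of "avg x"] by linarith
  have "(g - g') * (norm ?w)\<^sup>2 = g * (norm ?w)\<^sup>2 - g' * (norm ?w)\<^sup>2" by (rule left_diff_distrib)
  then show "potential (x, l, mx, ml) \<le> F (avg x) + quad x (dual x l)
       + e * (norm (avg (grad_error x l mx)))\<^sup>2 + \<phi> * (norm (grad_error x l mx))\<^sup>2 + g * (norm ?w)\<^sup>2"
    unfolding potential_def split_conv using q s g2 by linarith
qed

section \<open>Recursions of one step\<close>

lemma graph_noise_diff: "graph_noise s (y - y') = graph_noise s y - graph_noise s y'"
  using graph_noise_linear[of s "- 1" y' y] by (simp add: algebra_simps)

text \<open>The dual variable cancels between the sampled and the exact gradient of the Lagrangian, so only
  gradient and graph noise remain.\<close>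

lemma step_grad_error:
  assumes "step ((x, l, mx, ml), (p, s)) = (x', l', mx', ml')"
  shows "grad_error x' l' mx' = (1 - a\<^sub>x) *\<^sub>R grad_error x l mx
     + (gradient_noise p x x' + (\<gamma> / \<alpha>) *\<^sub>R graph_noise s (a\<^sub>x *\<^sub>R x + (x' - x)))"
proof -
  have mx': "mx' = sampled_lagrangian_gradient (p, s) x' l' + (1 - a\<^sub>x) *\<^sub>R (mx - sampled_lagrangian_gradient (p, s) x l)"
    using assms by (auto simp: step_def)
  show ?thesis
    unfolding grad_error_def mx' sampled_lagrangian_gradient_eq gradient_noise_def graph_noise_linear graph_noise_diff
    by (simp add: algebra_simps diff_divide_distrib)
qed

lemma step_graph_error:
  assumes "step ((x, l, mx, ml), (p, s)) = (x', l', mx', ml')"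
  shows "graph_error x' ml' = (1 - a\<^sub>l) *\<^sub>R graph_error x ml + graph_noise s (a\<^sub>l *\<^sub>R x + (x' - x))"
proof -
  have ml': "ml' = (Im s ** A) *v x' + (1 - a\<^sub>l) *\<^sub>R (ml - (Im s ** A) *v x)"
    using assms by (auto simp: step_def)
  show ?thesis
    unfolding graph_error_def ml' graph_noise_linear graph_noise_diff graph_noise_def
    by (simp add: matrix_vector_right_distrib matrix_vector_mult_diff_distrib matrix_vector_mult_scaleR
      matrix_vector_mul_assoc[symmetric] algebra_simps)
qed

lemma momentum_split: "mx = grad_error x l mx + grads x + (\<eta> / \<alpha>) *\<^sub>R (transpose A *v l) + (\<gamma> / \<alpha>) *\<^sub>R (C *v x)"
  by (simp add: grad_error_def lagrangian_gradient_exact)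

lemma avg_momentum: "avg mx = avg (grad_error x l mx) + avg (grads x)"
  by (subst momentum_split[of mx x l]) simp

text \<open>The exact gradient part of the momentum is rewritten around the average, which turns the dual
  variable into the dual residual.\<close>

lemma consensus_primal_step:
  "K *v (x - \<alpha> *\<^sub>R mx) = K *v x - \<gamma> *\<^sub>R (C *v (K *v x)) - \<eta> *\<^sub>R (K *v dual x l)
     - \<alpha> *\<^sub>R (K *v (grads x - grads (ones_kron *v avg x))) - \<alpha> *\<^sub>R (K *v grad_error x l mx)"
proof -
  have "K *v (x - \<alpha> *\<^sub>R mx) = K *v x - \<alpha> *\<^sub>R (K *v (grad_error x l mx + grads x + (\<eta> / \<alpha>) *\<^sub>R (transpose A *v l) + (\<gamma> / \<alpha>) *\<^sub>R (C *v x)))"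
    by (subst momentum_split[of mx x l]) (simp add: matrix_vector_mult_diff_distrib matrix_vector_mult_scaleR)
  then show ?thesis using pos
    by (simp add: dual_def matrix_vector_right_distrib matrix_vector_mult_diff_distrib matrix_vector_mult_scaleR
      consensus_dual C.consensus_mult_eq C.mult_consensus algebra_simps)
qed

lemma consensus_dual_step:
  "K *v dual x' (l + \<beta> *\<^sub>R ml) = K *v dual x l + \<beta> *\<^sub>R (C *v (K *v x)) + \<beta> *\<^sub>R graph_error x ml
     + (\<alpha> / \<eta>) *\<^sub>R (K *v (grads (ones_kron *v avg x') - grads (ones_kron *v avg x)))"
  by (simp add: dual_def graph_error_def matrix_vector_right_distrib matrix_vector_mult_diff_distrib matrix_vector_mult_scaleR
      consensus_dual C.mult_consensus algebra_simps)

lemma grads_dev: "norm (grads x - grads (ones_kron *v avg x)) \<le> L * norm (K *v x)"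
  using stacked_gradient_lipschitz[where f=f and x=x and y="ones_kron *v avg x", OF L_smooth] pos
  by (simp add: ones_kron_mult consensus_mult)

lemma grads_avg_dev: "(norm (grads (ones_kron *v y) - grads (ones_kron *v y')))\<^sup>2 \<le> real CARD('n) * L\<^sup>2 * (norm (y - y'))\<^sup>2"
proof -
  have "(norm (grads (ones_kron *v y) - grads (ones_kron *v y')))\<^sup>2 \<le> (L * norm (ones_kron *v y - ones_kron *v y' :: real^('n \<times> 'd)))\<^sup>2"
    using stacked_gradient_lipschitz[where f=f, OF L_smooth] pos by (intro power_mono) auto
  also have "\<dots> = L\<^sup>2 * (real CARD('n) * (norm (y - y'))\<^sup>2)"
    by (simp add: power_mult_distrib norm_sq_blocks ones_kron_mult)
  finally show ?thesis by (simp add: ac_simps)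
qed

text \<open>The descent lemma for the average, whose direction differs from the exact gradient by the averaged
  gradient error and by the gradient deviation due to disagreement.\<close>

lemma objective_step:
  "F (avg (x - \<alpha> *\<^sub>R mx)) \<le> F (avg x) - \<alpha> / 2 * (norm (gradient F (avg x)))\<^sup>2 - \<alpha> / 4 * (norm (avg mx))\<^sup>2
     + \<alpha> * (norm (avg (grad_error x l mx)))\<^sup>2 + \<alpha> * (L\<^sup>2 / real CARD('n) * (norm (K *v x))\<^sup>2)"
proof -
  let ?n = "real CARD('n)" and ?g = "gradient F (avg x)" and ?m = "avg mx" and ?\<epsilon> = "avg (grad_error x l mx)"
  have fi: "f i (avg x + - \<alpha> *\<^sub>R ?m) \<le> f i (avg x) + gradient (f i) (avg x) \<bullet> (- \<alpha> *\<^sub>R ?m) + L / 2 * (norm (- \<alpha> *\<^sub>R ?m))\<^sup>2" for i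
    by (rule smooth_upper_bound[OF f_diff L_smooth])
  have "(\<Sum>i\<in>UNIV. f i (avg x + - \<alpha> *\<^sub>R ?m)) \<le> (\<Sum>i\<in>UNIV. f i (avg x) + gradient (f i) (avg x) \<bullet> (- \<alpha> *\<^sub>R ?m) + L / 2 * (norm (- \<alpha> *\<^sub>R ?m))\<^sup>2)"
    by (intro sum_mono fi)
  also have "\<dots> = (\<Sum>i\<in>UNIV. f i (avg x)) - \<alpha> * ((\<Sum>i\<in>UNIV. gradient (f i) (avg x)) \<bullet> ?m) + ?n * (L / 2 * (\<alpha>\<^sup>2 * (norm ?m)\<^sup>2))"
    by (simp add: sum.distrib sum_subtractf inner_sum_left sum_distrib_left sum_negf power_mult_distrib)
  finally have "1 / ?n * (\<Sum>i\<in>UNIV. f i (avg x + - \<alpha> *\<^sub>R ?m)) \<le> 1 / ?n * ((\<Sum>i\<in>UNIV. f i (avg x))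
      - \<alpha> * ((\<Sum>i\<in>UNIV. gradient (f i) (avg x)) \<bullet> ?m) + ?n * (L / 2 * (\<alpha>\<^sup>2 * (norm ?m)\<^sup>2)))"
    by (intro mult_left_mono) auto
  also have "\<dots> = F (avg x) - \<alpha> * (?g \<bullet> ?m) + L / 2 * (\<alpha>\<^sup>2 * (norm ?m)\<^sup>2)"
    by (simp add: F_def gradient_F field_simps)
  finally have 1: "F (avg (x - \<alpha> *\<^sub>R mx)) \<le> F (avg x) - \<alpha> * (?g \<bullet> ?m) + L / 2 * (\<alpha>\<^sup>2 * (norm ?m)\<^sup>2)"
    by (simp add: F_def)
  have "(norm (?m - ?g))\<^sup>2 = (norm ?m)\<^sup>2 - 2 * (?g \<bullet> ?m) + (norm ?g)\<^sup>2"
    by (simp add: power2_norm_eq_inner inner_diff_left inner_diff_right inner_commute)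
  then have ip: "?g \<bullet> ?m = ((norm ?m)\<^sup>2 + (norm ?g)\<^sup>2 - (norm (?m - ?g))\<^sup>2) / 2" by simp
  have "(norm (?m - ?g))\<^sup>2 \<le> 2 * (norm ?\<epsilon>)\<^sup>2 + 2 * (L\<^sup>2 / ?n * (norm (K *v x))\<^sup>2)"
  proof -
    have "avg (grads (ones_kron *v avg x)) = ?g"
      by (simp add: avg_stacked_gradient gradient_F ones_kron_mult)
    then have e: "?m - ?g = ?\<epsilon> + avg (grads x - grads (ones_kron *v avg x))"
      using avg_momentum[of mx x l] by simp
    have "?n * (norm (avg (grads x - grads (ones_kron *v avg x))))\<^sup>2 \<le> (norm (grads x - grads (ones_kron *v avg x)))\<^sup>2"
      by (rule norm_avg_sq_le)
    also have "\<dots> \<le> (L * norm (K *v x))\<^sup>2" by (intro power_mono grads_dev) auto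
    finally have "(norm (avg (grads x - grads (ones_kron *v avg x))))\<^sup>2 \<le> L\<^sup>2 / ?n * (norm (K *v x))\<^sup>2"
      by (simp add: power_mult_distrib pos_le_divide_eq mult.commute)
    then show ?thesis unfolding e using norm_add_sq_le2[of ?\<epsilon> "avg (grads x - grads (ones_kron *v avg x))"] by linarith
  qed
  then have "\<alpha> / 2 * (norm (?m - ?g))\<^sup>2 \<le> \<alpha> / 2 * (2 * (norm ?\<epsilon>)\<^sup>2 + 2 * (L\<^sup>2 / ?n * (norm (K *v x))\<^sup>2))"
    using pos by (intro mult_left_mono) auto
  moreover have "(\<alpha> * L) * (\<alpha> / 2 * (norm ?m)\<^sup>2) \<le> 1/2 * (\<alpha> / 2 * (norm ?m)\<^sup>2)"
    using alpha_le_half pos by (intro mult_right_mono) auto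
  moreover have "F' \<le> F0 - \<alpha> / 2 * G' - \<alpha> / 4 * M' + \<alpha> * E' + \<alpha> * u"
    if "\<alpha> / 2 * D \<le> \<alpha> / 2 * (2 * E' + 2 * u)" "(\<alpha> * L) * (\<alpha> / 2 * M') \<le> 1/2 * (\<alpha> / 2 * M')"
      "F' \<le> F0 - \<alpha> * ((M' + G' - D) / 2) + L / 2 * (\<alpha>\<^sup>2 * M')" for F' F0 G' M' D E' u :: real
  proof -
    have "\<alpha> * ((M' + G' - D) / 2) = \<alpha> / 2 * M' + \<alpha> / 2 * G' - \<alpha> / 2 * D"
      by (simp add: algebra_simps add_divide_distrib diff_divide_distrib)
    moreover have "L / 2 * (\<alpha>\<^sup>2 * M') = (\<alpha> * L) * (\<alpha> / 2 * M')" by (simp add: power2_eq_square)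
    moreover have "\<alpha> / 2 * (2 * E' + 2 * u) = \<alpha> * E' + \<alpha> * u" by (simp add: distrib_left)
    ultimately show ?thesis using that by linarith
  qed
  ultimately show ?thesis using 1 unfolding ip by blast
qed

text \<open>The new \<open>x\<close> and \<open>l\<close> are constants for the integration, so only the three errors are random. Each is a
  constant plus centred noise (\<open>Z1\<close> from the gradients, \<open>Z2\<close> and \<open>Z3\<close> from the graph), its second moment
  splits accordingly, and the term linear in the graph error only sees its mean.\<close>

theorem one_step:
  fixes x mx :: "real^('n \<times> 'd)" and l ml :: "real^('m \<times> 'd)"
  defines "St \<equiv> (x, l, mx, ml)"
  shows "integrable N (\<lambda>\<omega>. potential (step (St, \<omega>)))"
    and "(LINT \<omega>|N. potential (step (St, \<omega>)))
       + (\<alpha> / 4 * (norm (gradient F (avg x)))\<^sup>2 + a * z / 8 * (norm (K *v x))\<^sup>2)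
      \<le> potential St + (e * (2 * a\<^sub>x\<^sup>2) + \<phi> * (4 * a\<^sub>x\<^sup>2 * real CARD('n))) * \<sigma>b2"
proof -
  let ?n = "real CARD('n)"
  define x' l' where "x' = x - \<alpha> *\<^sub>R mx" and "l' = l + \<beta> *\<^sub>R ml"
  define ex w where "ex = grad_error x l mx" and "w = graph_error x ml"
  define Z1 Z3 where "Z1 \<omega> = gradient_noise (fst \<omega>) x x'" and "Z3 \<omega> = graph_noise (snd \<omega>) (a\<^sub>l *\<^sub>R x + (x' - x))" for \<omega> :: "('n \<Rightarrow> 's) \<times> 'a"
  define Z2 where "Z2 \<omega> = (\<gamma> / \<alpha>) *\<^sub>R graph_noise (snd \<omega>) (a\<^sub>x *\<^sub>R x + (x' - x))" for \<omega> :: "('n \<Rightarrow> 's) \<times> 'a"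
  define q1 where "q1 = quad x' (dual x' l') / 2 + shift * \<kappa> * a * (1 - a\<^sub>l) * ((K *v x') \<bullet> (Q *v w))"
  let ?k = "shift * \<kappa> * a"

  have pot: "potential (step (St, \<omega>)) = F (avg x') + q1 + ?k * ((K *v x') \<bullet> (Q *v Z3 \<omega>))
      + e * (norm (avg ((1 - a\<^sub>x) *\<^sub>R ex) + avg (Z1 \<omega>)))\<^sup>2 + \<phi> * (norm ((1 - a\<^sub>x) *\<^sub>R ex + (Z1 \<omega> + Z2 \<omega>)))\<^sup>2
      + g' * (norm ((1 - a\<^sub>l) *\<^sub>R w + Z3 \<omega>))\<^sup>2" for \<omega>
  proof -
    obtain p s where ps: "\<omega> = (p, s)" by (cases \<omega>)
    obtain x'' l'' mx' ml' where st: "step (St, (p, s)) = (x'', l'', mx', ml')" by (metis prod_cases4)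
    have "x'' = x'" "l'' = l'" using st by (auto simp: step_def St_def x'_def l'_def)
    note st = st[unfolded this St_def]
    note ge = step_grad_error[OF st] and we = step_graph_error[OF st]
    have "avg (grad_error x' l' mx') = avg ((1 - a\<^sub>x) *\<^sub>R ex) + avg (Z1 (p, s))"
      unfolding ge by (simp add: ex_def Z1_def)
    moreover have "(K *v x') \<bullet> (Q *v graph_error x' ml') = (1 - a\<^sub>l) * ((K *v x') \<bullet> (Q *v w)) + (K *v x') \<bullet> (Q *v Z3 (p, s))"
      unfolding we by (simp add: w_def Z3_def matrix_vector_right_distrib matrix_vector_mult_scaleR inner_add_right)
    moreover have "grad_error x' l' mx' = (1 - a\<^sub>x) *\<^sub>R ex + (Z1 \<omega> + Z2 \<omega>)"
      unfolding ge by (simp add: ex_def Z1_def Z2_def ps)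
    moreover have "graph_error x' ml' = (1 - a\<^sub>l) *\<^sub>R w + Z3 \<omega>" unfolding we by (simp add: w_def Z3_def ps)
    ultimately show ?thesis unfolding ps St_def st potential_def split_conv
      by (simp only: q1_def ps distrib_left mult.assoc add.assoc)
  qed

  have H0: "(norm (x' - x))\<^sup>2 = ?n * \<alpha>\<^sup>2 * (norm (avg mx))\<^sup>2 + (norm (K *v x' - K *v x))\<^sup>2"
  proof -
    have "avg (x' - x) = - (\<alpha> *\<^sub>R avg mx)" by (simp only: x'_def avg_diff avg_scaleR) simp
    then have "(norm (avg (x' - x)))\<^sup>2 = \<alpha>\<^sup>2 * (norm (avg mx))\<^sup>2" by (simp add: power_mult_distrib)
    then show ?thesis using norm_sq_consensus[of "x' - x"]
      by (simp only: matrix_vector_mult_diff_distrib mult.assoc add.commute)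
  qed
  let ?H = "(norm (K *v x' - K *v x))\<^sup>2" and ?M = "(norm (avg mx))\<^sup>2" and ?U = "norm (K *v x)"

  have Z1i: "integrable N Z1" "(LINT \<omega>|N. Z1 \<omega>) = 0" "integrable N (\<lambda>\<omega>. (norm (Z1 \<omega>))\<^sup>2)"
    and Z1sq: "(LINT \<omega>|N. (norm (Z1 \<omega>))\<^sup>2) \<le> 2 * a\<^sub>x\<^sup>2 * (?n * \<sigma>b2) + 2 * L\<^sub>s\<^sup>2 * (?n * \<alpha>\<^sup>2 * ?M + ?H)"
    using gradient_noise_moments[of x x'] unfolding Z1_def[abs_def] H0 by auto
  have Kxx: "K *v (x' - x) = K *v x' - K *v x" by (simp add: matrix_vector_mult_diff_distrib)
  have gi: "integrable N (\<lambda>\<omega>. graph_noise (snd \<omega>) y)" "(LINT \<omega>|N. graph_noise (snd \<omega>) y) = 0"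
    "integrable N (\<lambda>\<omega>. (norm (graph_noise (snd \<omega>) y))\<^sup>2)" for y
    using marginal_graph[OF graph_noise_mean(1)] graph_noise_mean(2) marginal_graph[OF graph_noise_sq(1)] by auto
  have gsq: "(LINT \<omega>|N. (norm (graph_noise (snd \<omega>) y))\<^sup>2) = (LINT s|Pa. (norm (graph_noise s y))\<^sup>2)" for y
    by (rule marginal_graph(2)[OF graph_noise_sq(1)])
  have Z3i: "integrable N Z3" "(LINT \<omega>|N. Z3 \<omega>) = 0" "integrable N (\<lambda>\<omega>. (norm (Z3 \<omega>))\<^sup>2)"
    using gi by (simp_all add: Z3_def[abs_def])
  have Z3sq: "(LINT \<omega>|N. (norm (Z3 \<omega>))\<^sup>2) \<le> 2 * a\<^sub>l\<^sup>2 * \<sigma>\<^sub>A\<^sup>2 * ?U\<^sup>2 + 2 * (q * ?H)"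
    using graph_noise_combination[OF graph_noise_q, of a\<^sub>l x "x' - x"] unfolding Z3_def gsq Kxx by (simp add: mult.assoc)
  have Z2e: "(norm (Z2 \<omega>))\<^sup>2 = \<gamma>\<^sup>2 / \<alpha>\<^sup>2 * (norm (graph_noise (snd \<omega>) (a\<^sub>x *\<^sub>R x + (x' - x))))\<^sup>2" for \<omega>
    by (simp add: Z2_def power_mult_distrib power_divide)
  have Z2i: "integrable N Z2" "(LINT \<omega>|N. Z2 \<omega>) = 0" "integrable N (\<lambda>\<omega>. (norm (Z2 \<omega>))\<^sup>2)"
    unfolding Z2e using gi by (simp_all add: Z2_def[abs_def])
  have Z2sq: "(LINT \<omega>|N. (norm (Z2 \<omega>))\<^sup>2) \<le> \<gamma>\<^sup>2 / \<alpha>\<^sup>2 * (2 * (a\<^sub>x\<^sup>2 * \<sigma>\<^sub>A\<^sup>2 * ?U\<^sup>2) + 2 * (\<rho>bmax\<^sup>2 * ?H))"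
    using graph_noise_combination[OF graph_noise_sq(3), of a\<^sub>x x "x' - x"]
    unfolding Z2e integral_mult_right_zero gsq Kxx by (intro mult_left_mono) auto
  have Z12: "integrable N (\<lambda>\<omega>. Z1 \<omega> + Z2 \<omega>)" "(LINT \<omega>|N. Z1 \<omega> + Z2 \<omega>) = 0" using Z1i Z2i by simp_all
  have Z12i: "integrable N (\<lambda>\<omega>. (norm (Z1 \<omega> + Z2 \<omega>))\<^sup>2)"
  proof (rule Bochner_Integration.integrable_bound)
    show "integrable N (\<lambda>\<omega>. 2 * (norm (Z1 \<omega>))\<^sup>2 + 2 * (norm (Z2 \<omega>))\<^sup>2)" using Z1i(3) Z2i(3) by simp
    show "(\<lambda>\<omega>. (norm (Z1 \<omega> + Z2 \<omega>))\<^sup>2) \<in> borel_measurable N" using borel_measurable_integrable[OF Z12(1)] by measurable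
    show "AE \<omega> in N. norm ((norm (Z1 \<omega> + Z2 \<omega>))\<^sup>2) \<le> norm (2 * (norm (Z1 \<omega>))\<^sup>2 + 2 * (norm (Z2 \<omega>))\<^sup>2)"
      using norm_add_sq_le2[of "Z1 _" "Z2 _"] by (intro AE_I2) (auto intro: order_trans[OF _ abs_ge_self])
  qed
  have Z12sq: "(LINT \<omega>|N. (norm (Z1 \<omega> + Z2 \<omega>))\<^sup>2) \<le> 2 * (LINT \<omega>|N. (norm (Z1 \<omega>))\<^sup>2) + 2 * (LINT \<omega>|N. (norm (Z2 \<omega>))\<^sup>2)"
  proof -
    have "(LINT \<omega>|N. (norm (Z1 \<omega> + Z2 \<omega>))\<^sup>2) \<le> (LINT \<omega>|N. 2 * (norm (Z1 \<omega>))\<^sup>2 + 2 * (norm (Z2 \<omega>))\<^sup>2)"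
      using Z12i Z1i(3) Z2i(3) by (intro integral_mono norm_add_sq_le2) auto
    then show ?thesis using Z1i(3) Z2i(3) by simp
  qed
  have aZi: "integrable N (\<lambda>\<omega>. avg (Z1 \<omega>))" by (rule integrable_bounded_linear[OF bounded_linear_avg Z1i(1)])
  have aZ0: "(LINT \<omega>|N. avg (Z1 \<omega>)) = 0" using integral_bounded_linear[OF bounded_linear_avg Z1i(1)] Z1i(2) by simp
  have avg_le: "(norm (avg y))\<^sup>2 \<le> (norm y)\<^sup>2 / ?n" for y :: "real^('n \<times> 'd)"
    using norm_avg_sq_le[of y] by (simp add: pos_le_divide_eq mult.commute)
  have aZi2: "integrable N (\<lambda>\<omega>. (norm (avg (Z1 \<omega>)))\<^sup>2)"
  proof (rule Bochner_Integration.integrable_bound)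
    show "integrable N (\<lambda>\<omega>. (norm (Z1 \<omega>))\<^sup>2 / ?n)" using Z1i(3) by simp
    show "(\<lambda>\<omega>. (norm (avg (Z1 \<omega>)))\<^sup>2) \<in> borel_measurable N" using borel_measurable_integrable[OF aZi] by measurable
    show "AE \<omega> in N. norm ((norm (avg (Z1 \<omega>)))\<^sup>2) \<le> norm ((norm (Z1 \<omega>))\<^sup>2 / ?n)"
      using avg_le by (intro AE_I2) auto
  qed
  have aZsq: "(LINT \<omega>|N. (norm (avg (Z1 \<omega>)))\<^sup>2) \<le> (LINT \<omega>|N. (norm (Z1 \<omega>))\<^sup>2) / ?n"
  proof -
    have "(LINT \<omega>|N. (norm (avg (Z1 \<omega>)))\<^sup>2) \<le> (LINT \<omega>|N. (norm (Z1 \<omega>))\<^sup>2 / ?n)"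
      using aZi2 Z1i(3) avg_le by (intro integral_mono) auto
    then show ?thesis by simp
  qed
  note m1 = NN.second_moment_shift[OF aZi aZi2 aZ0, of "avg ((1 - a\<^sub>x) *\<^sub>R ex)"]
  note m2 = NN.second_moment_shift[OF Z12(1) Z12i Z12(2), of "(1 - a\<^sub>x) *\<^sub>R ex"]
  note m3 = NN.second_moment_shift[OF Z3i(1,3,2), of "(1 - a\<^sub>l) *\<^sub>R w"]
  have bl: "bounded_linear (\<lambda>y. (K *v x') \<bullet> (Q *v y))"
    by (rule bounded_linear_compose[OF bounded_linear_inner_right matrix_vector_mul_bounded_linear])
  have Qi: "integrable N (\<lambda>\<omega>. (K *v x') \<bullet> (Q *v Z3 \<omega>))" by (rule integrable_bounded_linear[OF bl Z3i(1)])
  have Q0: "(LINT \<omega>|N. (K *v x') \<bullet> (Q *v Z3 \<omega>)) = 0" using integral_bounded_linear[OF bl Z3i(1)] Z3i(2) by simp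

  show "integrable N (\<lambda>\<omega>. potential (step (St, \<omega>)))"
    unfolding pot using m1(1) m2(1) m3(1) Qi by simp
  let ?e2 = "(LINT \<omega>|N. (norm (avg ((1 - a\<^sub>x) *\<^sub>R ex) + avg (Z1 \<omega>)))\<^sup>2)"
    and ?x2 = "(LINT \<omega>|N. (norm ((1 - a\<^sub>x) *\<^sub>R ex + (Z1 \<omega> + Z2 \<omega>)))\<^sup>2)"
    and ?w2 = "(LINT \<omega>|N. (norm ((1 - a\<^sub>l) *\<^sub>R w + Z3 \<omega>))\<^sup>2)"
  have int: "(LINT \<omega>|N. potential (step (St, \<omega>))) = F (avg x') + q1 + e * ?e2 + \<phi> * ?x2 + g' * ?w2"
    unfolding pot using m1(1) m2(1) m3(1) Qi Q0 by (simp add: NN.prob_space)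
  let ?\<epsilon> = "norm (avg ex)"
  define q0 where "q0 = quad x (dual x l) / 2 + ?k * ((K *v x) \<bullet> (Q *v w))"
  have potS: "potential St = F (avg x) + q0 + e * ?\<epsilon>\<^sup>2 + \<phi> * (norm ex)\<^sup>2 + g' * (norm w)\<^sup>2"
    by (simp add: St_def potential_def q0_def ex_def w_def)

  let ?p = "K *v (grads x - grads (ones_kron *v avg x))" and ?v = "K *v dual x l"
  let ?\<delta> = "K *v (grads (ones_kron *v avg x') - grads (ones_kron *v avg x))"
  have Kx': "K *v x' = K *v x - \<gamma> *\<^sub>R (C *v (K *v x)) - \<eta> *\<^sub>R ?v - \<alpha> *\<^sub>R ?p - \<alpha> *\<^sub>R (K *v ex)"
    unfolding x'_def ex_def by (rule consensus_primal_step)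
  have Kv': "K *v dual x' l' = ?v + \<beta> *\<^sub>R (C *v (K *v x)) + \<beta> *\<^sub>R w + (\<alpha> / \<eta>) *\<^sub>R ?\<delta>"
    unfolding l'_def w_def by (rule consensus_dual_step)
  have p: "norm ?p \<le> L * ?U" using norm_consensus_le grads_dev by (rule order_trans)
  have \<delta>: "(norm ?\<delta>)\<^sup>2 \<le> ?n * L\<^sup>2 * \<alpha>\<^sup>2 * ?M"
  proof -
    have "(norm ?\<delta>)\<^sup>2 \<le> (norm (grads (ones_kron *v avg x') - grads (ones_kron *v avg x)))\<^sup>2"
      by (intro power_mono norm_consensus_le) auto
    also have "\<dots> \<le> ?n * L\<^sup>2 * (norm (avg x' - avg x))\<^sup>2" by (rule grads_avg_dev)
    finally show ?thesis by (simp add: x'_def power_mult_distrib mult.assoc)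
  qed
  have Cu: "\<rho>min * ?U\<^sup>2 \<le> (K *v x) \<bullet> (C *v (K *v x))" "(norm (C *v (K *v x)))\<^sup>2 \<le> \<rho>max * ((K *v x) \<bullet> (C *v (K *v x)))"
    using C.quad_lower[of "K *v x"] C.norm_sq_le[of "K *v x"] by simp_all
  have QC: "Q *v (C *v (K *v x)) = K *v x" using C.pinv_mult[of "K *v x"] by (simp add: Q_def)
  have Qsym: "y \<bullet> (Q *v y') = (Q *v y) \<bullet> y'" for y y' using C.pinv_sym by (simp add: Q_def)
  have Qn: "norm (Q *v y) \<le> norm y / \<rho>min" for y using C.pinv_norm by (simp add: Q_def)
  have quad_step: "q1 \<le> q0 - 4/10 * (a * z * ?U\<^sup>2) - 3/10 * (d * \<eta> * (norm ?v)\<^sup>2)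
       + 46/100 * (Y * (norm w)\<^sup>2) + 5/100 * (\<phi> * a\<^sub>x * (norm (K *v ex))\<^sup>2) + 11/100 * (\<alpha> * ?M)"
    unfolding q1_def q0_def quad_def
    by (rule quadratic_descent[where C="(*v) C" and Q="(*v) Q", OF _ Qsym Cu QC Qn p \<delta> _ Kx' Kv'])
      (simp_all add: matrix_vector_mul_linear)
  have H: "?H \<le> 6 * (\<gamma>\<^sup>2 * \<rho>max\<^sup>2 * ?U\<^sup>2) + 6 * (\<eta>\<^sup>2 * (norm ?v)\<^sup>2) + 6 * (\<alpha>\<^sup>2 * L\<^sup>2 * ?U\<^sup>2) + 2 * (\<alpha>\<^sup>2 * (norm (K *v ex))\<^sup>2)"
  proof -
    let ?r = "\<gamma> *\<^sub>R (C *v (K *v x)) + \<eta> *\<^sub>R ?v + \<alpha> *\<^sub>R ?p"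
    have "K *v x' - K *v x = - (?r + \<alpha> *\<^sub>R (K *v ex))" unfolding Kx' by simp
    then have "?H \<le> 2 * (norm ?r)\<^sup>2 + 2 * (norm (\<alpha> *\<^sub>R (K *v ex)))\<^sup>2"
      using norm_add_sq_le2[of ?r "\<alpha> *\<^sub>R (K *v ex)"] by (metis norm_minus_cancel)
    moreover have "(norm ?r)\<^sup>2 \<le> 3 * (norm (\<gamma> *\<^sub>R (C *v (K *v x))))\<^sup>2 + 3 * (norm (\<eta> *\<^sub>R ?v))\<^sup>2 + 3 * (norm (\<alpha> *\<^sub>R ?p))\<^sup>2"
      by (rule norm_add_sq_le3)
    moreover have "(norm (\<gamma> *\<^sub>R (C *v (K *v x))))\<^sup>2 \<le> \<gamma>\<^sup>2 * \<rho>max\<^sup>2 * ?U\<^sup>2"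
    proof -
      have "(norm (C *v (K *v x)))\<^sup>2 \<le> \<rho>max * (\<rho>max * ?U\<^sup>2)"
        using Cu(2) C.quad_upper[of "K *v x"] rmax_pos by (auto intro: order_trans mult_left_mono)
      then have "\<gamma>\<^sup>2 * (norm (C *v (K *v x)))\<^sup>2 \<le> \<gamma>\<^sup>2 * (\<rho>max * (\<rho>max * ?U\<^sup>2))" by (rule mult_left_mono) simp
      then show ?thesis by (simp add: power_mult_distrib power2_eq_square ac_simps)
    qed
    moreover have "(norm (\<alpha> *\<^sub>R ?p))\<^sup>2 \<le> \<alpha>\<^sup>2 * L\<^sup>2 * ?U\<^sup>2"
    proof -
      have "(norm ?p)\<^sup>2 \<le> (L * ?U)\<^sup>2" using p by (intro power_mono) auto
      then have "\<alpha>\<^sup>2 * (norm ?p)\<^sup>2 \<le> \<alpha>\<^sup>2 * (L * ?U)\<^sup>2" by (rule mult_left_mono) simp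
      then show ?thesis by (simp add: power_mult_distrib mult.assoc)
    qed
    ultimately show ?thesis by (simp add: power_mult_distrib)
  qed
  have F: "F (avg x') \<le> F (avg x) - \<alpha> / 2 * (norm (gradient F (avg x)))\<^sup>2 - \<alpha> / 4 * ?M + \<alpha> * ?\<epsilon>\<^sup>2 + \<alpha> * (L\<^sup>2 / ?n * ?U\<^sup>2)"
    unfolding x'_def ex_def by (rule objective_step)
  have E1: "?e2 \<le> (1 - a\<^sub>x)\<^sup>2 * ?\<epsilon>\<^sup>2 + 2 * a\<^sub>x\<^sup>2 * \<sigma>b2 + 2 * (L\<^sub>s\<^sup>2 / ?n * (?n * \<alpha>\<^sup>2 * ?M + ?H))"
  proof -
    have "(LINT \<omega>|N. (norm (Z1 \<omega>))\<^sup>2) / ?n \<le> (2 * a\<^sub>x\<^sup>2 * (?n * \<sigma>b2) + 2 * L\<^sub>s\<^sup>2 * (?n * \<alpha>\<^sup>2 * ?M + ?H)) / ?n"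
      using Z1sq by (rule divide_right_mono) simp
    also have "\<dots> = 2 * a\<^sub>x\<^sup>2 * \<sigma>b2 + 2 * (L\<^sub>s\<^sup>2 / ?n * (?n * \<alpha>\<^sup>2 * ?M + ?H))"
      by (simp add: add_divide_distrib)
    finally show ?thesis unfolding m1(2) using aZsq by (simp add: power_mult_distrib)
  qed
  have E2: "?x2 \<le> (1 - a\<^sub>x)\<^sup>2 * (norm ex)\<^sup>2 + 4 * a\<^sub>x\<^sup>2 * ?n * \<sigma>b2 + 4 * (L\<^sub>s\<^sup>2 * (?n * \<alpha>\<^sup>2 * ?M + ?H))
        + 4 * (\<gamma>\<^sup>2 / \<alpha>\<^sup>2 * (a\<^sub>x\<^sup>2 * \<sigma>\<^sub>A\<^sup>2 * ?U\<^sup>2 + \<rho>bmax\<^sup>2 * ?H))"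
  proof -
    have "(LINT \<omega>|N. (norm (Z1 \<omega> + Z2 \<omega>))\<^sup>2) \<le> 2 * (2 * a\<^sub>x\<^sup>2 * (?n * \<sigma>b2) + 2 * L\<^sub>s\<^sup>2 * (?n * \<alpha>\<^sup>2 * ?M + ?H))
      + 2 * (\<gamma>\<^sup>2 / \<alpha>\<^sup>2 * (2 * (a\<^sub>x\<^sup>2 * \<sigma>\<^sub>A\<^sup>2 * ?U\<^sup>2) + 2 * (\<rho>bmax\<^sup>2 * ?H)))"
      by (rule order_trans[OF Z12sq add_mono[OF mult_left_mono[OF Z1sq] mult_left_mono[OF Z2sq]]]) simp_all
    also have "\<dots> = 4 * a\<^sub>x\<^sup>2 * ?n * \<sigma>b2 + 4 * (L\<^sub>s\<^sup>2 * (?n * \<alpha>\<^sup>2 * ?M + ?H))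
        + 4 * (\<gamma>\<^sup>2 / \<alpha>\<^sup>2 * (a\<^sub>x\<^sup>2 * \<sigma>\<^sub>A\<^sup>2 * ?U\<^sup>2 + \<rho>bmax\<^sup>2 * ?H))"
      by (simp add: distrib_left)
    finally show ?thesis unfolding m2(2) by (simp add: power_mult_distrib)
  qed
  have E3: "?w2 \<le> (1 - a\<^sub>l)\<^sup>2 * (norm w)\<^sup>2 + 2 * a\<^sub>l\<^sup>2 * \<sigma>\<^sub>A\<^sup>2 * ?U\<^sup>2 + 2 * (q * ?H)"
    unfolding m3(2) using Z3sq by (simp add: power_mult_distrib)
  show "(LINT \<omega>|N. potential (step (St, \<omega>)))
       + (\<alpha> / 4 * (norm (gradient F (avg x)))\<^sup>2 + a * z / 8 * (norm (K *v x))\<^sup>2)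
      \<le> potential St + (e * (2 * a\<^sub>x\<^sup>2) + \<phi> * (4 * a\<^sub>x\<^sup>2 * ?n)) * \<sigma>b2"
    unfolding int potS
    by (rule drift_budget[OF _ norm_consensus_le _ _ _ H quad_step F E1 E2 E3]) simp_all
qed

section \<open>Bounds for the sampled iterate\<close>

lemma measurable_gradient_f [measurable]: "gradient (f i) \<in> borel_measurable borel"
proof (rule borel_measurable_continuous_onI)
  have "L-lipschitz_on UNIV (gradient (f i))"
    using L_smooth pos by (intro lipschitz_onI) (auto simp: dist_norm)
  then show "continuous_on UNIV (gradient (f i))" by (rule lipschitz_on_continuous_on)
qed

lemma measurable_grads [measurable]: "grads \<in> borel_measurable borel"
  unfolding stacked_gradient_def[abs_def] by measurable

lemma measurable_f [measurable]: "f i \<in> borel_measurable borel"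
  using f_diff by (intro borel_measurable_continuous_onI differentiable_imp_continuous_on)
    (auto simp: differentiable_on_def differentiable_at_withinI)

lemma measurable_F [measurable]: "F \<in> borel_measurable borel"
  unfolding F_def[abs_def] by measurable

lemma measurable_gradient_F [measurable]: "gradient F \<in> borel_measurable borel"
proof -
  have "gradient F = (\<lambda>y. (1 / real CARD('n)) *\<^sub>R (\<Sum>i\<in>UNIV. gradient (f i) y))" using gradient_F by blast
  then show ?thesis by simp
qed

lemma measurable_potential [measurable]: "potential \<in> borel_measurable borel"
  unfolding potential_def quad_def dual_def grad_error_def graph_error_def lagrangian_gradient_exact split_beta'
  by measurable

lemma measurable_sample_gradient [measurable (raw)]:
  assumes x [measurable]: "x \<in> borel_measurable M'" and \<omega> [measurable]: "\<omega> \<in> measurable M' N"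
  shows "(\<lambda>t. sample_gradient (fst (\<omega> t)) (x t)) \<in> borel_measurable M'"
  unfolding sample_gradient_def
proof (rule measurable_stack)
  fix i
  have g: "(\<lambda>(y, s). gradient (\<lambda>z. fs i z s) y) \<in> borel_measurable (borel \<Otimes>\<^sub>M P i)"
    using fs_int fs_diff by (intro gradient_sample_measurable borel_measurable_integrable) auto
  have "(\<lambda>t. fst (\<omega> t) i) \<in> measurable M' (P i)"
    by (rule measurable_compose[OF \<omega> fst_sample_measurable])
  then have "(\<lambda>t. (block (x t) i, fst (\<omega> t) i)) \<in> measurable M' (borel \<Otimes>\<^sub>M P i)" by measurable
  from measurable_compose[OF this g] show "(\<lambda>t. gradient (\<lambda>z. fs i z (fst (\<omega> t) i)) (block (x t) i)) \<in> borel_measurable M'"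
    by simp
qed

lemma measurable_mask [measurable (raw)]:
  assumes "\<omega> \<in> measurable M' N"
  shows "(\<lambda>t. Im (snd (\<omega> t))) \<in> borel_measurable M'"
  using measurable_compose[OF measurable_compose[OF assms snd_sample_measurable] Im_meas] by simp

lemma sampled_lagrangian_gradient_split:
  "sampled_lagrangian_gradient \<omega> x l = sample_gradient (fst \<omega>) x + (\<eta> / \<alpha>) *\<^sub>R (transpose A *v l)
     + (\<gamma> / \<alpha>) *\<^sub>R (transpose A *v (Im (snd \<omega>) *v (A *v x)))"
  by (simp add: sampled_lagrangian_gradient_def lagrangian_gradient_eq sample_gradient_def stacked_gradient_def)

text \<open>This is where joint measurability of the sampled gradients is used.\<close>

lemma measurable_step: "step \<in> measurable (borel \<Otimes>\<^sub>M N) borel"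
  unfolding step_def sampled_lagrangian_gradient_split split_beta' matrix_vector_mul_assoc[symmetric]
  by measurable

text \<open>The potential is shifted by its lower bound so that the estimate becomes one between extended
  nonnegative reals.\<close>

lemma drift:
  fixes St :: "('n, 'm, 'd) state"
  shows "(\<integral>\<^sup>+\<omega>. ennreal (potential (step (St, \<omega>)) - fstar) \<partial>N)
      + ennreal (\<alpha> / 4 * (norm (gradient F (avg (fst St))))\<^sup>2 + a * z / 8 * (norm (K *v fst St))\<^sup>2)
    \<le> ennreal (potential St - fstar) + ennreal ((e * (2 * a\<^sub>x\<^sup>2) + \<phi> * (4 * a\<^sub>x\<^sup>2 * real CARD('n))) * \<sigma>b2)"
proof -
  obtain x l mx ml where St: "St = (x, l, mx, ml)" by (metis prod_cases4)
  have low: "fstar \<le> potential s" for s by (cases s) (simp add: potential_bounds)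
  have i: "integrable N (\<lambda>\<omega>. potential (step (St, \<omega>)) - fstar)" using one_step(1) by (simp add: St)
  have az: "0 < a * z" using pos z_pos by simp
  have s0: "0 \<le> \<sigma>b2" by (simp add: \<sigma>b2_def sum_nonneg)
  let ?D = "\<alpha> / 4 * (norm (gradient F (avg x)))\<^sup>2 + a * z / 8 * (norm (K *v x))\<^sup>2"
    and ?c = "(e * (2 * a\<^sub>x\<^sup>2) + \<phi> * (4 * a\<^sub>x\<^sup>2 * real CARD('n))) * \<sigma>b2"
  have D0: "0 \<le> ?D" and c0: "0 \<le> ?c" using pos az s0 by simp_all
  have "(\<integral>\<^sup>+\<omega>. ennreal (potential (step (St, \<omega>)) - fstar) \<partial>N) = ennreal (LINT \<omega>|N. potential (step (St, \<omega>)) - fstar)"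
    using i low by (intro nn_integral_eq_integral) auto
  also have "(LINT \<omega>|N. potential (step (St, \<omega>)) - fstar) = (LINT \<omega>|N. potential (step (St, \<omega>))) - fstar"
    using one_step(1)[of x l mx ml] by (simp add: St NN.prob_space)
  finally have e: "(\<integral>\<^sup>+\<omega>. ennreal (potential (step (St, \<omega>)) - fstar) \<partial>N) = ennreal ((LINT \<omega>|N. potential (step (St, \<omega>))) - fstar)" .
  have "(LINT \<omega>|N. fstar) \<le> (LINT \<omega>|N. potential (step (St, \<omega>)))"
    using one_step(1) low by (intro integral_mono) (auto simp: St)
  then have p0: "0 \<le> (LINT \<omega>|N. potential (step (St, \<omega>))) - fstar" by (simp add: NN.prob_space)
  have "(LINT \<omega>|N. potential (step (St, \<omega>))) - fstar + ?D \<le> potential St - fstar + ?c"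
    using one_step(2)[of x l mx ml] by (simp add: St)
  then have "ennreal ((LINT \<omega>|N. potential (step (St, \<omega>))) - fstar + ?D) \<le> ennreal (potential St - fstar + ?c)"
    by (rule ennreal_leI)
  then show ?thesis unfolding e using p0 D0 c0 low[of St] by (simp add: St)
qed

theorem sampled_iterate_bounds:
  fixes M :: "'w measure" and Sq :: "nat \<Rightarrow> 'w \<Rightarrow> ('n, 'm, 'd) state" and \<Phi>\<^sub>0 :: "'w \<Rightarrow> real"
  assumes chain: "sampled_chain M N borel \<xi> Sq step"
    and tau: "distr M (count_space UNIV) \<tau> = measure_pmf (pmf_of_set {0..<T})" and T: "T \<ge> 1"
    and tau_indep: "indep_rv M (count_space UNIV) \<tau> (borel \<Otimes>\<^sub>M (\<Pi>\<^sub>M t\<in>{1..}. N)) (\<lambda>\<omega>. (Sq 0 \<omega>, \<lambda>t\<in>{1..}. \<xi> t \<omega>))"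
    and \<Phi>: "integrable M \<Phi>\<^sub>0" "\<And>\<omega>. \<omega> \<in> space M \<Longrightarrow> potential (Sq 0 \<omega>) \<le> \<Phi>\<^sub>0 \<omega>"
  defines "noise \<equiv> (e * (2 * a\<^sub>x\<^sup>2) + \<phi> * (4 * a\<^sub>x\<^sup>2 * real CARD('n))) * \<sigma>b2"
    and "B \<equiv> (LINT \<omega>|M. \<Phi>\<^sub>0 \<omega>) - fstar"
  shows "integrable M (\<lambda>\<omega>. (norm (gradient F (avg (fst (Sq (\<tau> \<omega>) \<omega>)))))\<^sup>2)"
    and "(LINT \<omega>|M. (norm (gradient F (avg (fst (Sq (\<tau> \<omega>) \<omega>)))))\<^sup>2) \<le> (B + real T * noise) / (real T * (\<alpha> / 4))"
    and "integrable M (\<lambda>\<omega>. (norm (K *v fst (Sq (\<tau> \<omega>) \<omega>)))\<^sup>2)"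
    and "(LINT \<omega>|M. (norm (K *v fst (Sq (\<tau> \<omega>) \<omega>)))\<^sup>2) \<le> (B + real T * noise) / (real T * (a * z / 8))"
proof -
  interpret sampled_chain M N borel \<xi> Sq step by (rule chain)
  have [measurable]: "\<tau> \<in> measurable M (count_space UNIV)" using tau_indep by (simp add: indep_rv_def)
  have Sm [measurable]: "(\<lambda>\<omega>. Sq (\<tau> \<omega>) \<omega>) \<in> borel_measurable M"
    by (rule measurable_compose_countable) auto
  have low: "fstar \<le> potential s" for s by (cases s) (simp add: potential_bounds)
  have f\<Phi>: "fstar \<le> \<Phi>\<^sub>0 \<omega>" if "\<omega> \<in> space M" for \<omega> by (rule order_trans[OF low \<Phi>(2)[OF that]])
  have az: "0 < a * z" using pos z_pos by simp
  have s0: "0 \<le> \<sigma>b2" by (simp add: \<sigma>b2_def sum_nonneg)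
  have noise0: "0 \<le> noise" using pos s0 by (simp add: noise_def)
  have "(\<integral>\<^sup>+\<omega>. ennreal (potential (Sq 0 \<omega>) - fstar) \<partial>M) \<le> (\<integral>\<^sup>+\<omega>. ennreal (\<Phi>\<^sub>0 \<omega> - fstar) \<partial>M)"
    using \<Phi>(2) by (intro nn_integral_mono ennreal_leI) auto
  also have "\<dots> = ennreal (LINT \<omega>|M. \<Phi>\<^sub>0 \<omega> - fstar)"
    using \<Phi>(1) f\<Phi> by (intro nn_integral_eq_integral) (auto intro!: AE_I2)
  also have "(LINT \<omega>|M. \<Phi>\<^sub>0 \<omega> - fstar) = B" using \<Phi>(1) by (simp add: B_def prob_space)
  finally have V0: "(\<integral>\<^sup>+\<omega>. ennreal (potential (Sq 0 \<omega>) - fstar) \<partial>M) \<le> ennreal B" .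
  have "(LINT \<omega>|M. fstar) \<le> (LINT \<omega>|M. \<Phi>\<^sub>0 \<omega>)"
    using \<Phi>(1) f\<Phi> by (intro integral_mono) auto
  then have B0: "0 \<le> B" by (simp add: B_def prob_space)
  define D where "D s = \<alpha> / 4 * (norm (gradient F (avg (fst s))))\<^sup>2 + a * z / 8 * (norm (K *v fst s))\<^sup>2"
    for s :: "('n, 'm, 'd) state"
  have [measurable]: "D \<in> borel_measurable borel" unfolding D_def[abs_def] by measurable
  have "of_nat T * (\<integral>\<^sup>+\<omega>. ennreal (D (Sq (\<tau> \<omega>) \<omega>)) \<partial>M) = (\<Sum>t<T. \<integral>\<^sup>+\<omega>. ennreal (D (Sq t \<omega>)) \<partial>M)"
    using tau_indep by (intro nn_integral_uniform_time[OF _ tau T]) (auto simp: path_def[abs_def])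
  also have "\<dots> \<le> (\<integral>\<^sup>+\<omega>. ennreal (potential (Sq 0 \<omega>) - fstar) \<partial>M) + of_nat T * ennreal noise"
  proof (rule telescoped_drift)
    show "(\<integral>\<^sup>+w. ennreal (potential (step (s, w)) - fstar) \<partial>N) + ennreal (D s) \<le> ennreal (potential s - fstar) + ennreal noise" for s
      unfolding D_def noise_def by (rule drift)
  qed measurable
  also have "\<dots> \<le> ennreal B + of_nat T * ennreal noise" using V0 by (rule add_right_mono)
  also have "\<dots> = ennreal (B + real T * noise)"
    using B0 noise0 by (simp add: ennreal_mult ennreal_of_nat_eq_real_of_nat)
  finally have total: "ennreal (real T) * (\<integral>\<^sup>+\<omega>. ennreal (D (Sq (\<tau> \<omega>) \<omega>)) \<partial>M) \<le> ennreal (B + real T * noise)"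
    by (simp add: ennreal_of_nat_eq_real_of_nat)
  have BT: "0 \<le> B + real T * noise" using B0 noise0 by simp
  have part: "ennreal (real T) * (\<integral>\<^sup>+\<omega>. ennreal (h (Sq (\<tau> \<omega>) \<omega>)) \<partial>M) \<le> ennreal (B + real T * noise)"
    if "\<And>s. h s \<le> D s" for h
    by (rule order_trans[OF mult_left_mono total]) (auto intro!: nn_integral_mono ennreal_leI that)
  have h1: "ennreal (real T) * (\<integral>\<^sup>+\<omega>. ennreal (\<alpha> / 4 * (norm (gradient F (avg (fst (Sq (\<tau> \<omega>) \<omega>)))))\<^sup>2) \<partial>M) \<le> ennreal (B + real T * noise)"
    by (rule part) (use az in \<open>simp add: D_def\<close>)
  have h2: "ennreal (real T) * (\<integral>\<^sup>+\<omega>. ennreal (a * z / 8 * (norm (K *v fst (Sq (\<tau> \<omega>) \<omega>)))\<^sup>2) \<partial>M) \<le> ennreal (B + real T * noise)"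
    by (rule part) (use pos in \<open>simp add: D_def\<close>)
  show "integrable M (\<lambda>\<omega>. (norm (gradient F (avg (fst (Sq (\<tau> \<omega>) \<omega>)))))\<^sup>2)"
    "(LINT \<omega>|M. (norm (gradient F (avg (fst (Sq (\<tau> \<omega>) \<omega>)))))\<^sup>2) \<le> (B + real T * noise) / (real T * (\<alpha> / 4))"
    by (rule integral_le_of_scaled_nn_integral[OF _ _ _ _ h1 BT]; use pos T in simp)+
  show "integrable M (\<lambda>\<omega>. (norm (K *v fst (Sq (\<tau> \<omega>) \<omega>)))\<^sup>2)"
    "(LINT \<omega>|M. (norm (K *v fst (Sq (\<tau> \<omega>) \<omega>)))\<^sup>2) \<le> (B + real T * noise) / (real T * (a * z / 8))"
    by (rule integral_le_of_scaled_nn_integral[OF _ _ _ _ h2 BT]; use az T in simp)+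
qed

end

theorem theorem3p9:
  fixes E :: "'n::finite set set"
    and inc :: "real^'n^('n set)"
    and A :: "real^('n \<times> 'd::finite)^('n set \<times> 'd)"
    and K Q :: "real^('n \<times> 'd)^('n \<times> 'd)"
    and P :: "'n \<Rightarrow> 's measure"
    and Pa :: "'a measure"
    and Im :: "'a \<Rightarrow> real^('n set \<times> 'd)^('n set \<times> 'd)"
    and R :: "real^('n set \<times> 'd)^('n set \<times> 'd)"
    and As :: "'a \<Rightarrow> real^('n \<times> 'd)^('n set \<times> 'd)"
    and f :: "'n \<Rightarrow> real^'d \<Rightarrow> real"
    and fs :: "'n \<Rightarrow> real^'d \<Rightarrow> 's \<Rightarrow> real"
    and F :: "real^'d \<Rightarrow> real"
    and M :: "'w measure"
    and N :: "(('n \<Rightarrow> 's) \<times> 'a) measure"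
    and \<xi> :: "nat \<Rightarrow> 'w \<Rightarrow> ('n \<Rightarrow> 's) \<times> 'a"
    and x m\<^sub>x :: "nat \<Rightarrow> 'w \<Rightarrow> real^('n \<times> 'd)"
    and l m\<^sub>l :: "nat \<Rightarrow> 'w \<Rightarrow> real^('n set \<times> 'd)"
    and v\<^sub>0 :: "'w \<Rightarrow> real^('n \<times> 'd)"
    and init :: "'w \<Rightarrow> (real^('n \<times> 'd)) \<times> (real^('n set \<times> 'd))
                     \<times> (real^('n \<times> 'd)) \<times> (real^('n set \<times> 'd))"
    and \<Phi>\<^sub>0 :: "'w \<Rightarrow> real"
    and \<tau> :: "'w \<Rightarrow> nat"
    and T :: nat
    and \<sigma> :: "'n \<Rightarrow> real"
    and \<alpha> \<eta> \<gamma> \<beta> a\<^sub>x a\<^sub>l L L\<^sub>s fstar \<sigma>\<^sub>A \<rho>max \<rho>min \<rho>bmax \<rho>bmin :: real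
    and a b c d e \<phi> g :: real
    and n S PP G \<sigma>b2 F0 :: real
  assumes n_def: "n = real CARD('n)"
    and graph: "simple_graph E" "connected_graph E"
    and incidence: "oriented_incidence E inc"
    and A_def: "A = kron inc (mat 1)"
    and K_def: "K = consensus"
    \<comment> \<open>distributions of the samples, local objectives\<close>
    and P_prob: "\<And>i. prob_space (P i)"
    and Pa_prob: "prob_space Pa"
    and f_C1: "\<And>i y. f i differentiable (at y)" "\<And>i. continuous_on UNIV (gradient (f i))"
    and fs_diff: "\<And>i s y. s \<in> space (P i) \<Longrightarrow> (\<lambda>z. fs i z s) differentiable (at y)"
    and f_mean: "\<And>i y. integrable (P i) (fs i y)"
      "\<And>i y. f i y = (LINT s|P i. fs i y s)"
    and grad_mean: "\<And>i y. integrable (P i) (\<lambda>s. gradient (\<lambda>z. fs i z s) y)"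
      "\<And>i y. gradient (f i) y = (LINT s|P i. gradient (\<lambda>z. fs i z s) y)"
    and F_def: "F = (\<lambda>y. (1 / n) * (\<Sum>i\<in>UNIV. f i y))"
    \<comment> \<open>random graph\<close>
    and Im_meas: "Im \<in> borel_measurable Pa"
    and Im_binary: "\<And>s. s \<in> space Pa \<Longrightarrow> binary_diagonal (Im s)"
    and As_def: "As = (\<lambda>s. Im s ** A)"
    and R_def: "R = (LINT s|Pa. Im s)"
    and R_pos: "\<And>u k. u \<in> E \<Longrightarrow> R $ (u, k) $ (u, k) > 0"
    and Q_def: "Q = pinv (transpose A ** R ** A)"
    \<comment> \<open>parameters\<close>
    and params: "\<alpha> > 0" "\<eta> > 0" "\<gamma> > 0" "\<beta> > 0" "a\<^sub>x \<in> {0..1}" "a\<^sub>l \<in> {0..1}"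
    \<comment> \<open>the algorithm and its randomness\<close>
    and M_prob: "prob_space M"
    and N_def: "N = (\<Pi>\<^sub>M i\<in>UNIV. P i) \<Otimes>\<^sub>M Pa"
    and xi_indep: "prob_space.indep_vars M (\<lambda>_. N) \<xi> {1..}"
    and xi_distr: "\<And>t. t \<ge> 1 \<Longrightarrow> distr M N (\<xi> t) = N"
    and init_def: "init = (\<lambda>\<omega>. (x 0 \<omega>, l 0 \<omega>, m\<^sub>x 0 \<omega>, m\<^sub>l 0 \<omega>))"
    and init_indep: "indep_rv M borel init (\<Pi>\<^sub>M t\<in>{1..}. N) (\<lambda>\<omega>. \<lambda>t\<in>{1..}. \<xi> t \<omega>)"
    and x_step: "\<And>t \<omega>. \<omega> \<in> space M \<Longrightarrow> x (Suc t) \<omega> = x t \<omega> - \<alpha> *\<^sub>R m\<^sub>x t \<omega>"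
    and l_step: "\<And>t \<omega>. \<omega> \<in> space M \<Longrightarrow> l (Suc t) \<omega> = l t \<omega> + \<beta> *\<^sub>R m\<^sub>l t \<omega>"
    and mx_step: "\<And>t \<omega>. \<omega> \<in> space M \<Longrightarrow> m\<^sub>x (Suc t) \<omega> =
        lagrangian_gradient \<alpha> \<eta> \<gamma> A (\<lambda>i y. fs i y (fst (\<xi> (Suc t) \<omega>) i))
          (As (snd (\<xi> (Suc t) \<omega>))) (x (Suc t) \<omega>) (l (Suc t) \<omega>)
        + (1 - a\<^sub>x) *\<^sub>R (m\<^sub>x t \<omega> -
            lagrangian_gradient \<alpha> \<eta> \<gamma> A (\<lambda>i y. fs i y (fst (\<xi> (Suc t) \<omega>) i))
              (As (snd (\<xi> (Suc t) \<omega>))) (x t \<omega>) (l t \<omega>))"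
    and ml_step: "\<And>t \<omega>. \<omega> \<in> space M \<Longrightarrow> m\<^sub>l (Suc t) \<omega> =
        As (snd (\<xi> (Suc t) \<omega>)) *v x (Suc t) \<omega>
        + (1 - a\<^sub>l) *\<^sub>R (m\<^sub>l t \<omega> - As (snd (\<xi> (Suc t) \<omega>)) *v x t \<omega>)"
    \<comment> \<open>(1)\<close>
    and L_pos: "L > 0"
    and L_smooth: "\<And>i y z. norm (gradient (f i) y - gradient (f i) z) \<le> L * norm (y - z)"
    and f_lower: "\<And>i y. f i y \<ge> fstar"
    \<comment> \<open>(2)\<close>
    and rho: "\<rho>max \<ge> \<rho>min" "\<rho>min > 0" "\<rho>bmax \<ge> \<rho>bmin" "\<rho>bmin > 0"
    and ARA_bounds: "\<rho>min *\<^sub>R K \<preceq>\<^sub>L transpose A ** R ** A"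
      "transpose A ** R ** A \<preceq>\<^sub>L \<rho>max *\<^sub>R K"
    and AA_bounds: "\<rho>bmin *\<^sub>R K \<preceq>\<^sub>L transpose A ** A"
      "transpose A ** A \<preceq>\<^sub>L \<rho>bmax *\<^sub>R K"
    \<comment> \<open>(3)\<close>
    and sigma_nonneg: "\<And>i. \<sigma> i \<ge> 0"
    and variance:
      "\<And>i y. integrable (P i) (\<lambda>s. (norm (gradient (\<lambda>z. fs i z s) y - gradient (f i) y))\<^sup>2)"
      "\<And>i y. (LINT s|P i. (norm (gradient (\<lambda>z. fs i z s) y - gradient (f i) y))\<^sup>2) \<le> (\<sigma> i)\<^sup>2"
    and sigmab2_def: "\<sigma>b2 = (1 / n) * (\<Sum>i\<in>UNIV. (\<sigma> i)\<^sup>2)"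
    \<comment> \<open>(4); the integrand is a bounded function of the sample\<close>
    and sigmaA_nonneg: "\<sigma>\<^sub>A \<ge> 0"
    and graph_variance: "\<And>y. (LINT s|Pa. (norm (transpose (As s) *v (A *v y)
        - (transpose A ** R ** A) *v y))\<^sup>2) \<le> \<sigma>\<^sub>A\<^sup>2 * weighted_norm_sq K y"
    \<comment> \<open>(5)\<close>
    and Ls_pos: "L\<^sub>s > 0"
    and mean_smooth:
      "\<And>i y z. integrable (P i)
         (\<lambda>s. (norm (gradient (\<lambda>w. fs i w s) y - gradient (\<lambda>w. fs i w s) z))\<^sup>2)"
      "\<And>i y z. (LINT s|P i. (norm (gradient (\<lambda>w. fs i w s) y - gradient (\<lambda>w. fs i w s) z))\<^sup>2)
         \<le> L\<^sub>s\<^sup>2 * (norm (y - z))\<^sup>2"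
    \<comment> \<open>constants; \<open>\<phi>\<close> is the constant written as a sans-serif f in the source\<close>
    and consts_pos: "a > 0" "b > 0" "c > 0" "d > 0" "e > 0" "\<phi> > 0" "g > 0"
    and S_def: "S = L\<^sub>s\<^sup>2 + L\<^sup>2"
    and PP_def: "PP = \<rho>max\<^sup>2 + \<rho>bmax\<^sup>2"
    and G_def: "G = L\<^sub>s\<^sup>2 + L\<^sup>2 + \<gamma>\<^sup>2 / \<alpha>\<^sup>2 * \<rho>bmax\<^sup>2 + \<gamma>\<^sup>2 / \<alpha>\<^sup>2 * \<rho>max\<^sup>2"
    \<comment> \<open>(i)\<close>
    and i_alpha: "\<alpha> \<le> 1 / (2 * L)" "\<alpha> \<le> sqrt (a\<^sub>x / (64 * S))"
      "\<alpha> \<le> \<gamma> * \<rho>min * sqrt (1 - \<gamma> * \<rho>min) / (sqrt 32 * L)" "\<alpha> \<le> 1 / sqrt 12" "\<alpha> \<le> \<eta>"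
    and i_gamma: "\<gamma> \<le> sqrt (a\<^sub>x / (64 * PP))"
      "\<sigma>\<^sub>A \<noteq> 0 \<Longrightarrow> \<gamma> \<le> 1 / (8 * sqrt a\<^sub>x * \<sigma>\<^sub>A\<^sup>2)"
    and i_rest: "\<eta> * \<beta> \<le> 1 / 12" "\<beta> \<le> 1" "0 < a\<^sub>x" "a\<^sub>x \<le> 1" "\<sigma>\<^sub>A \<noteq> 0 \<Longrightarrow> a\<^sub>l \<le> 1 / \<sigma>\<^sub>A"
    \<comment> \<open>(ii)\<close>
    and ii: "\<alpha> \<le> 1 / (512 * e * S)" "\<alpha> \<le> 1 / (512 * g * n * PP)"
      "64 * \<phi> * \<alpha>\<^sup>2 * n * G \<le> \<alpha> / 24"
    \<comment> \<open>(iii)\<close>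
    and iii: "\<alpha> \<le> a * (\<gamma> * \<rho>min * n / (256 * L\<^sup>2))"
      "\<alpha>\<^sup>2 \<le> a / d * min (\<eta> * \<gamma> * \<rho>min / (768 * L\<^sup>2)) (\<eta> * \<gamma> * \<rho>min / 640)"
      "\<beta>\<^sup>2 \<le> min (a / b * (\<gamma> * \<rho>min\<^sup>2 / (1536 * \<rho>max\<^sup>2))) (a / c * (\<gamma> * \<rho>min / (1536 * \<rho>max\<^sup>2)))"
      "\<alpha>^3 \<le> a / d * (\<eta> * \<gamma> * \<rho>min / (768 * L^4))"
      "\<beta> \<le> a / d * min (\<gamma> * \<rho>min / (512 * \<rho>max\<^sup>2)) (\<gamma> * \<rho>min / 640)"
      "\<alpha>\<^sup>2 \<le> min (a / e * (\<gamma> * \<rho>min * n / (8192 * L\<^sup>2 * S))) (a / g * (\<gamma> * \<rho>min / (8192 * L\<^sup>2 * PP)))"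
      "\<gamma> \<le> min (a / e * (\<rho>min * n / (8192 * \<rho>max\<^sup>2 * S))) (a / g * (\<rho>min / (8192 * \<rho>max\<^sup>2 * PP)))"
      "\<sigma>\<^sub>A \<noteq> 0 \<Longrightarrow> a\<^sub>x\<^sup>2 \<le> a / \<phi> * (\<alpha>\<^sup>2 * \<rho>min / (5120 * \<gamma> * \<sigma>\<^sub>A\<^sup>2))"
      "64 * \<phi> * \<alpha>\<^sup>2 * L\<^sup>2 * G \<le> a * (\<gamma> * \<rho>min / 256)"
      "64 * \<phi> * \<gamma>\<^sup>2 * \<rho>max\<^sup>2 * G \<le> a * (\<gamma> * \<rho>min / 256)"
      "\<sigma>\<^sub>A \<noteq> 0 \<Longrightarrow> a\<^sub>l\<^sup>2 \<le> a / g * (\<gamma> * \<rho>min / (2560 * \<sigma>\<^sub>A\<^sup>2))"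
    \<comment> \<open>(iv)\<close>
    and iv: "\<eta> \<le> d / a * inverse (28 * (1 - \<gamma> * \<rho>min) * (1 - \<gamma> * \<rho>min / 2))"
      "\<beta> + \<alpha> / \<eta> \<le> min (d / b * (\<eta> * \<rho>min / 28)) (d / c * (\<eta> / 28))"
      "\<eta> \<le> min (d / e * (n / (896 * S))) (d / g * (1 / 448))"
      "\<sigma>\<^sub>A \<noteq> 0 \<Longrightarrow> a\<^sub>x\<^sup>2 * \<eta> * \<gamma>\<^sup>2 \<le> d / \<phi> * (\<alpha>\<^sup>2 / (448 * \<sigma>\<^sub>A\<^sup>2))"
      "64 * \<phi> * \<eta>\<^sup>2 * G \<le> d * (\<eta> / 28)"
    \<comment> \<open>(v)\<close>
    and v: "b = \<eta> * (1 - \<gamma> * \<rho>min / 4) / (\<beta> * (1 - \<gamma> * \<rho>min)) * a"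
      "c = (d * (\<gamma> + \<eta> * \<beta>) - 2 * a * \<eta> * \<gamma> * (1 - \<gamma> * \<rho>min / 4) * inverse (1 - \<gamma> * \<rho>min)) / (2 * \<beta>)"
    \<comment> \<open>(vi)\<close>
    and vi: "\<alpha> \<le> e * (a\<^sub>x / 2)"
    \<comment> \<open>(vii)\<close>
    and vii: "\<alpha>\<^sup>2 \<le> \<phi> / a * (a\<^sub>x * \<gamma> * \<rho>min / 64)" "\<alpha>\<^sup>2 \<le> \<phi> / d * (a\<^sub>x * \<eta> / 384)" "\<alpha>\<^sup>2 \<le> \<phi> / d * (a\<^sub>x / 64)"
      "\<alpha>\<^sup>2 * \<beta> \<le> \<phi> / d * (a\<^sub>x / 256)"
      "\<alpha>^4 \<le> \<phi> / d * (a\<^sub>x * \<eta> / 256)"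
      "\<alpha>\<^sup>2 \<le> min (\<phi> / e * (a\<^sub>x * n / (256 * S))) (\<phi> / g * (a\<^sub>x / (256 * (1 + PP))))"
    \<comment> \<open>(viii)\<close>
    and viii: "\<beta> \<le> g / b * (a\<^sub>l * \<rho>min / 24)" "\<beta> \<le> g / c * (a\<^sub>l / 24)" "\<beta> \<le> g / d * (a\<^sub>l / 3)"
    \<comment> \<open>(ix)\<close>
    and ix: "\<alpha>\<^sup>2 \<le> min (\<eta> * \<rho>min / (96 * b * n * L\<^sup>2)) (\<eta> / (96 * c * n * L\<^sup>2))"
      "\<alpha> \<le> \<eta> / (12 * d * n * L\<^sup>2)"
    \<comment> \<open>the uniformly sampled iterate\<close>
    and T_pos: "T \<ge> 1"
    and tau_distr: "distr M (count_space UNIV) \<tau> = measure_pmf (pmf_of_set {0..<T})"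
    and tau_indep: "indep_rv M (count_space UNIV) \<tau> (borel \<Otimes>\<^sub>M (\<Pi>\<^sub>M t\<in>{1..}. N))
        (\<lambda>\<omega>. (init \<omega>, \<lambda>t\<in>{1..}. \<xi> t \<omega>))"
    \<comment> \<open>the initial value of the potential; its expectation is finite\<close>
    and v0_def: "v\<^sub>0 = (\<lambda>\<omega>. transpose A *v l 0 \<omega>
        + (\<alpha> / \<eta>) *\<^sub>R stacked_gradient f (ones_kron *v avg (x 0 \<omega>)))"
    and Phi0_def: "\<Phi>\<^sub>0 = (\<lambda>\<omega>. F (avg (x 0 \<omega>)) + a * weighted_norm_sq K (x 0 \<omega>)
        + weighted_norm_sq (b *\<^sub>R Q + c *\<^sub>R K) (v\<^sub>0 \<omega>)
        + d * weighted_inner K (x 0 \<omega>) (v\<^sub>0 \<omega>)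
        + e * (norm ((1 / n) *\<^sub>R (transpose ones_kron *v m\<^sub>x 0 \<omega>)
                 - (1 / n) *\<^sub>R (transpose ones_kron *v stacked_gradient f (x 0 \<omega>))))\<^sup>2
        + \<phi> * (norm (m\<^sub>x 0 \<omega> - lagrangian_gradient \<alpha> \<eta> \<gamma> A f (R ** A) (x 0 \<omega>) (l 0 \<omega>)))\<^sup>2
        + g * (norm (transpose A *v m\<^sub>l 0 \<omega> - (transpose A ** R ** A) *v x 0 \<omega>))\<^sup>2)"
    and Phi0_int: "integrable M \<Phi>\<^sub>0"
    and F0_def: "F0 = (LINT \<omega>|M. \<Phi>\<^sub>0 \<omega>)"
  shows "integrable M (\<lambda>\<omega>. (norm (gradient F (avg (x (\<tau> \<omega>) \<omega>))))\<^sup>2) \<and>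
         (LINT \<omega>|M. (norm (gradient F (avg (x (\<tau> \<omega>) \<omega>))))\<^sup>2)
           \<le> (F0 - fstar) / (real T * \<alpha> / 4)
             + (e * (2 * a\<^sub>x\<^sup>2) + \<phi> * (4 * a\<^sub>x\<^sup>2 * n)) * \<sigma>b2 / (\<alpha> / 4) \<and>
         integrable M (\<lambda>\<omega>. \<Sum>i\<in>UNIV. (norm (block (x (\<tau> \<omega>) \<omega>) i - avg (x (\<tau> \<omega>) \<omega>)))\<^sup>2) \<and>
         (LINT \<omega>|M. (\<Sum>i\<in>UNIV. (norm (block (x (\<tau> \<omega>) \<omega>) i - avg (x (\<tau> \<omega>) \<omega>)))\<^sup>2))
           \<le> (F0 - fstar) / (real T * a * \<gamma> * \<rho>min / 8)
             + (e * (2 * a\<^sub>x\<^sup>2) + \<phi> * (4 * a\<^sub>x\<^sup>2 * n)) * \<sigma>b2 / (a * \<gamma> * \<rho>min / 8)"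
proof -
  have tAs: "transpose (As s) *v y = transpose A *v (Im s *v y)" if "s \<in> space Pa" for s y
  proof -
    have "Im s $ p $ q = Im s $ q $ p" for p q
      using Im_binary[OF that] unfolding binary_diagonal_def by (cases "p = q") (simp, metis)
    then have "transpose (Im s) = Im s" by (simp add: transpose_def vec_eq_iff del: split_paired_All)
    then show ?thesis by (simp add: As_def matrix_transpose_mul flip: matrix_vector_mul_assoc)
  qed
  have gv: "(LINT s|Pa. (norm (transpose A *v (Im s *v (A *v y)) - (transpose A ** R ** A) *v y))\<^sup>2)
      \<le> \<sigma>\<^sub>A\<^sup>2 * (norm (consensus *v y))\<^sup>2" for y
  proof -
    have "(LINT s|Pa. (norm (transpose A *v (Im s *v (A *v y)) - (transpose A ** R ** A) *v y))\<^sup>2)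
      = (LINT s|Pa. (norm (transpose (As s) *v (A *v y) - (transpose A ** R ** A) *v y))\<^sup>2)"
      by (intro Bochner_Integration.integral_cong) (simp_all add: tAs)
    then show ?thesis using graph_variance[of y] by (simp add: K_def weighted_norm_sq_consensus)
  qed
  have rb: "\<rho>bmax > 0" using rho by linarith
  have n1: "real CARD('n) \<ge> 1" by (simp add: Suc_le_eq)
  note facts = assms[unfolded n_def K_def]
  interpret st: fspda_storm \<alpha> \<eta> \<gamma> \<beta> a\<^sub>x a\<^sub>l L L\<^sub>s \<sigma>\<^sub>A \<rho>max \<rho>min \<rho>bmax a b c d e \<phi> g S PP G A P Pa Im R f fs \<sigma> fstar
    by (intro fspda_storm.intro storm_parameters.intro fspda_storm_axioms.intro; fact facts gv rb n1)
  have F: "st.F = F" using F_def by (simp add: st.F_def[abs_def] n_def)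
  have \<sigma>b2: "st.\<sigma>b2 = \<sigma>b2" using sigmab2_def by (simp add: st.\<sigma>b2_def n_def)
  have N: "st.N = N" using N_def by (simp add: st.N_def)
  have Q: "st.Q = Q" using Q_def by (simp add: st.Q_def st.C_def)
  define Sq where "Sq t \<omega> = (x t \<omega>, l t \<omega>, m\<^sub>x t \<omega>, m\<^sub>l t \<omega>)" for t \<omega>
  have init: "Sq 0 = init" by (simp add: init_def Sq_def fun_eq_iff)
  have chain: "sampled_chain M st.N borel \<xi> Sq st.step"
  proof (intro sampled_chain.intro sampled_chain_axioms.intro)
    show "prob_space M" by (rule M_prob)
    show "prob_space st.N" by (rule st.NN.prob_space_axioms)
    show "prob_space.indep_vars M (\<lambda>_. st.N) \<xi> {1..}" unfolding N by (rule xi_indep)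
    show "distr M st.N (\<xi> t) = st.N" if "t \<ge> 1" for t unfolding N by (rule xi_distr[OF that])
    show "indep_rv M borel (Sq 0) (\<Pi>\<^sub>M t\<in>{1..}. st.N) (\<lambda>\<omega>. \<lambda>t\<in>{1..}. \<xi> t \<omega>)" unfolding N init by (rule init_indep)
    show "st.step \<in> measurable (borel \<Otimes>\<^sub>M st.N) borel" by (rule st.measurable_step)
    show "Sq (Suc t) \<omega> = st.step (Sq t \<omega>, \<xi> (Suc t) \<omega>)" if "\<omega> \<in> space M" for t \<omega>
      using x_step[OF that] l_step[OF that] mx_step[OF that] ml_step[OF that]
      by (simp add: Sq_def st.step_def st.sampled_lagrangian_gradient_def As_def)
  qed
  have \<Phi>: "st.potential (Sq 0 \<omega>) \<le> \<Phi>\<^sub>0 \<omega>" for \<omega>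
  proof -
    have v0: "v\<^sub>0 \<omega> = st.dual (x 0 \<omega>) (l 0 \<omega>)" by (simp add: v0_def st.dual_def)
    have q: "a * weighted_norm_sq K (x 0 \<omega>) + weighted_norm_sq (b *\<^sub>R Q + c *\<^sub>R K) (v\<^sub>0 \<omega>)
        + d * weighted_inner K (x 0 \<omega>) (v\<^sub>0 \<omega>) = st.quad (x 0 \<omega>) (v\<^sub>0 \<omega>)"
      using st.weighted_form_eq_quad unfolding Q K_def by simp
    have ea: "(1 / n) *\<^sub>R (transpose ones_kron *v m\<^sub>x 0 \<omega>) - (1 / n) *\<^sub>R (transpose ones_kron *v stacked_gradient f (x 0 \<omega>))
        = avg (st.grad_error (x 0 \<omega>) (l 0 \<omega>) (m\<^sub>x 0 \<omega>))"
      unfolding n_def avg_eq_ones_kron using st.avg_momentum[of "m\<^sub>x 0 \<omega>" "x 0 \<omega>" "l 0 \<omega>"] by simp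
    show ?thesis
      using st.potential_bounds(2)[of "x 0 \<omega>" "l 0 \<omega>" "m\<^sub>x 0 \<omega>" "m\<^sub>l 0 \<omega>"] q
      unfolding Phi0_def Sq_def ea F v0 by (simp add: st.grad_error_def st.graph_error_def st.C_def)
  qed
  have tau: "indep_rv M (count_space UNIV) \<tau> (borel \<Otimes>\<^sub>M (\<Pi>\<^sub>M t\<in>{1..}. st.N)) (\<lambda>\<omega>. (Sq 0 \<omega>, \<lambda>t\<in>{1..}. \<xi> t \<omega>))"
    unfolding N init by (rule tau_indep)
  note bounds = st.sampled_iterate_bounds[OF chain tau_distr T_pos tau Phi0_int \<Phi>, folded F0_def, unfolded F \<sigma>b2]
  have cons: "(\<Sum>i\<in>UNIV. (norm (block y i - avg y))\<^sup>2) = (norm (consensus *v y))\<^sup>2" for y :: "real^('n \<times> 'd)"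
    by (simp add: norm_sq_blocks)
  have split: "(B + real T * s) / (real T * k) = B / (real T * k) + s / k" for B s k :: real
    using T_pos by (simp add: add_divide_distrib)
  have z: "a * st.z / 8 = a * \<gamma> * \<rho>min / 8" by (simp add: st.z_def)
  show ?thesis
    using bounds unfolding cons split z by (simp add: Sq_def n_def)
qed

end
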